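(* Let $\chi_2\in L^\infty(0,1)$ be real-valued, $q\in C[0,1]$ real-valued, and $0\neq f\in L^2(0,1)$. For any $\rho,\delta>0$ there exists $c=c(\rho,\delta,f,\chi_2,q)>0$ such that if $\chi_1\in L^\infty(0,1)$ is real-valued with $\|\chi_1\|_{L^\infty}<c$, then for every $\omega\in\mathcal{G}_{\rho,\delta}$ the equation $$T^\diamond_\omega(\bm{u})=\bm{f},\qquad \bm{f}=(0,f),$$ has a solution $\bm{u}\in X_\diamond$.
   Context: All functions in $L^2=L^2(0,1)$ and $H^2=H^2(0,1)$ are complex-valued. $H^2$ carries the inner product $\langle u,v\rangle_{H^2}=\langle u,v\rangle_{L^2}+\langle u'',v''\rangle_{L^2}$. $H^2_\diamond=\{u\in H^2:u(0)=0\}$ and $X_\diamond=H^2_\diamond\times L^2$, with inner product $\langle\bm{u},\bm{\phi}\rangle_{X_\diamond}=\langle u_1,\phi_1\rangle_{H^2}+\langle u_2,\phi_2\rangle_{L^2}$. For $\omega\in\mathbb{C}$, the (nonlinear) operator $T^\diamond_\omega:X_\diamond\to X_\diamond$ is defined via the Riesz representation theorem by requiring, for all $\bm{u},\bm{\phi}\in X_\diamond$, $$\langle T^\diamond_\omega(\bm{u}),\bm{\phi}\rangle_{X_\diamond}=\int_0^1\left[(u_1''+\omega^2qu_1)\overline{\phi}_2+\frac{\omega^2}{x}\chi_1u_2\overline{u}_1\overline{\phi}_2\right]dx+\int_0^1\left[u_2(\overline{\phi}_1''+4\omega^2q\overline{\phi}_1)+\frac{\omega^2}{x}\chi_2u_1^2\overline{\phi}_1\right]dx.$$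 For $\omega\in\mathbb{C}$ let $z_\omega,\widetilde z_\omega$ be the solutions on $(0,1)$ of $z''+\omega^2qz=0$ with $z_\omega(0)=0,\ z_\omega'(0)=1$ and $\widetilde z_\omega(0)=1,\ \widetilde z_\omega'(0)=0$. Let $a_\omega$ be the solution of $a_\omega''+\omega^2qa_\omega=f$ with $a_\omega(0)=a_\omega'(0)=0$, i.e. $a_\omega(x)=\int_0^x[z_\omega(x)\widetilde z_\omega(t)-z_\omega(t)\widetilde z_\omega(x)]f(t)\,dt$. Set $$\zeta(\omega)=\left(\int_0^1z_\omega a_\omega z_{2\omega}\frac{\chi_2\,dx}{x}\right)^2-\int_0^1z_\omega^2z_{2\omega}\frac{\chi_2\,dx}{x}\cdot\int_0^1a_\omega^2z_{2\omega}\frac{\chi_2\,dx}{x},$$ $$\Lambda=\Lambda(f,q,\chi_2)=\{\omega\in\mathbb{C}:\zeta(\omega)=0\}\cup\{0\},$$ and, for $\rho,\delta>0$, $$\mathcal{G}_{\rho,\delta}=\{\omega\in\mathbb{C}:|\omega|\le\rho\ \text{ and }\ \mathrm{dist}(\omega,\Lambda)\ge\delta\}.$$ *)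

theory Defs
  imports "HOL-Analysis.Analysis" "HOL-Probability.Essential_Supremum"
begin

abbreviation I01 :: "real measure" where
  "I01 \<equiv> lebesgue_on {0<..<1}"

section \<open>Function spaces on the unit interval\<close>

text \<open>Elements of the function spaces are represented by functions on the real line, of which
  only the values on the unit interval matter; functions representing the same class agree
  almost everywhere.\<close>

definition L2 :: "(real \<Rightarrow> complex) set" where
  "L2 = {u. u \<in> borel_measurable I01 \<and> integrable I01 (\<lambda>x. (cmod (u x))\<^sup>2)}"

definition Linf_norm :: "(real \<Rightarrow> real) \<Rightarrow> ereal" where
  "Linf_norm chi = esssup I01 (\<lambda>x. ereal \<bar>chi x\<bar>)"

definition Linf :: "(real \<Rightarrow> real) set" where
  "Linf = {chi. chi \<in> borel_measurable I01 \<and> Linf_norm chi < \<infinity>}"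

definition test_functions :: "(real \<Rightarrow> real) set" where
  "test_functions = {\<phi>. (\<forall>n x. (deriv ^^ n) \<phi> field_differentiable (at x)) \<and>
     compact (closure {x. \<phi> x \<noteq> 0}) \<and> closure {x. \<phi> x \<noteq> 0} \<subseteq> {0<..<1}}"

definition is_weak_deriv :: "nat \<Rightarrow> (real \<Rightarrow> complex) \<Rightarrow> (real \<Rightarrow> complex) \<Rightarrow> bool" where
  "is_weak_deriv n u v \<longleftrightarrow> (\<forall>\<phi>\<in>test_functions.
     (LINT x|I01. u x * of_real ((deriv ^^ n) \<phi> x)) =
     (-1) ^ n * (LINT x|I01. v x * of_real (\<phi> x)))"

text \<open>Weak derivatives are determined up to null sets, so the choice below is immaterial
  under an integral.\<close>

definition weak_deriv :: "nat \<Rightarrow> (real \<Rightarrow> complex) \<Rightarrow> real \<Rightarrow> complex" where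
  "weak_deriv n u = (SOME v. v \<in> L2 \<and> is_weak_deriv n u v)"

text \<open>Every class in the Sobolev space \<open>H\<^sup>2(0,1)\<close> has a unique representative that is continuous
  on the closed interval. Only these representatives are admitted, so that the boundary value
  at \<open>0\<close> is the value of the function there.\<close>

definition H2 :: "(real \<Rightarrow> complex) set" where
  "H2 = {u \<in> L2. continuous_on {0..1} u \<and> (\<forall>n\<in>{1,2}. \<exists>v\<in>L2. is_weak_deriv n u v)}"

definition H2_diamond :: "(real \<Rightarrow> complex) set" where
  "H2_diamond = {u \<in> H2. u 0 = 0}"

definition X_diamond :: "((real \<Rightarrow> complex) \<times> (real \<Rightarrow> complex)) set" where
  "X_diamond = H2_diamond \<times> L2"

definition inner_L2 :: "(real \<Rightarrow> complex) \<Rightarrow> (real \<Rightarrow> complex) \<Rightarrow> complex" where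
  "inner_L2 u v = (LINT x|I01. u x * cnj (v x))"

definition inner_H2 :: "(real \<Rightarrow> complex) \<Rightarrow> (real \<Rightarrow> complex) \<Rightarrow> complex" where
  "inner_H2 u v = inner_L2 u v + inner_L2 (weak_deriv 2 u) (weak_deriv 2 v)"

definition inner_X ::
  "(real \<Rightarrow> complex) \<times> (real \<Rightarrow> complex) \<Rightarrow> (real \<Rightarrow> complex) \<times> (real \<Rightarrow> complex) \<Rightarrow> complex" where
  "inner_X u \<phi> = inner_H2 (fst u) (fst \<phi>) + inner_L2 (snd u) (snd \<phi>)"

definition eq_X ::
  "(real \<Rightarrow> complex) \<times> (real \<Rightarrow> complex) \<Rightarrow> (real \<Rightarrow> complex) \<times> (real \<Rightarrow> complex) \<Rightarrow> bool" where
  "eq_X u v \<longleftrightarrow> (AE x in I01. fst u x = fst v x) \<and> (AE x in I01. snd u x = snd v x)"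

section \<open>The operator\<close>

definition T_form ::
  "(real \<Rightarrow> real) \<Rightarrow> (real \<Rightarrow> real) \<Rightarrow> (real \<Rightarrow> real) \<Rightarrow> complex \<Rightarrow>
   (real \<Rightarrow> complex) \<times> (real \<Rightarrow> complex) \<Rightarrow> (real \<Rightarrow> complex) \<times> (real \<Rightarrow> complex) \<Rightarrow> complex" where
  "T_form chi\<^sub>1 chi\<^sub>2 q \<omega> = (\<lambda>(u\<^sub>1, u\<^sub>2) (\<phi>\<^sub>1, \<phi>\<^sub>2).
     (LINT x|I01. (weak_deriv 2 u\<^sub>1 x + \<omega>\<^sup>2 * of_real (q x) * u\<^sub>1 x) * cnj (\<phi>\<^sub>2 x)
        + \<omega>\<^sup>2 / of_real x * of_real (chi\<^sub>1 x) * u\<^sub>2 x * cnj (u\<^sub>1 x) * cnj (\<phi>\<^sub>2 x)) +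
     (LINT x|I01. u\<^sub>2 x * (cnj (weak_deriv 2 \<phi>\<^sub>1 x) + 4 * \<omega>\<^sup>2 * of_real (q x) * cnj (\<phi>\<^sub>1 x))
        + \<omega>\<^sup>2 / of_real x * of_real (chi\<^sub>2 x) * (u\<^sub>1 x)\<^sup>2 * cnj (\<phi>\<^sub>1 x)))"

text \<open>For \<open>u\<close> in \<open>X_diamond\<close> the form is bounded and antilinear in \<open>\<phi>\<close>, so its Riesz representative
  exists and is unique up to \<open>eq_X\<close>; values of \<open>T_diamond\<close> are to be compared by \<open>eq_X\<close>.\<close>

definition T_diamond ::
  "(real \<Rightarrow> real) \<Rightarrow> (real \<Rightarrow> real) \<Rightarrow> (real \<Rightarrow> real) \<Rightarrow> complex \<Rightarrow>
   (real \<Rightarrow> complex) \<times> (real \<Rightarrow> complex) \<Rightarrow> (real \<Rightarrow> complex) \<times> (real \<Rightarrow> complex)" where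
  "T_diamond chi\<^sub>1 chi\<^sub>2 q \<omega> u =
     (SOME g. g \<in> X_diamond \<and> (\<forall>\<phi>\<in>X_diamond. inner_X g \<phi> = T_form chi\<^sub>1 chi\<^sub>2 q \<omega> u \<phi>))"

section \<open>The exceptional set\<close>

definition solves_ivp ::
  "(real \<Rightarrow> real) \<Rightarrow> complex \<Rightarrow> complex \<Rightarrow> complex \<Rightarrow> (real \<Rightarrow> complex) \<Rightarrow> bool" where
  "solves_ivp q \<omega> \<alpha> \<beta> z \<longleftrightarrow> (\<exists>z' z''.
     (\<forall>x\<in>{0..1}. (z has_vector_derivative z' x) (at x within {0..1}) \<and>
                  (z' has_vector_derivative z'' x) (at x within {0..1}) \<and>
                  z'' x + \<omega>\<^sup>2 * of_real (q x) * z x = 0) \<and>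
     z 0 = \<alpha> \<and> z' 0 = \<beta>)"

text \<open>For \<open>q\<close> continuous on \<open>[0,1]\<close> the solutions are unique on \<open>[0,1]\<close>, and their values elsewhere
  are never used.\<close>

definition z_sol :: "(real \<Rightarrow> real) \<Rightarrow> complex \<Rightarrow> real \<Rightarrow> complex" where
  "z_sol q \<omega> = (SOME z. solves_ivp q \<omega> 0 1 z)"

definition zt_sol :: "(real \<Rightarrow> real) \<Rightarrow> complex \<Rightarrow> real \<Rightarrow> complex" where
  "zt_sol q \<omega> = (SOME z. solves_ivp q \<omega> 1 0 z)"

text \<open>The variation-of-constants formula for the solution of \<open>a'' + \<omega>\<^sup>2 q a = f\<close> with zero Cauchy
  data at \<open>0\<close>; since \<open>f\<close> is only square integrable, \<open>a''\<close> exists merely almost everywhere.\<close>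

definition a_sol :: "(real \<Rightarrow> complex) \<Rightarrow> (real \<Rightarrow> real) \<Rightarrow> complex \<Rightarrow> real \<Rightarrow> complex" where
  "a_sol f q \<omega> x = (LINT t|lebesgue_on {0<..<x}.
     (z_sol q \<omega> x * zt_sol q \<omega> t - z_sol q \<omega> t * zt_sol q \<omega> x) * f t)"

definition zeta_det :: "(real \<Rightarrow> complex) \<Rightarrow> (real \<Rightarrow> real) \<Rightarrow> (real \<Rightarrow> real) \<Rightarrow> complex \<Rightarrow> complex" where
  "zeta_det f q chi\<^sub>2 \<omega> =
     (LINT x|I01. z_sol q \<omega> x * a_sol f q \<omega> x * z_sol q (2 * \<omega>) x * of_real (chi\<^sub>2 x / x))\<^sup>2
     - (LINT x|I01. (z_sol q \<omega> x)\<^sup>2 * z_sol q (2 * \<omega>) x * of_real (chi\<^sub>2 x / x))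
       * (LINT x|I01. (a_sol f q \<omega> x)\<^sup>2 * z_sol q (2 * \<omega>) x * of_real (chi\<^sub>2 x / x))"

definition Lambda_set :: "(real \<Rightarrow> complex) \<Rightarrow> (real \<Rightarrow> real) \<Rightarrow> (real \<Rightarrow> real) \<Rightarrow> complex set" where
  "Lambda_set f q chi\<^sub>2 = {\<omega>. zeta_det f q chi\<^sub>2 \<omega> = 0} \<union> {0}"

definition G_set ::
  "(real \<Rightarrow> complex) \<Rightarrow> (real \<Rightarrow> real) \<Rightarrow> (real \<Rightarrow> real) \<Rightarrow> real \<Rightarrow> real \<Rightarrow> complex set" where
  "G_set f q chi\<^sub>2 \<rho> \<delta> = {\<omega>. cmod \<omega> \<le> \<rho> \<and> infdist \<omega> (Lambda_set f q chi\<^sub>2) \<ge> \<delta>}"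

end

(* Eliminate u2: the second component is the solution of a linear problem with Cauchy data at 1 and
   right-hand side quadratic in u1, and the remaining condition u2(0) = 0 reads
   "integral of chi2/x * z_{2 omega} * u1^2 = 0". The first component is u1 = s z_omega + a_omega - p with a
   scalar s and p = O(chi1). For chi1 = 0 the condition is a quadratic equation in s with discriminant
   4 zeta(omega), so it has a simple root when zeta(omega) <> 0. By continuity of zeta on the compact set
   G_{rho,delta} the root is uniformly simple there, and for small chi1 a Newton step in s combined with
   the fixed-point map for p is a contraction. *)

theory Submission
  imports Defs
begin

section \<open>Test functions\<close>

text \<open>Three obstacles shape the argument. The factor 1/x is not integrable, so bounds are kept
  in the form |u(x)| \<le> R x, which makes chi u / x bounded; this is why solutions and the Green
  kernel are estimated with a factor x. Since f is merely square integrable and \<open>H2\<close> is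
  defined by weak derivatives, differential equations are replaced by Volterra integral equations,
  and a function of \<open>H2_diamond\<close> is identified with c x plus the twofold integral of
  its second derivative. Both c and that derivative are free in a test function: the derivative
  forces the Cauchy data of u2 at 1, and c forces the extra condition u2(0) = 0. Finally, the
  leading coefficient of the quadratic in s may vanish or be small on the frequency set, so a root
  formula that divides by it would give no uniform bound on s. Moreover \<open>T_diamond\<close> is
  a choice among Riesz representatives; the equation is therefore proved in variational form, and
  uniqueness of the representative is a separate step.\<close>

definition smooth :: "(real \<Rightarrow> real) \<Rightarrow> bool" where
  "smooth f \<longleftrightarrow> (\<forall>n x. (deriv ^^ n) f field_differentiable (at x))"

text \<open>A class in which every member has a derivative inside the class contains all iterated
  derivatives of its members. This replaces formulas for the n-th derivative: it suffices to guess a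
  class stable under differentiation.\<close>

lemma smooth_coinduct:
  assumes "f \<in> S" and S: "\<And>f. f \<in> S \<Longrightarrow> \<exists>f'\<in>S. \<forall>x. (f has_real_derivative f' x) (at x)"
  shows "smooth f"
proof -
  have D: "deriv g \<in> S \<and> g field_differentiable (at x)" if "g \<in> S" for g x
  proof -
    obtain g' where g': "g' \<in> S" "\<forall>x. (g has_real_derivative g' x) (at x)"
      using S \<open>g \<in> S\<close> by blast
    then have "deriv g = g'" by (auto intro!: ext DERIV_imp_deriv)
    with g' show ?thesis by (auto simp: field_differentiable_def)
  qed
  have "(deriv ^^ n) f \<in> S" for n
    by (induction n) (auto simp: \<open>f \<in> S\<close> D)
  then show ?thesis unfolding smooth_def using D by blast
qed

lemma smooth_deriv:
  assumes "smooth f"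
  shows "smooth (deriv f)" "(f has_real_derivative deriv f x) (at x)"
proof -
  have "(deriv ^^ n) (deriv f) = (deriv ^^ Suc n) f" for n
    by (simp add: funpow_swap1)
  with assms show "smooth (deriv f)" unfolding smooth_def by metis
  have "(deriv ^^ 0) f field_differentiable (at x)" using assms unfolding smooth_def by blast
  then show "(f has_real_derivative deriv f x) (at x)"
    by (simp add: field_differentiable_derivI)
qed

lemma smooth_antiderivative:
  assumes "smooth g" "\<And>x. (f has_real_derivative g x) (at x)"
  shows "smooth f"
proof (rule smooth_coinduct[of f "insert f {h. smooth h}"])
  fix h assume "h \<in> insert f {h. smooth h}"
  then show "\<exists>f'\<in>insert f {h. smooth h}. \<forall>x. (h has_real_derivative f' x) (at x)"
    using assms smooth_deriv by blast
qed auto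

lemma smooth_add:
  assumes "smooth f" "smooth g" shows "smooth (\<lambda>x. f x + g x)"
proof (rule smooth_coinduct[of _ "{\<lambda>x. f x + g x | f g. smooth f \<and> smooth g}"])
  fix h assume "h \<in> {\<lambda>x. f x + g x | f g. smooth f \<and> smooth g}"
  then obtain f g where h: "h = (\<lambda>x. f x + g x)" "smooth f" "smooth g" by blast
  show "\<exists>f'\<in>{\<lambda>x. f x + g x | f g. smooth f \<and> smooth g}. \<forall>x. (h has_real_derivative f' x) (at x)"
    unfolding h
    by (rule bexI[of _ "\<lambda>x. deriv f x + deriv g x"])
       (use h smooth_deriv in \<open>auto intro!: derivative_eq_intros\<close>)
qed (use assms in blast)

text \<open>The Leibniz rule leads out of the products of two smooth functions, but not out of their
  finite sums; these form the stable class needed for \<open>smooth_coinduct\<close>.\<close>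

inductive prod_sum :: "(real \<Rightarrow> real) \<Rightarrow> bool" where
  prod: "smooth f \<Longrightarrow> smooth g \<Longrightarrow> prod_sum (\<lambda>x. f x * g x)"
| sum: "prod_sum f \<Longrightarrow> prod_sum g \<Longrightarrow> prod_sum (\<lambda>x. f x + g x)"

lemma smooth_mult:
  assumes "smooth f" "smooth g" shows "smooth (\<lambda>x. f x * g x)"
proof (rule smooth_coinduct[of _ "{f. prod_sum f}"])
  fix h assume "h \<in> {f. prod_sum f}"
  then have "prod_sum h" by simp
  then have "\<exists>h'. prod_sum h' \<and> (\<forall>x. (h has_real_derivative h' x) (at x))"
  proof induction
    case (prod f g)
    then have "prod_sum (\<lambda>x. deriv f x * g x + f x * deriv g x)"
      by (intro prod_sum.intros smooth_deriv)
    moreover have "((\<lambda>x. f x * g x) has_real_derivative deriv f x * g x + f x * deriv g x) (at x)" for x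
      using prod smooth_deriv by (auto intro!: derivative_eq_intros)
    ultimately show ?case by blast
  next
    case (sum f g)
    then obtain f' g' where "prod_sum f'" "prod_sum g'"
      "\<forall>x. (f has_real_derivative f' x) (at x)" "\<forall>x. (g has_real_derivative g' x) (at x)" by blast
    then show ?case
      by (intro exI[of _ "\<lambda>x. f' x + g' x"]) (auto intro!: prod_sum.intros derivative_eq_intros)
  qed
  then show "\<exists>f'\<in>{f. prod_sum f}. \<forall>x. (h has_real_derivative f' x) (at x)" by blast
qed (use assms prod_sum.prod in blast)

lemma smooth_const: "smooth (\<lambda>x. c)"
proof (rule smooth_coinduct[of _ "range (\<lambda>c x. c)"])
  fix f :: "real \<Rightarrow> real" assume "f \<in> range (\<lambda>c x. c)"
  then obtain c where "f = (\<lambda>x. c)" by blast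
  then show "\<exists>f'\<in>range (\<lambda>c x. c). \<forall>x. (f has_real_derivative f' x) (at x)"
    by (intro bexI[of _ "\<lambda>x. 0"]) auto
qed auto

lemma smooth_affine:
  assumes "smooth f" shows "smooth (\<lambda>x. f (k * x + d))"
\<comment> \<open>The leading factor c absorbs the factors k produced by the chain rule.\<close>
proof (rule smooth_coinduct[of _ "{\<lambda>x. c * f (k * x + d) | c f. smooth f}"])
  fix h assume "h \<in> {\<lambda>x. c * f (k * x + d) | c f. smooth f}"
  then obtain f c where h: "h = (\<lambda>x. c * f (k * x + d))" "smooth f" by blast
  show "\<exists>f'\<in>{\<lambda>x. c * f (k * x + d) | c f. smooth f}. \<forall>x. (h has_real_derivative f' x) (at x)"
    unfolding h
  proof (rule bexI[of _ "\<lambda>x. (c * k) * deriv f (k * x + d)"], intro allI)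
    fix x
    have "((\<lambda>x. f (k * x + d)) has_real_derivative deriv f (k * x + d) * k) (at x)"
      by (rule DERIV_chain2[OF smooth_deriv(2)[OF h(2)]]) (auto intro!: derivative_eq_intros)
    then show "((\<lambda>x. c * f (k * x + d)) has_real_derivative c * k * deriv f (k * x + d)) (at x)"
      by (auto intro!: derivative_eq_intros)
  qed (use h smooth_deriv(1) in blast)
next
  show "(\<lambda>x. f (k * x + d)) \<in> {\<lambda>x. c * f (k * x + d) | c f. smooth f}"
    using assms by (auto intro!: exI[of _ 1] exI[of _ f])
qed

section \<open>Bump functions built from exp(-1/x)\<close>

definition flat :: "real poly \<Rightarrow> real \<Rightarrow> real" where
  "flat p x = (if x > 0 then poly p (1 / x) * exp (- (1 / x)) else 0)"

lemma tendsto_poly_exp: "((\<lambda>y. poly p y * exp (- y)) \<longlongrightarrow> (0::real)) at_top"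
proof -
  have "((\<lambda>y. \<Sum>i\<le>degree p. coeff p i * (y ^ i / exp y)) \<longlongrightarrow> 0) at_top"
    by (intro tendsto_null_sum tendsto_mult_right_zero tendsto_power_div_exp_0)
  moreover have "(\<lambda>y. \<Sum>i\<le>degree p. coeff p i * (y ^ i / exp y)) = (\<lambda>y. poly p y * exp (- y))"
    by (simp add: poly_altdef exp_minus sum_distrib_left divide_inverse mult_ac)
  ultimately show ?thesis by simp
qed

lemma flat_tendsto: "(flat p \<longlongrightarrow> 0) (at 0)"
proof -
  have "((\<lambda>x. poly p (inverse x) * exp (- inverse x)) \<longlongrightarrow> 0) (at_right 0)"
    by (rule filterlim_compose[OF tendsto_poly_exp filterlim_inverse_at_top_right])
  then have R: "(flat p \<longlongrightarrow> 0) (at_right 0)"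
    by (rule tendsto_cong[THEN iffD1, rotated])
       (auto simp: flat_def eventually_at_filter divide_inverse)
  have L: "(flat p \<longlongrightarrow> 0) (at_left 0)"
    by (rule tendsto_cong[THEN iffD1, rotated], rule tendsto_const)
       (auto simp: flat_def eventually_at_filter)
  show ?thesis using L R by (simp add: filterlim_at_split)
qed

text \<open>With y = 1/x the chain rule turns p(y) exp(-y) into y^2 (p(y) - p'(y)) exp(-y), and the
  two \<open>pCons 0\<close> are the factor y^2. Allowing all polynomials thus makes the family
  stable under differentiation.\<close>

lemma flat_deriv:
  "(flat p has_real_derivative flat (pCons 0 (pCons 0 (p - pderiv p))) x) (at x)"
proof -
  consider "x > 0" | "x < 0" | "x = 0" by linarith
  then show ?thesis
  proof cases
    case 1
    have "((\<lambda>x. poly p (1 / x) * exp (- (1 / x))) has_real_derivative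
            flat (pCons 0 (pCons 0 (p - pderiv p))) x) (at x)"
      using 1 by (auto intro!: derivative_eq_intros poly_DERIV[THEN DERIV_chain2]
          simp: flat_def field_simps power2_eq_square)
    then show ?thesis
      by (rule has_field_derivative_transform_within_open[where S = "{0<..}"])
         (use 1 in \<open>auto simp: flat_def\<close>)
  next
    case 2
    have "((\<lambda>x. 0) has_real_derivative 0) (at x)" by simp
    then have "(flat p has_real_derivative 0) (at x)"
      by (rule has_field_derivative_transform_within_open[where S = "{..<0}"])
         (use 2 in \<open>auto simp: flat_def\<close>)
    with 2 show ?thesis by (simp add: flat_def)
  next
    case 3
    \<comment> \<open>Dividing by h replaces p(y) by y p(y), so the difference quotient at 0 is
      again a member of the family.\<close>
    have "((\<lambda>h. flat (pCons 0 p) h) \<longlongrightarrow> 0) (at 0)" by (rule flat_tendsto)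
    then have "((\<lambda>h. (flat p (0 + h) - flat p 0) / h) \<longlongrightarrow> 0) (at 0)"
      by (rule tendsto_cong[THEN iffD1, rotated])
         (auto simp: flat_def eventually_at_filter field_simps)
    then show ?thesis using 3 by (simp add: DERIV_def flat_def)
  qed
qed

lemma smooth_flat: "smooth (flat p)"
  by (rule smooth_coinduct[of _ "range flat"]) (use flat_deriv in blast)+

text \<open>The set where it is nonzero is (a, b) for every n, while the factor n + 1 drives the
  values there to 1, because \<open>flat 1\<close> tends to 1 at infinity. The sequence approximates
  the indicator of (a, b).\<close>

definition bump :: "real \<Rightarrow> real \<Rightarrow> nat \<Rightarrow> real \<Rightarrow> real" where
  "bump a b n x = flat 1 (real (Suc n) * (x - a)) * flat 1 (real (Suc n) * (b - x))"

lemma smooth_bump: "smooth (bump a b n)"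
proof -
  have "smooth (\<lambda>x. flat 1 (real (Suc n) * x + - real (Suc n) * a) *
                     flat 1 (- real (Suc n) * x + real (Suc n) * b))"
    by (intro smooth_mult smooth_affine smooth_flat)
  then show ?thesis unfolding bump_def[abs_def] by (simp add: algebra_simps)
qed

lemma flat_1_bounds: "0 \<le> flat 1 x" "flat 1 x \<le> 1"
  by (auto simp: flat_def)

lemma bump_bounds: "0 \<le> bump a b n x" "bump a b n x \<le> 1" "bump a b n x \<noteq> 0 \<longleftrightarrow> a < x \<and> x < b"
proof -
  show "0 \<le> bump a b n x" "bump a b n x \<le> 1"
    unfolding bump_def by (auto intro!: mult_le_one mult_nonneg_nonneg flat_1_bounds)
  have nz: "flat 1 y \<noteq> 0 \<longleftrightarrow> y > 0" for y by (simp add: flat_def)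
  show "bump a b n x \<noteq> 0 \<longleftrightarrow> a < x \<and> x < b"
    unfolding bump_def mult_eq_0_iff de_Morgan_disj nz by (simp add: zero_less_mult_iff)
qed

lemma bump_tendsto: "(\<lambda>n. bump a b n x) \<longlonglongrightarrow> indicator {a<..<b} x"
proof (cases "a < x \<and> x < b")
  case True
  have L: "(\<lambda>n. flat 1 (real (Suc n) * y)) \<longlonglongrightarrow> 1" if "y > 0" for y
  proof -
    have "(\<lambda>n. exp (- (inverse (real (Suc n)) * (1 / y)))) \<longlonglongrightarrow> exp (- (0 * (1 / y)))"
      by (intro tendsto_intros LIMSEQ_inverse_real_of_nat)
    then show ?thesis using that by (simp add: flat_def divide_inverse)
  qed
  have "(\<lambda>n. bump a b n x) \<longlonglongrightarrow> 1 * 1"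
    unfolding bump_def by (intro tendsto_mult L) (use True in auto)
  with True show ?thesis by simp
next
  case False
  then have "bump a b n x = 0" for n using bump_bounds(3) by blast
  with False show ?thesis by auto
qed

section \<open>Test functions as a vector space closed under differentiation\<close>

lemma test_functionsI:
  assumes "smooth f" "0 < a" "b < 1" "\<And>x. f x \<noteq> 0 \<Longrightarrow> a \<le> x \<and> x \<le> b"
  shows "f \<in> test_functions"
proof -
  have "closure {x. f x \<noteq> 0} \<subseteq> {a..b}"
    by (rule closure_minimal) (use assms in auto)
  moreover from this have "compact (closure {x. f x \<noteq> 0})"
    by (metis bounded_closed_interval bounded_subset closed_closure compact_eq_bounded_closed)
  ultimately show ?thesis
    using assms unfolding test_functions_def smooth_def by (fastforce simp: subset_iff)
qed

lemma test_functionsE: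
  assumes "f \<in> test_functions"
  obtains a b where "smooth f" "0 < a" "a \<le> b" "b < 1" "\<And>x. f x \<noteq> 0 \<Longrightarrow> a \<le> x \<and> x \<le> b"
proof -
  let ?C = "closure {x. f x \<noteq> 0}"
  have *: "compact ?C" "?C \<subseteq> {0<..<1}" "smooth f"
    using assms unfolding test_functions_def smooth_def by auto
  show thesis
  proof (cases "?C = {}")
    case True
    then have "f x = 0" for x using closure_subset[of "{x. f x \<noteq> 0}"] by auto
    then show thesis using that[of "1/2" "1/2"] * by simp
  next
    case False
    obtain a where a: "a \<in> ?C" "\<forall>x\<in>?C. a \<le> x" using compact_attains_inf[OF *(1) False] by blast
    obtain b where b: "b \<in> ?C" "\<forall>x\<in>?C. x \<le> b" using compact_attains_sup[OF *(1) False] by blast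
    show thesis
      by (rule that[of a b]) (use a b * closure_subset[of "{x. f x \<noteq> 0}"] in auto)
  qed
qed

lemma bump_test_function:
  assumes "0 < a" "b < 1" shows "bump a b n \<in> test_functions"
  by (rule test_functionsI[OF smooth_bump assms]) (use bump_bounds(3) in \<open>force\<close>)

lemma test_function_props:
  assumes "f \<in> test_functions"
  shows "smooth f" "deriv f \<in> test_functions" "continuous_on S f" "f x \<noteq> 0 \<Longrightarrow> 0 < x \<and> x < 1"
    "(f has_real_derivative deriv f x) (at x)"
proof -
  obtain a b where ab: "smooth f" "0 < a" "a \<le> b" "b < 1" "\<And>x. f x \<noteq> 0 \<Longrightarrow> a \<le> x \<and> x \<le> b"
    using test_functionsE[OF assms] by blast
  show "smooth f" by fact
  show D: "(f has_real_derivative deriv f x) (at x)" for x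
    using smooth_deriv[OF ab(1)] by blast
  then show "continuous_on S f"
    by (meson DERIV_continuous continuous_at_imp_continuous_on)
  show "f x \<noteq> 0 \<Longrightarrow> 0 < x \<and> x < 1" using ab by force
  show "deriv f \<in> test_functions"
  proof (rule test_functionsI[OF smooth_deriv(1)[OF ab(1)] ab(2,4)])
    fix x assume nz: "deriv f x \<noteq> 0"
    show "a \<le> x \<and> x \<le> b"
    proof (rule ccontr)
      assume "\<not> ?thesis"
      then have x: "x \<in> - {a..b}" by auto
      have "((\<lambda>x. 0) has_real_derivative 0) (at x)" by simp
      then have "(f has_real_derivative 0) (at x)"
        by (rule has_field_derivative_transform_within_open[where S = "- {a..b}"])
           (use x ab(5) in auto)
      with nz show False using DERIV_imp_deriv by blast
    qed
  qed
qed

lemma test_function_add: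
  assumes "f \<in> test_functions" "g \<in> test_functions"
  shows "(\<lambda>x. f x + g x) \<in> test_functions"
proof -
  obtain a b where ab: "smooth f" "0 < a" "a \<le> b" "b < 1" "\<And>x. f x \<noteq> 0 \<Longrightarrow> a \<le> x \<and> x \<le> b"
    using test_functionsE[OF assms(1)] by blast
  obtain c d where cd: "smooth g" "0 < c" "c \<le> d" "d < 1" "\<And>x. g x \<noteq> 0 \<Longrightarrow> c \<le> x \<and> x \<le> d"
    using test_functionsE[OF assms(2)] by blast
  show ?thesis
  proof (rule test_functionsI[OF smooth_add[OF ab(1) cd(1)], of "min a c" "max b d"])
    fix x assume "f x + g x \<noteq> 0"
    then have "f x \<noteq> 0 \<or> g x \<noteq> 0" by auto
    then show "min a c \<le> x \<and> x \<le> max b d" using ab(5) cd(5) by fastforce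
  qed (use ab cd in auto)
qed

lemma test_function_cmult:
  assumes "f \<in> test_functions" shows "(\<lambda>x. c * f x) \<in> test_functions"
proof -
  obtain a b where ab: "smooth f" "0 < a" "a \<le> b" "b < 1" "\<And>x. f x \<noteq> 0 \<Longrightarrow> a \<le> x \<and> x \<le> b"
    using test_functionsE[OF assms(1)] by blast
  show ?thesis
    by (rule test_functionsI[OF smooth_mult[OF smooth_const ab(1)] ab(2,4)]) (use ab in auto)
qed

section \<open>Integrals over the unit interval\<close>

text \<open>Connects the Lebesgue integral over the open interval with the gauge integral of the
  fundamental theorem. The two integrands differ at most at the endpoints 0 and 1, a null
  set.\<close>

lemma LINT_I01_FTC_interval:
  fixes F :: "real \<Rightarrow> 'a::euclidean_space"
  assumes "0 \<le> a" "a \<le> b" "b \<le> 1"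
    and D: "\<And>x. x \<in> {a..b} \<Longrightarrow> (F has_vector_derivative f x) (at x within {a..b})"
    and cont: "continuous_on {a..b} f"
  shows "(LINT x|I01. indicator {a..b} x *\<^sub>R f x) = F b - F a"
proof -
  have "(LINT x|I01. indicator {a..b} x *\<^sub>R f x) =
      (LINT x|lebesgue. indicator {0<..<1} x *\<^sub>R (indicator {a..b} x *\<^sub>R f x))"
    by (rule integral_restrict_space) simp
  also have "\<dots> = (LINT x|lebesgue. indicator {a..b} x *\<^sub>R f x)"
  proof (rule integral_cong_AE)
    have "(\<lambda>x. indicator {a..b} x *\<^sub>R f x) \<in> borel_measurable borel"
      by (rule borel_measurable_continuous_on_indicator) (use cont in auto)
    then show m: "(\<lambda>x. indicator {a..b} x *\<^sub>R f x) \<in> borel_measurable lebesgue"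
      by (simp add: measurable_completion)
    show "(\<lambda>x. indicator {0<..<1} x *\<^sub>R (indicator {a..b} x *\<^sub>R f x)) \<in> borel_measurable lebesgue"
      by (rule borel_measurable_scaleR[OF _ m]) (rule borel_measurable_indicator, simp)
    show "AE x in lebesgue. indicator {0<..<1} x *\<^sub>R (indicator {a..b} x *\<^sub>R f x) = indicator {a..b} x *\<^sub>R f x"
    proof (rule AE_I')
      have "negligible {0,1::real}" by simp
      then show "{0,1::real} \<in> null_sets lebesgue" using negligible_iff_null_sets by blast
      show "{x \<in> space lebesgue. indicator {0<..<1} x *\<^sub>R (indicator {a..b} x *\<^sub>R f x) \<noteq> indicator {a..b} x *\<^sub>R f x} \<subseteq> {0,1}"
        using assms by (auto simp: indicator_def)
    qed
  qed
  also have "\<dots> = (LINT x:{a..b}|lebesgue. f x)"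
    by (simp add: set_lebesgue_integral_def)
  also have "\<dots> = integral {a..b} f"
    by (rule set_lebesgue_integral_eq_integral)
       (metis absolutely_integrable_continuous cont interval_cbox)
  also have "\<dots> = F b - F a"
    using fundamental_theorem_of_calculus[OF assms(2) D] by (simp add: integral_unique)
  finally show ?thesis .
qed

lemma I01_integral_cong:
  fixes f g :: "real \<Rightarrow> 'a::{banach, second_countable_topology}"
  assumes "\<And>x. x \<in> {0<..<1} \<Longrightarrow> f x = g x"
  shows "(LINT x|I01. f x) = (LINT x|I01. g x)"
  by (rule Bochner_Integration.integral_cong) (use assms in \<open>auto simp: space_restrict_space\<close>)

lemma LINT_I01_FTC:
  fixes F :: "real \<Rightarrow> 'a::euclidean_space"
  assumes "\<And>x. x \<in> {0..1} \<Longrightarrow> (F has_vector_derivative f x) (at x within {0..1})"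
    and "continuous_on {0..1} f"
  shows "(LINT x|I01. f x) = F 1 - F 0"
proof -
  have "(LINT x|I01. f x) = (LINT x|I01. indicator {0..1} x *\<^sub>R f x)"
    by (rule I01_integral_cong) auto
  also have "\<dots> = F 1 - F 0" by (rule LINT_I01_FTC_interval) (use assms in auto)
  finally show ?thesis .
qed

lemma LINT_I01_FTC_upper:
  fixes F :: "real \<Rightarrow> real"
  assumes "0 \<le> t" "t \<le> 1" and D: "\<And>x. (F has_real_derivative f x) (at x)" and "continuous_on {t..1} f"
    and g: "\<And>x. x \<in> {0<..<1} \<Longrightarrow> g x = indicator {t..1} x * f x"
  shows "(LINT x|I01. g x) = F 1 - F t"
proof -
  have "(LINT x|I01. g x) = (LINT x|I01. indicator {t..1} x *\<^sub>R f x)"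
    by (rule I01_integral_cong) (simp add: g)
  also have "\<dots> = F 1 - F t"
    by (rule LINT_I01_FTC_interval)
       (use assms has_field_derivative_at_within[OF D] in \<open>auto simp: has_real_derivative_iff_has_vector_derivative\<close>)
  finally show ?thesis .
qed

section \<open>Measurability, integrability and Fubini on the unit interval\<close>

lemma finite_measure_I01: "finite_measure I01"
  by (rule finite_measure_lebesgue_on) (simp add: lmeasurable_open)

lemma measure_I01: "measure I01 {0<..<1} = 1"
  by (simp add: measure_restrict_space space_restrict_space)

interpretation I01: finite_measure I01
  by (rule finite_measure_I01)

interpretation I01_pair: pair_sigma_finite I01 I01
  by (simp add: pair_sigma_finite_def I01.sigma_finite_measure_axioms)

lemma AE_I01I: "(\<And>x. 0 < x \<Longrightarrow> x < 1 \<Longrightarrow> P x) \<Longrightarrow> AE x in I01. P x"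
  by (rule AE_I2) (auto simp: space_restrict_space)

lemma AE_I01_mp:
  assumes "AE x in I01. P x" "\<And>x. x \<in> {0<..<1} \<Longrightarrow> P x \<Longrightarrow> Q x"
  shows "AE x in I01. Q x"
  using assms(1) AE_space by eventually_elim (use assms(2) in \<open>auto simp: space_restrict_space\<close>)

lemma measurable_I01_cong:
  assumes "f \<in> borel_measurable I01" "\<And>x. x \<in> {0<..<1} \<Longrightarrow> g x = f x"
  shows "g \<in> borel_measurable I01"
  by (rule measurable_cong[THEN iffD1, OF _ assms(1)]) (use assms(2) in \<open>auto simp: space_restrict_space\<close>)

text \<open>If h is not integrable, its integral is 0 by convention, and the pointwise bound makes
  the right-hand side non-negative. Estimates can therefore be made before measurability is
  settled.\<close>

lemma integral_norm_bound_AE: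
  fixes h :: "'a \<Rightarrow> 'b::{banach, second_countable_topology}"
  assumes "integrable M g" "AE x in M. norm (h x) \<le> g x"
  shows "norm (integral\<^sup>L M h) \<le> integral\<^sup>L M g"
proof (cases "integrable M h")
  case True
  have "norm (integral\<^sup>L M h) \<le> (LINT x|M. norm (h x))" by simp
  also have "\<dots> \<le> integral\<^sup>L M g"
    by (rule integral_mono_AE) (use True assms in auto)
  finally show ?thesis .
next
  case False
  have "AE x in M. 0 \<le> g x" using assms(2) by eventually_elim (use norm_ge_zero order_trans in blast)
  then show ?thesis using False by (simp add: not_integrable_integral_eq integral_nonneg_AE)
qed

lemma I01_norm_le_const:
  fixes h :: "real \<Rightarrow> 'b::{banach, second_countable_topology}"
  assumes "AE x in I01. norm (h x) \<le> B"
  shows "norm (LINT x|I01. h x) \<le> B"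
  using integral_norm_bound_AE[of I01 "\<lambda>x. B" h] assms by (simp add: measure_I01)

lemma I01_continuous_measurable:
  fixes f :: "real \<Rightarrow> 'b::topological_space"
  assumes "continuous_on {0..1} f" shows "f \<in> borel_measurable I01"
proof -
  have "continuous_on {0<..<1} f" by (rule continuous_on_subset[OF assms]) auto
  then show ?thesis by (simp add: continuous_imp_measurable_on_sets_lebesgue)
qed

lemma I01_continuous_integrable:
  fixes f :: "real \<Rightarrow> 'b::{banach, second_countable_topology}"
  assumes "continuous_on {0..1} f" shows "integrable I01 f"
proof -
  have "bounded (f ` {0..1})" using assms compact_continuous_image compact_imp_bounded by blast
  then obtain B where "\<And>x. x \<in> {0..1} \<Longrightarrow> norm (f x) \<le> B" unfolding bounded_iff by blast
  then show ?thesis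
    by (intro I01.integrable_const_bound[where B = B] AE_I01I I01_continuous_measurable assms) auto
qed

lemma I01_integrable_mult_bounded:
  fixes f g :: "real \<Rightarrow> complex"
  assumes "integrable I01 g" "f \<in> borel_measurable I01" "AE x in I01. cmod (f x) \<le> B"
  shows "integrable I01 (\<lambda>x. f x * g x)"
proof (rule Bochner_Integration.integrable_bound[where f = "\<lambda>x. B * cmod (g x)"])
  show "integrable I01 (\<lambda>x. B * cmod (g x))" using assms(1) by simp
  show "AE x in I01. norm (f x * g x) \<le> norm (B * cmod (g x))"
    using assms(3) by eventually_elim (auto simp: norm_mult abs_mult intro!: mult_right_mono)
  show "(\<lambda>x. f x * g x) \<in> borel_measurable I01" using assms by simp
qed

text \<open>The product B |\<phi>(s)| |f(t)| is an integrable majorant on the square. Exchanges of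
  Green and Volterra kernels with other integrals go through this form.\<close>

lemma I01_Fubini:
  fixes K :: "real \<Rightarrow> real \<Rightarrow> complex"
  assumes \<phi>: "integrable I01 \<phi>"
    and K [measurable]: "(\<lambda>(s, t). K s t) \<in> borel_measurable (I01 \<Otimes>\<^sub>M I01)"
    and B: "\<And>s t. 0 < s \<Longrightarrow> s < 1 \<Longrightarrow> 0 < t \<Longrightarrow> t < 1 \<Longrightarrow> cmod (K s t) \<le> B"
    and f: "integrable I01 f"
  shows "(LINT s|I01. \<phi> s * (LINT t|I01. K s t * f t)) = (LINT t|I01. (LINT s|I01. \<phi> s * K s t) * f t)"
proof -
  have [measurable]: "\<phi> \<in> borel_measurable I01" "f \<in> borel_measurable I01" using \<phi> f by auto
  have int: "integrable (I01 \<Otimes>\<^sub>M I01) (\<lambda>(s, t). \<phi> s * K s t * f t)"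
  proof (rule Bochner_Integration.integrable_bound[where f = "\<lambda>(s, t). B * cmod (\<phi> s) * cmod (f t)"])
    show "integrable (I01 \<Otimes>\<^sub>M I01) (\<lambda>(s, t). B * cmod (\<phi> s) * cmod (f t))"
    proof (rule I01_pair.Fubini_integrable)
      show "(\<lambda>(s, t). B * cmod (\<phi> s) * cmod (f t)) \<in> borel_measurable (I01 \<Otimes>\<^sub>M I01)" by measurable
      show "integrable I01 (\<lambda>x. LINT y|I01. norm (case (x, y) of (s, t) \<Rightarrow> B * cmod (\<phi> s) * cmod (f t)))"
        using \<phi> by (simp add: abs_mult)
      show "AE x in I01. integrable I01 (\<lambda>y. case (x, y) of (s, t) \<Rightarrow> B * cmod (\<phi> s) * cmod (f t))"
        using f by simp
    qed
    show "(\<lambda>(s, t). \<phi> s * K s t * f t) \<in> borel_measurable (I01 \<Otimes>\<^sub>M I01)" by measurable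
    show "AE p in I01 \<Otimes>\<^sub>M I01. norm (case p of (s, t) \<Rightarrow> \<phi> s * K s t * f t)
            \<le> norm (case p of (s, t) \<Rightarrow> B * cmod (\<phi> s) * cmod (f t))"
    proof (rule AE_I2)
      fix p assume "p \<in> space (I01 \<Otimes>\<^sub>M I01)"
      then obtain s t where p: "p = (s, t)" "0 < s" "s < 1" "0 < t" "t < 1"
        by (auto simp: space_pair_measure space_restrict_space)
      from B[OF p(2-5)] have "cmod (K s t) \<le> \<bar>B\<bar>" by simp
      then have "cmod (K s t) * (cmod (\<phi> s) * cmod (f t)) \<le> \<bar>B\<bar> * (cmod (\<phi> s) * cmod (f t))"
        by (rule mult_right_mono) simp
      then show "norm (case p of (s, t) \<Rightarrow> \<phi> s * K s t * f t)
            \<le> norm (case p of (s, t) \<Rightarrow> B * cmod (\<phi> s) * cmod (f t))"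
        by (simp add: p norm_mult abs_mult mult_ac)
    qed
  qed
  have "(LINT s|I01. \<phi> s * (LINT t|I01. K s t * f t)) = (LINT s|I01. LINT t|I01. \<phi> s * K s t * f t)"
  proof (rule Bochner_Integration.integral_cong[OF refl])
    fix s show "\<phi> s * (LINT t|I01. K s t * f t) = (LINT t|I01. \<phi> s * K s t * f t)"
      by (simp add: mult.assoc)
  qed
  also have "\<dots> = (LINT t|I01. LINT s|I01. \<phi> s * K s t * f t)"
    using I01_pair.Fubini_integral[OF int] by simp
  finally show ?thesis by simp
qed

text \<open>The fundamental lemma of the calculus of variations. Bump functions give zero integrals
  over intervals compactly inside (0, 1), exhaustion extends this to all intervals, a pi-lambda
  argument to Borel sets, and completion to Lebesgue sets; an integrable function with all these
  integrals zero vanishes almost everywhere.\<close>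

lemma integral_test_functions_eq_0_imp_AE:
  fixes h :: "real \<Rightarrow> complex"
  assumes h: "integrable I01 h"
    and zero: "\<And>\<phi>. \<phi> \<in> test_functions \<Longrightarrow> (LINT x|I01. h x * of_real (\<phi> x)) = 0"
  shows "AE x in I01. h x = 0"
proof -
  have [measurable]: "h \<in> borel_measurable I01" using h by auto
  \<comment> \<open>Extension by zero lets the Dynkin argument run over the Borel sets of the whole
    line.\<close>
  define h0 where "h0 = (\<lambda>x. indicator {0<..<1} x *\<^sub>R h x)"
  have h0: "integrable lebesgue h0"
    using h unfolding h0_def by (subst (asm) integrable_restrict_space) auto
  have restr: "(LINT x|I01. indicator A x *\<^sub>R h x) = (LINT x:A|lebesgue. h0 x)" for A
    unfolding set_lebesgue_integral_def h0_def
    by (subst integral_restrict_space) (auto simp: mult.commute intro!: Bochner_Integration.integral_cong)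
  have 1: "(LINT x|I01. indicator {a<..<b} x *\<^sub>R h x) = 0" if "0 < a" "b < 1" for a b
  proof -
    have "(\<lambda>n. LINT x|I01. h x * of_real (bump a b n x)) \<longlonglongrightarrow> (LINT x|I01. h x * of_real (indicator {a<..<b} x))"
    proof (rule integral_dominated_convergence[where w = "\<lambda>x. cmod (h x)"])
      show "(\<lambda>x. h x * of_real (bump a b i x)) \<in> borel_measurable I01" for i
      proof -
        have "bump a b i \<in> borel_measurable I01"
          by (intro I01_continuous_measurable test_function_props bump_test_function that)
        then show ?thesis by simp
      qed
      show "(\<lambda>x. h x * of_real (indicator {a<..<b} x)) \<in> borel_measurable I01"
      proof -
        have "(indicator {a<..<b} :: real \<Rightarrow> real) \<in> borel_measurable I01"
          by (intro measurable_restrict_space1 borel_measurable_indicator) simp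
        then show ?thesis by simp
      qed
      show "AE x in I01. (\<lambda>i. h x * complex_of_real (bump a b i x)) \<longlonglongrightarrow> h x * complex_of_real (indicator {a<..<b} x)"
        by (intro AE_I2 tendsto_intros bump_tendsto)
      show "AE x in I01. cmod (h x * complex_of_real (bump a b i x)) \<le> cmod (h x)" for i
        using bump_bounds(1,2)[of a b i] by (intro AE_I2) (simp add: norm_mult mult_left_le)
    qed (use h in auto)
    then have "(LINT x|I01. h x * of_real (indicator {a<..<b} x)) = 0"
      by (simp add: zero bump_test_function[OF that] LIMSEQ_const_iff)
    moreover have "h x * of_real (indicator {a<..<b} x) = indicator {a<..<b} x *\<^sub>R h x" for x
      by (simp add: scaleR_conv_of_real)
    ultimately show ?thesis by simp
  qed
  have 2: "(LINT x|I01. indicator {a<..<b} x *\<^sub>R h x) = 0" for a b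
  proof -
    \<comment> \<open>The endpoints are pulled into (0, 1) by 1/(n+1), where the bumps are test
      functions; each x in (0, 1) is eventually unaffected.\<close>
    define an bn where "an = (\<lambda>n. max a (inverse (real (Suc n))))"
      and "bn = (\<lambda>n. min b (1 - inverse (real (Suc n))))"
    have "(\<lambda>n. LINT x|I01. indicator {an n<..<bn n} x *\<^sub>R h x) \<longlonglongrightarrow> (LINT x|I01. indicator {a<..<b} x *\<^sub>R h x)"
    proof (rule integral_dominated_convergence[where w = "\<lambda>x. cmod (h x)"])
      show "AE x in I01. (\<lambda>i. indicator {an i<..<bn i} x *\<^sub>R h x) \<longlonglongrightarrow> indicator {a<..<b} x *\<^sub>R h x"
      proof (rule AE_I01I)
        fix x :: real assume x: "0 < x" "x < 1"
        have "\<forall>\<^sub>F n in sequentially. inverse (real (Suc n)) < min x (1 - x)"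
          by (rule order_tendstoD(2)[OF LIMSEQ_inverse_real_of_nat]) (use x in auto)
        then have "\<forall>\<^sub>F n in sequentially. indicator {an n<..<bn n} x *\<^sub>R h x = indicator {a<..<b} x *\<^sub>R h x"
          by eventually_elim (auto simp: an_def bn_def indicator_def)
        then show "(\<lambda>i. indicator {an i<..<bn i} x *\<^sub>R h x) \<longlonglongrightarrow> indicator {a<..<b} x *\<^sub>R h x"
          by (rule tendsto_eventually)
      qed
      show "AE x in I01. cmod (indicator {an i<..<bn i} x *\<^sub>R h x) \<le> cmod (h x)" for i
        by (intro AE_I2) (auto simp: indicator_def)
      have "(indicator {c<..<d} :: real \<Rightarrow> real) \<in> borel_measurable I01" for c d
        by (intro measurable_restrict_space1 borel_measurable_indicator) simp
      then show "(\<lambda>x. indicator {a<..<b} x *\<^sub>R h x) \<in> borel_measurable I01"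
        "(\<lambda>x. indicator {an i<..<bn i} x *\<^sub>R h x) \<in> borel_measurable I01" for i
        by simp_all
    qed (use h in auto)
    moreover have "(LINT x|I01. indicator {an n<..<bn n} x *\<^sub>R h x) = 0" for n
      by (rule 1) (auto simp: an_def bn_def min_def max_def not_le
          intro: less_le_trans[of 0 "inverse (real (Suc n))"] le_less_trans[of _ "1 - inverse (real (Suc n))" 1])
    ultimately show ?thesis by (simp add: LIMSEQ_const_iff)
  qed
  have set_int: "set_integrable lebesgue A h0" if "A \<in> sets lebesgue" for A
    unfolding set_integrable_def using integrable_mult_indicator[OF that h0] .
  have whole: "(LINT x|lebesgue. h0 x) = 0"
  proof -
    have "(LINT x|lebesgue. h0 x) = (LINT x:{0<..<1}|lebesgue. h0 x)"
      unfolding set_lebesgue_integral_def h0_def by (rule Bochner_Integration.integral_cong) (auto simp: indicator_def)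
    also have "\<dots> = 0" unfolding restr[symmetric] by (rule 2)
    finally show ?thesis .
  qed
  have gen: "sets (borel :: real measure) = sigma_sets UNIV (range (\<lambda>(a, b). {a<..<b}))"
    unfolding box_real(1)[symmetric] by (subst borel_eq_box) simp
  have 3: "(LINT x:A|lebesgue. h0 x) = 0" if "A \<in> sets borel" for A
  proof -
    have "Int_stable (range (\<lambda>(a, b). {a<..<b::real}))"
      by (auto simp: Int_stable_def)
    moreover have "range (\<lambda>(a, b). {a<..<b::real}) \<subseteq> Pow UNIV" by simp
    moreover have "A \<in> sigma_sets UNIV (range (\<lambda>(a, b). {a<..<b::real}))"
      using that by (simp add: gen)
    ultimately show ?thesis
    proof (induction rule: sigma_sets_induct_disjoint)
      case (basic A)
      then obtain a b where "A = {a<..<b}" by auto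
      then show ?case using 2[of a b] restr by simp
    next
      case (compl A)
      then have "A \<in> sets borel" by (simp add: gen)
      then have A: "A \<in> sets lebesgue" by simp
      have "(LINT x|lebesgue. h0 x) = (LINT x:A \<union> (UNIV - A)|lebesgue. h0 x)"
        by (simp add: set_lebesgue_integral_def)
      also have "\<dots> = (LINT x:A|lebesgue. h0 x) + (LINT x:(UNIV - A)|lebesgue. h0 x)"
        by (rule set_integral_Un) (use A set_int sets.compl_sets[OF A] in auto)
      finally show ?case using compl whole by simp
    next
      case (union A)
      then have "range A \<subseteq> sets borel" by (simp add: gen)
      then have A: "A i \<in> sets lebesgue" for i by auto
      have "(LINT x:(\<Union>i. A i)|lebesgue. h0 x) = (\<Sum>i. LINT x:A i|lebesgue. h0 x)"
        by (rule lebesgue_integral_countable_add)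
           (use A union set_int in \<open>auto simp: disjoint_family_on_def\<close>)
      then show ?case using union by simp
    qed (auto simp: set_lebesgue_integral_def)
  qed
  have 4: "(LINT x:A|lebesgue. h0 x) = 0" if "A \<in> sets lebesgue" for A
  proof -
    \<comment> \<open>A Lebesgue set differs from its Borel \<open>main_part\<close> by a null
      set.\<close>
    let ?S = "main_part lborel A" and ?N = "null_part lborel A"
    have N: "?N \<in> null_sets lebesgue" and S: "?S \<in> sets borel" "A = ?S \<union> ?N"
      using that null_part[OF that] main_part_sets[OF that] main_part_null_part_Un[OF that]
        null_sets_completionI by (auto simp: null_sets_completion_iff2)
    have "(LINT x:A|lebesgue. h0 x) = (LINT x:?S|lebesgue. h0 x)"
      unfolding set_lebesgue_integral_def
    proof (rule integral_cong_AE)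
      show "AE x in lebesgue. indicator A x *\<^sub>R h0 x = indicator ?S x *\<^sub>R h0 x"
        by (rule AE_I'[OF N]) (use S in \<open>auto simp: indicator_def\<close>)
    qed (use h0 that S in \<open>auto intro!: borel_measurable_scaleR borel_measurable_indicator\<close>)
    with 3[OF S(1)] show ?thesis by simp
  qed
  have "AE x in I01. h x = (\<lambda>x. 0) x"
  proof (rule I01.density_unique_banach[OF h])
    fix A assume "A \<in> sets I01"
    then have "A \<in> sets lebesgue" by (simp add: sets_restrict_space_iff)
    then show "(LINT x:A|I01. h x) = (LINT x:A|I01. 0)"
      using 4 restr[of A] by (simp add: set_lebesgue_integral_def)
  qed simp
  then show ?thesis .
qed

section \<open>A contraction principle in a weighted ball\<close>

text \<open>Banach's fixed point theorem for the distance sup |f(i) - g(i)| / w(i) on the ball of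
  radius R around f0, with contraction factor 1/2, written pointwise so that no function space has
  to be set up. The predicate P is meant for measurability, which survives pointwise limits; outside
  D the map F freezes values at f0, so iterates converge there as well.\<close>

lemma weighted_contraction:
  fixes w :: "'i \<Rightarrow> real" and F :: "('i \<Rightarrow> complex) \<Rightarrow> 'i \<Rightarrow> complex"
  assumes w: "\<And>i. i \<in> D \<Longrightarrow> 0 \<le> w i" and "0 \<le> R"
    and P0: "P f0" and PF: "\<And>f. P f \<Longrightarrow> (\<And>i. i \<in> D \<Longrightarrow> cmod (f i - f0 i) \<le> R * w i) \<Longrightarrow> P (F f)"
    and Plim: "\<And>X f. (\<And>n. P (X n)) \<Longrightarrow> (\<And>i. (\<lambda>n. X n i) \<longlonglongrightarrow> f i) \<Longrightarrow> P f"
    and out: "\<And>f i. i \<notin> D \<Longrightarrow> F f i = f0 i"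
    and start: "\<And>i. i \<in> D \<Longrightarrow> cmod (F f0 i - f0 i) \<le> R / 2 * w i"
    and contr: "\<And>f g d i. P f \<Longrightarrow> P g \<Longrightarrow> 0 \<le> d \<Longrightarrow>
      (\<And>i. i \<in> D \<Longrightarrow> cmod (f i - f0 i) \<le> R * w i) \<Longrightarrow> (\<And>i. i \<in> D \<Longrightarrow> cmod (g i - f0 i) \<le> R * w i) \<Longrightarrow>
      (\<And>i. i \<in> D \<Longrightarrow> cmod (f i - g i) \<le> d * w i) \<Longrightarrow> i \<in> D \<Longrightarrow> cmod (F f i - F g i) \<le> d / 2 * w i"
  shows "\<exists>f. P f \<and> (\<forall>i\<in>D. cmod (f i - f0 i) \<le> R * w i) \<and> (\<forall>i\<in>D. F f i = f i)"
proof -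
  define S where "S = {f. P f \<and> (\<forall>i\<in>D. cmod (f i - f0 i) \<le> R * w i)}"
  have f0S: "f0 \<in> S" using P0 w \<open>0 \<le> R\<close> by (auto simp: S_def)
  have FS: "F f \<in> S" if "f \<in> S" for f
  proof -
    have "cmod (F f i - f0 i) \<le> R * w i" if i: "i \<in> D" for i
    proof -
      have "cmod (F f i - F f0 i) \<le> R / 2 * w i"
        by (rule contr) (use \<open>f \<in> S\<close> f0S i \<open>0 \<le> R\<close> in \<open>auto simp: S_def\<close>)
      with start[OF i] norm_triangle_ineq[of "F f i - F f0 i" "F f0 i - f0 i"]
      show ?thesis by simp
    qed
    then show ?thesis using that PF by (auto simp: S_def)
  qed
  define X where "X n = (F ^^ n) f0" for n
  have XS: "X n \<in> S" for n by (induction n) (auto simp: X_def f0S FS)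
  have step: "cmod (X (Suc n) i - X n i) \<le> R * (1/2) ^ Suc n * w i" if "i \<in> D" for n i
    using that
  proof (induction n arbitrary: i)
    case 0 then show ?case using start by (simp add: X_def)
  next
    case (Suc n)
    have "cmod (F (X (Suc n)) i - F (X n) i) \<le> (R * (1/2) ^ Suc n) / 2 * w i"
      by (rule contr) (use XS Suc \<open>0 \<le> R\<close> in \<open>auto simp: S_def\<close>)
    then show ?case by (simp add: X_def)
  qed
  have Xout: "X n i = f0 i" if "i \<notin> D" for n i
    using that out by (cases n) (auto simp: X_def)
  have dist: "cmod (X (n + k) i - X n i) \<le> R * (1/2) ^ n * w i" if i: "i \<in> D" for n k i
  proof -
    \<comment> \<open>The exact geometric partial sum is carried through the induction, since the
      final bound alone would not reproduce itself.\<close>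
    have "cmod (X (n + k) i - X n i) \<le> R * ((1/2) ^ n - (1/2) ^ (n + k)) * w i"
    proof (induction k)
      case (Suc k)
      have "cmod (X (n + Suc k) i - X n i) \<le> cmod (X (Suc (n + k)) i - X (n + k) i) + cmod (X (n + k) i - X n i)"
        using norm_triangle_ineq[of "X (Suc (n + k)) i - X (n + k) i" "X (n + k) i - X n i"] by simp
      also have "\<dots> \<le> R * (1/2) ^ Suc (n + k) * w i + R * ((1/2) ^ n - (1/2) ^ (n + k)) * w i"
        by (rule add_mono[OF step[OF i] Suc])
      also have "\<dots> = R * ((1/2) ^ n - (1/2) ^ (n + Suc k)) * w i" by (simp add: algebra_simps)
      finally show ?case .
    qed simp
    also have "\<dots> \<le> R * (1/2) ^ n * w i"
      by (intro mult_right_mono mult_left_mono w i \<open>0 \<le> R\<close>) simp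
    finally show ?thesis .
  qed
  have pow0: "(\<lambda>n. R * (1/2::real) ^ n * w i) \<longlonglongrightarrow> 0" for i
    by (intro tendsto_mult_left_zero tendsto_mult_right_zero LIMSEQ_power_zero) simp
  have "convergent (\<lambda>n. X n i)" for i
  proof (cases "i \<in> D")
    case True
    have "Cauchy (\<lambda>n. X n i)"
      unfolding Cauchy_altdef2
    proof (intro allI impI)
      fix e :: real assume "0 < e"
      obtain N where "R * (1/2) ^ N * w i < e"
        using order_tendstoD(2)[OF pow0 \<open>0 < e\<close>] by (auto simp: eventually_sequentially)
      moreover have "dist (X n i) (X N i) \<le> R * (1/2) ^ N * w i" if "n \<ge> N" for n
        using dist[OF True, of N "n - N"] that by (simp add: dist_norm)
      ultimately show "\<exists>N. \<forall>n\<ge>N. dist (X n i) (X N i) < e" by (meson le_less_trans)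
    qed
    then show ?thesis by (rule Cauchy_convergent)
  qed (simp add: Xout convergent_const)
  then obtain f where lim: "\<And>i. (\<lambda>n. X n i) \<longlonglongrightarrow> f i" unfolding convergent_def by metis
  have near: "cmod (f i - X n i) \<le> R * (1/2) ^ n * w i" if "i \<in> D" for i n
  proof (rule LIMSEQ_le_const2)
    show "(\<lambda>k. cmod (X (k + n) i - X n i)) \<longlonglongrightarrow> cmod (f i - X n i)"
      by (intro tendsto_intros LIMSEQ_ignore_initial_segment lim)
    show "\<exists>N. \<forall>k\<ge>N. cmod (X (k + n) i - X n i) \<le> R * (1/2) ^ n * w i"
      using dist[OF that, of n] by (auto simp: add.commute)
  qed
  have Pf: "P f" by (rule Plim[OF _ lim]) (use XS in \<open>auto simp: S_def\<close>)
  have ball: "cmod (f i - f0 i) \<le> R * w i" if "i \<in> D" for i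
    using near[OF that, of 0] by (simp add: X_def)
  have "F f i = f i" if i: "i \<in> D" for i
  proof -
    \<comment> \<open>Contraction with d = R / 2^n compares F f with F (X n), so F f is a limit of
      the same sequence as f.\<close>
    have "cmod (F f i - X (Suc n) i) \<le> (R * (1/2) ^ n) / 2 * w i" for n
      unfolding X_def funpow.simps comp_def
      by (rule contr) (use XS[of n] Pf ball near i \<open>0 \<le> R\<close> in \<open>auto simp: S_def X_def\<close>)
    then have "(\<lambda>n. F f i - X (Suc n) i) \<longlonglongrightarrow> 0"
      by (intro Lim_null_comparison[OF _ pow0[of i]] always_eventually allI)
         (use w[OF i] \<open>0 \<le> R\<close> in \<open>smt (verit) divide_nonneg_nonneg field_sum_of_halves mult_nonneg_nonneg mult_right_mono zero_le_power\<close>)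
    moreover have "(\<lambda>n. F f i - X (Suc n) i) \<longlonglongrightarrow> F f i - f i"
      by (intro tendsto_intros LIMSEQ_Suc lim)
    ultimately show ?thesis using LIMSEQ_unique by fastforce
  qed
  with Pf ball show ?thesis by blast
qed

section \<open>Square integrable functions and weak derivatives\<close>

lemma L2_measurable: "u \<in> L2 \<Longrightarrow> u \<in> borel_measurable I01"
  and L2_square_integrable: "u \<in> L2 \<Longrightarrow> integrable I01 (\<lambda>x. (cmod (u x))\<^sup>2)"
  by (auto simp: L2_def)

lemma L2_mult_integrable:
  assumes "u \<in> L2" "v \<in> L2" shows "integrable I01 (\<lambda>x. u x * v x)"
proof (rule Bochner_Integration.integrable_bound[where f = "\<lambda>x. (cmod (u x))\<^sup>2 + (cmod (v x))\<^sup>2"])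
  show "integrable I01 (\<lambda>x. (cmod (u x))\<^sup>2 + (cmod (v x))\<^sup>2)"
    using assms by (intro Bochner_Integration.integrable_add L2_square_integrable)
  have "cmod (u x) * cmod (v x) \<le> (cmod (u x))\<^sup>2 + (cmod (v x))\<^sup>2" for x
    using sum_squares_bound[of "cmod (u x)" "cmod (v x)"] mult_nonneg_nonneg[OF norm_ge_zero norm_ge_zero, of "u x" "v x"]
    by linarith
  then show "AE x in I01. norm (u x * v x) \<le> norm ((cmod (u x))\<^sup>2 + (cmod (v x))\<^sup>2)"
    by (intro AE_I2) (simp add: norm_mult)
qed (use assms L2_measurable in auto)

lemma L2_bounded:
  assumes "u \<in> borel_measurable I01" "AE x in I01. cmod (u x) \<le> B" shows "u \<in> L2"
proof -
  have "AE x in I01. norm ((cmod (u x))\<^sup>2) \<le> B\<^sup>2"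
    using assms(2) by eventually_elim (simp add: power_mono)
  then show ?thesis
    using assms(1) unfolding L2_def by (auto intro!: I01.integrable_const_bound)
qed

lemma L2_const: "(\<lambda>x. c) \<in> L2"
  by (rule L2_bounded[of _ "cmod c"]) auto

lemma L2_continuous: "continuous_on {0..1} u \<Longrightarrow> u \<in> L2"
  by (simp add: L2_def I01_continuous_measurable I01_continuous_integrable continuous_intros)

lemma L2_integrable: "u \<in> L2 \<Longrightarrow> integrable I01 u"
  using L2_mult_integrable[OF _ L2_const[of 1]] by simp

lemma L2_mult_bounded:
  assumes "u \<in> L2" "b \<in> borel_measurable I01" "AE x in I01. cmod (b x) \<le> B"
  shows "(\<lambda>x. b x * u x) \<in> L2"
proof -
  have "integrable I01 (\<lambda>x. (cmod (b x * u x))\<^sup>2)"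
  proof (rule Bochner_Integration.integrable_bound[where f = "\<lambda>x. B\<^sup>2 * (cmod (u x))\<^sup>2"])
    show "AE x in I01. norm ((cmod (b x * u x))\<^sup>2) \<le> norm (B\<^sup>2 * (cmod (u x))\<^sup>2)"
      using assms(3) by eventually_elim (simp add: norm_mult power_mult_distrib mult_right_mono power_mono)
  qed (use assms L2_measurable L2_square_integrable in auto)
  moreover have "(\<lambda>x. b x * u x) \<in> borel_measurable I01"
    using assms(2) L2_measurable[OF assms(1)] by simp
  ultimately show ?thesis by (simp add: L2_def)
qed

lemma L2_cmult: "u \<in> L2 \<Longrightarrow> (\<lambda>x. c * u x) \<in> L2"
  by (rule L2_mult_bounded[where B = "cmod c"]) auto

lemma L2_add:
  assumes "u \<in> L2" "v \<in> L2" shows "(\<lambda>x. u x + v x) \<in> L2"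
proof -
  have "integrable I01 (\<lambda>x. (cmod (u x + v x))\<^sup>2)"
  proof (rule Bochner_Integration.integrable_bound[where f = "\<lambda>x. 2 * (cmod (u x))\<^sup>2 + 2 * (cmod (v x))\<^sup>2"])
    have "(cmod (u x + v x))\<^sup>2 \<le> 2 * (cmod (u x))\<^sup>2 + 2 * (cmod (v x))\<^sup>2" for x
    proof -
      have "(cmod (u x + v x))\<^sup>2 \<le> (cmod (u x) + cmod (v x))\<^sup>2"
        by (intro power_mono norm_triangle_ineq) simp
      also have "\<dots> \<le> 2 * (cmod (u x))\<^sup>2 + 2 * (cmod (v x))\<^sup>2"
        using sum_squares_bound[of "cmod (u x)" "cmod (v x)"] by (simp add: power2_sum)
      finally show ?thesis .
    qed
    then show "AE x in I01. norm ((cmod (u x + v x))\<^sup>2) \<le> norm (2 * (cmod (u x))\<^sup>2 + 2 * (cmod (v x))\<^sup>2)"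
      by (intro AE_I2) simp
  qed (use assms L2_measurable L2_square_integrable in auto)
  moreover have "(\<lambda>x. u x + v x) \<in> borel_measurable I01"
    using L2_measurable[OF assms(1)] L2_measurable[OF assms(2)] by simp
  ultimately show ?thesis by (simp add: L2_def)
qed

lemma L2_diff: "u \<in> L2 \<Longrightarrow> v \<in> L2 \<Longrightarrow> (\<lambda>x. u x - v x) \<in> L2"
  using L2_add[OF _ L2_cmult[of v "-1"], of u] by simp

lemma L2_cnj:
  assumes "u \<in> L2" shows "(\<lambda>x. cnj (u x)) \<in> L2"
proof -
  have "(\<lambda>x. cnj (u x)) \<in> borel_measurable I01"
    by (rule measurable_compose[OF L2_measurable[OF assms]])
       (intro borel_measurable_continuous_onI continuous_intros)
  then show ?thesis using assms by (auto simp: L2_def)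
qed

lemma test_function_L2: "\<phi> \<in> test_functions \<Longrightarrow> (\<lambda>x. of_real (\<phi> x)) \<in> L2"
  by (intro L2_continuous continuous_intros test_function_props)

lemma is_weak_deriv_unique:
  assumes "v \<in> L2" "w \<in> L2" "is_weak_deriv n u v" "is_weak_deriv n u w"
  shows "AE x in I01. v x = w x"
proof -
  have "AE x in I01. v x - w x = 0"
  proof (rule integral_test_functions_eq_0_imp_AE)
    show "integrable I01 (\<lambda>x. v x - w x)"
      using assms L2_integrable by (intro Bochner_Integration.integrable_diff) auto
    fix \<phi> assume \<phi>: "\<phi> \<in> test_functions"
    have "(LINT x|I01. v x * of_real (\<phi> x)) = (LINT x|I01. w x * of_real (\<phi> x))"
      using assms(3,4) \<phi> unfolding is_weak_deriv_def by fastforce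
    then show "(LINT x|I01. (v x - w x) * of_real (\<phi> x)) = 0"
      using L2_mult_integrable[OF assms(1) test_function_L2[OF \<phi>]]
        L2_mult_integrable[OF assms(2) test_function_L2[OF \<phi>]]
      by (simp add: left_diff_distrib)
  qed
  then show ?thesis by simp
qed

lemma weak_deriv_props:
  assumes "v \<in> L2" "is_weak_deriv n u v"
  shows "weak_deriv n u \<in> L2" "is_weak_deriv n u (weak_deriv n u)" "AE x in I01. weak_deriv n u x = v x"
proof -
  have "weak_deriv n u \<in> L2 \<and> is_weak_deriv n u (weak_deriv n u)"
    unfolding weak_deriv_def by (rule someI[of _ v]) (use assms in blast)
  then show 1: "weak_deriv n u \<in> L2" "is_weak_deriv n u (weak_deriv n u)" by auto
  show "AE x in I01. weak_deriv n u x = v x"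
    by (rule is_weak_deriv_unique[OF 1(1) assms(1) 1(2) assms(2)])
qed

section \<open>Twofold integration from either endpoint and its weak derivatives\<close>

definition volterra :: "(real \<Rightarrow> complex) \<Rightarrow> real \<Rightarrow> complex" where
  "volterra h x = (LINT t|I01. of_real (max 0 (x - t)) * h t)"

text \<open>While \<open>volterra h\<close> integrates h twice from 0, this integrates twice from 1:
  the second derivative is h and the Cauchy data at 1 vanish. Truncated kernels over the fixed
  interval make the two operators transposes of each other under Fubini.\<close>

definition volterra_adj :: "(real \<Rightarrow> complex) \<Rightarrow> real \<Rightarrow> complex" where
  "volterra_adj h t = (LINT x|I01. of_real (max 0 (x - t)) * h x)"

lemma measurable_ident_I01 [measurable]: "(\<lambda>x. x) \<in> borel_measurable I01"
  by (intro I01_continuous_measurable continuous_intros)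

lemma I01_measurable_fst_snd [measurable]:
  "fst \<in> borel_measurable (I01 \<Otimes>\<^sub>M I01)" "snd \<in> borel_measurable (I01 \<Otimes>\<^sub>M I01)"
  using measurable_compose[OF measurable_fst measurable_ident_I01, of I01]
    measurable_compose[OF measurable_snd measurable_ident_I01, of I01] by simp_all

lemma I01_pair_measurable_continuous:
  fixes K :: "real \<times> real \<Rightarrow> 'b::topological_space"
  assumes "continuous_on UNIV K" shows "K \<in> borel_measurable (I01 \<Otimes>\<^sub>M I01)"
proof -
  have "(\<lambda>p. (fst p, snd p)) \<in> I01 \<Otimes>\<^sub>M I01 \<rightarrow>\<^sub>M (borel :: (real \<times> real) measure)"
    by (intro borel_measurable_Pair I01_measurable_fst_snd)
  then have "(\<lambda>p. K (fst p, snd p)) \<in> borel_measurable (I01 \<Otimes>\<^sub>M I01)"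
    by (rule measurable_compose) (rule borel_measurable_continuous_onI[OF assms])
  then show ?thesis by simp
qed

lemma max_kernel_integrable:
  fixes h :: "real \<Rightarrow> complex"
  assumes "integrable I01 h"
  shows "integrable I01 (\<lambda>t. of_real (max 0 (x - t)) * h t)"
    "integrable I01 (\<lambda>x. of_real (max 0 (x - t)) * h x)"
proof -
  show "integrable I01 (\<lambda>t. of_real (max 0 (x - t)) * h t)"
    by (rule I01_integrable_mult_bounded[OF assms, where B = "\<bar>x\<bar>"]) (auto intro!: AE_I01I)
  show "integrable I01 (\<lambda>x. of_real (max 0 (x - t)) * h x)"
    by (rule I01_integrable_mult_bounded[OF assms, where B = "1 + \<bar>t\<bar>"]) (auto intro!: AE_I01I)
qed

lemma volterra_0: "volterra h 0 = 0"
proof -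
  have "volterra h 0 = (LINT t|I01. 0)"
    unfolding volterra_def by (rule I01_integral_cong) auto
  then show ?thesis by simp
qed

lemma volterra_add:
  assumes "integrable I01 g" "integrable I01 h"
  shows "volterra (\<lambda>t. g t + h t) x = volterra g x + volterra h x"
  using max_kernel_integrable(1)[OF assms(1), of x] max_kernel_integrable(1)[OF assms(2), of x]
  by (simp add: volterra_def distrib_left)

lemma volterra_cmult: "volterra (\<lambda>t. c * h t) x = c * volterra h x"
  unfolding volterra_def by (subst integral_mult_right_zero[symmetric]) (simp add: mult_ac)

lemma continuous_on_lipschitz_real:
  fixes f :: "real \<Rightarrow> complex"
  assumes "\<And>x y. cmod (f x - f y) \<le> L * \<bar>x - y\<bar>"
  shows "continuous_on S f"
proof -
  have "cmod (f x - f y) \<le> \<bar>L\<bar> * \<bar>x - y\<bar>" for x y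
    using assms[of x y] mult_right_mono[OF abs_ge_self[of L], of "\<bar>x - y\<bar>"] by linarith
  then have "lipschitz_on \<bar>L\<bar> S f" by (intro lipschitz_onI) (auto simp: dist_norm)
  then show ?thesis by (rule lipschitz_on_continuous_on)
qed

text \<open>The truncated kernel is 1-Lipschitz in x, so the image is Lipschitz with constant the
  L^1 norm of h.\<close>

lemma volterra_continuous:
  assumes "integrable I01 h" shows "continuous_on S (volterra h)"
proof (rule continuous_on_lipschitz_real)
  fix x y
  have "volterra h x - volterra h y = (LINT t|I01. of_real (max 0 (x - t)) * h t - of_real (max 0 (y - t)) * h t)"
    unfolding volterra_def using max_kernel_integrable(1)[OF assms] by simp
  also have "cmod \<dots> \<le> (LINT t|I01. \<bar>x - y\<bar> * cmod (h t))"
  proof (rule integral_norm_bound_AE)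
    show "integrable I01 (\<lambda>t. \<bar>x - y\<bar> * cmod (h t))" using assms by simp
    have "cmod (of_real (max 0 (x - t)) * h t - of_real (max 0 (y - t)) * h t)
           = \<bar>max 0 (x - t) - max 0 (y - t)\<bar> * cmod (h t)" for t
      by (simp add: norm_mult flip: left_diff_distrib of_real_diff)
    then show "AE t in I01. cmod (of_real (max 0 (x - t)) * h t - of_real (max 0 (y - t)) * h t) \<le> \<bar>x - y\<bar> * cmod (h t)"
      by (intro AE_I2) (auto intro!: mult_right_mono)
  qed
  finally show "cmod (volterra h x - volterra h y) \<le> (LINT t|I01. cmod (h t)) * \<bar>x - y\<bar>"
    by (simp add: mult.commute)
qed

text \<open>The kernel is at most x for t in (0, 1). The resulting factor x is what later cancels
  1/x.\<close>

lemma volterra_bound: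
  assumes "integrable I01 h" "0 \<le> x" "x \<le> 1"
  shows "cmod (volterra h x) \<le> x * (LINT t|I01. cmod (h t))"
proof -
  have "cmod (volterra h x) \<le> (LINT t|I01. x * cmod (h t))"
    unfolding volterra_def
    by (rule integral_norm_bound_AE) (use assms in \<open>auto intro!: AE_I01I mult_right_mono simp: norm_mult\<close>)
  then show ?thesis by simp
qed

text \<open>Integration by parts with the antiderivatives (x - t) \<phi>'(x) - \<phi>(x) and
  \<phi>(x); nothing remains at 1, where \<phi> and \<phi>' vanish.\<close>

lemma test_function_twice_integrated:
  assumes "\<phi> \<in> test_functions" "0 \<le> t" "t \<le> 1"
  shows "(LINT x|I01. of_real (max 0 (x - t)) * complex_of_real (deriv (deriv \<phi>) x)) = of_real (\<phi> t)"
    and "(LINT x|I01. of_real (indicator {t..} x) * complex_of_real (deriv \<phi> x)) = - of_real (\<phi> t)"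
proof -
  note p = test_function_props[OF assms(1)] and p' = test_function_props[OF test_function_props(2)[OF assms(1)]]
    and p'' = test_function_props[OF test_function_props(2)[OF test_function_props(2)[OF assms(1)]]]
  have end1: "\<phi> 1 = 0" "deriv \<phi> 1 = 0" using p(4)[of 1] p'(4)[of 1] by auto
  have "(LINT x|I01. max 0 (x - t) * deriv (deriv \<phi>) x) = ((1 - t) * deriv \<phi> 1 - \<phi> 1) - ((t - t) * deriv \<phi> t - \<phi> t)"
    by (rule LINT_I01_FTC_upper[OF assms(2,3), where f = "\<lambda>x. (x - t) * deriv (deriv \<phi>) x"])
       (auto intro!: derivative_eq_intros p(5) p'(5) continuous_intros p'' simp: indicator_def)
  then have "(LINT x|I01. max 0 (x - t) * deriv (deriv \<phi>) x) = \<phi> t" by (simp add: end1)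
  then show "(LINT x|I01. of_real (max 0 (x - t)) * complex_of_real (deriv (deriv \<phi>) x)) = of_real (\<phi> t)"
    by (simp flip: of_real_mult)
  have "(LINT x|I01. indicator {t..} x * deriv \<phi> x) = \<phi> 1 - \<phi> t"
    by (rule LINT_I01_FTC_upper[OF assms(2,3) p(5)]) (auto intro!: p' simp: indicator_def)
  then have "(LINT x|I01. indicator {t..} x * deriv \<phi> x) = - \<phi> t" by (simp add: end1)
  then show "(LINT x|I01. of_real (indicator {t..} x) * complex_of_real (deriv \<phi> x)) = - of_real (\<phi> t)"
    by (simp flip: of_real_mult of_real_minus)
qed

text \<open>These moments handle the affine part c x of a function in \<open>H2_diamond\<close>:
  they say that 1 and x have the expected weak derivatives. Two of them are the case t = 0 of the
  truncated kernels, as test functions vanish at 0.\<close>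

lemma test_function_affine_moments:
  assumes "\<phi> \<in> test_functions"
  shows "(LINT x|I01. complex_of_real (deriv \<phi> x)) = 0"
    and "(LINT x|I01. of_real x * complex_of_real (deriv \<phi> x)) = - (LINT x|I01. of_real (\<phi> x))"
    and "(LINT x|I01. of_real x * complex_of_real (deriv (deriv \<phi>) x)) = 0"
proof -
  have *: "\<phi> 0 = 0" using test_function_props(4)[OF assms, of 0] by auto
  have "(LINT x|I01. complex_of_real (deriv \<phi> x)) = (LINT x|I01. of_real (indicator {0..} x) * complex_of_real (deriv \<phi> x))"
    by (rule I01_integral_cong) auto
  then show "(LINT x|I01. complex_of_real (deriv \<phi> x)) = 0"
    using test_function_twice_integrated(2)[OF assms, of 0] * by simp
  have "(LINT x|I01. of_real x * complex_of_real (deriv (deriv \<phi>) x)) =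
        (LINT x|I01. of_real (max 0 (x - 0)) * complex_of_real (deriv (deriv \<phi>) x))"
    by (rule I01_integral_cong) auto
  then show "(LINT x|I01. of_real x * complex_of_real (deriv (deriv \<phi>) x)) = 0"
    using test_function_twice_integrated(1)[OF assms, of 0] * by simp
  note p = test_function_props[OF assms] and p' = test_function_props[OF test_function_props(2)[OF assms]]
  have e: "\<phi> 1 = 0" using p(4)[of 1] by auto
  have "(LINT x|I01. \<phi> x + x * deriv \<phi> x) = 1 * \<phi> 1 - 0 * \<phi> 0"
    by (rule LINT_I01_FTC_upper[where t = 0 and f = "\<lambda>x. \<phi> x + x * deriv \<phi> x"])
       (auto intro!: derivative_eq_intros p(5) continuous_intros p(3) p'(3))
  moreover have "(LINT x|I01. \<phi> x + x * deriv \<phi> x) = (LINT x|I01. \<phi> x) + (LINT x|I01. x * deriv \<phi> x)"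
    by (intro Bochner_Integration.integral_add I01_continuous_integrable continuous_intros p(3) p'(3))
  ultimately have "(LINT x|I01. x * deriv \<phi> x) = - (LINT x|I01. \<phi> x)" using e by simp
  then show "(LINT x|I01. of_real x * complex_of_real (deriv \<phi> x)) = - (LINT x|I01. of_real (\<phi> x))"
    by (simp flip: of_real_mult of_real_minus)
qed

text \<open>Fubini moves the kernel onto the differentiated test function. For the second derivative
  it undoes both differentiations; for the first it leaves minus the integral of \<phi> from t to 1,
  which another use of Fubini returns to h. The first-order weak derivative is c plus the integral
  of h over (0, x).\<close>

lemma volterra_weak_deriv:
  assumes h: "h \<in> L2" and u: "\<And>x. x \<in> {0..1} \<Longrightarrow> u x = c * of_real x + volterra h x"
  shows "is_weak_deriv 2 u h"
    and "is_weak_deriv 1 u (\<lambda>x. c + (LINT t|I01. of_real (indicator {t..} x) * h t))"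
    and "(\<lambda>x. c + (LINT t|I01. of_real (indicator {t..} x) * h t)) \<in> L2"
    and "u \<in> H2"
proof -
  note hi = L2_integrable[OF h]
  define K where "K = (\<lambda>s t. complex_of_real (max 0 (s - t)))"
  define J where "J = (\<lambda>(s::real) (t::real). complex_of_real (indicator {t..} s))"
  have K: "(\<lambda>(s, t). K s t) \<in> borel_measurable (I01 \<Otimes>\<^sub>M I01)"
    unfolding K_def case_prod_beta by (intro I01_pair_measurable_continuous continuous_intros)
  have "(\<lambda>(s, t). J s t) = (\<lambda>p :: real \<times> real. if snd p \<le> fst p then 1 else 0)"
    by (auto simp: J_def indicator_def)
  also have "\<dots> \<in> borel_measurable (I01 \<Otimes>\<^sub>M I01)" by measurable
  finally have J: "(\<lambda>(s, t). J s t) \<in> borel_measurable (I01 \<Otimes>\<^sub>M I01)" .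
  have ucongr: "(LINT x|I01. u x * g x) = (LINT x|I01. c * of_real x * g x) + (LINT x|I01. volterra h x * g x)"
    if "continuous_on {0..1} g" for g
  proof -
    have "(LINT x|I01. u x * g x) = (LINT x|I01. c * of_real x * g x + volterra h x * g x)"
      by (rule I01_integral_cong) (auto simp: u distrib_right)
    also have "\<dots> = (LINT x|I01. c * of_real x * g x) + (LINT x|I01. volterra h x * g x)"
      by (intro Bochner_Integration.integral_add I01_continuous_integrable continuous_intros that volterra_continuous hi)
    finally show ?thesis .
  qed
  have swap: "(LINT x|I01. volterra h x * g x) = (LINT t|I01. (LINT x|I01. of_real (max 0 (x - t)) * g x) * h t)"
    if "continuous_on {0..1} g" for g
  proof -
    have "(LINT x|I01. g x * (LINT t|I01. K x t * h t)) = (LINT t|I01. (LINT x|I01. g x * K x t) * h t)"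
      by (rule I01_Fubini[OF I01_continuous_integrable[OF that] K _ hi, where B = 1]) (auto simp: K_def)
    then show ?thesis by (simp add: volterra_def K_def mult.commute)
  qed
  show 2: "is_weak_deriv 2 u h"
    unfolding is_weak_deriv_def
  proof
    fix \<phi> assume \<phi>: "\<phi> \<in> test_functions"
    note \<phi>'' = test_function_props(2)[OF test_function_props(2)[OF \<phi>]]
    have cont: "continuous_on {0..1} (\<lambda>x. complex_of_real (deriv (deriv \<phi>) x))"
      by (intro continuous_intros test_function_props(3)[OF \<phi>''])
    have "(LINT x|I01. u x * of_real (deriv (deriv \<phi>) x)) =
      c * (LINT x|I01. of_real x * complex_of_real (deriv (deriv \<phi>) x)) +
       (LINT t|I01. (LINT x|I01. of_real (max 0 (x - t)) * complex_of_real (deriv (deriv \<phi>) x)) * h t)"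
      unfolding ucongr[OF cont] swap[OF cont] by (simp add: mult.assoc)
    also have "\<dots> = (LINT t|I01. of_real (\<phi> t) * h t)"
      unfolding test_function_affine_moments(3)[OF \<phi>]
      by (simp, rule I01_integral_cong)
         (auto simp: test_function_twice_integrated(1)[OF \<phi>])
    finally show "(LINT x|I01. u x * of_real ((deriv ^^ 2) \<phi> x)) = (- 1)\<^sup>2 * (LINT x|I01. h x * of_real (\<phi> x))"
      by (simp add: numeral_2_eq_2 mult.commute)
  qed
  define v where "v = (\<lambda>x. c + (LINT t|I01. J x t * h t))"
  have vm: "(\<lambda>x. LINT t|I01. J x t * h t) \<in> borel_measurable I01"
  proof (rule I01.borel_measurable_lebesgue_integral)
    have [measurable]: "h \<in> borel_measurable I01" by (rule L2_measurable[OF h])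
    show "(\<lambda>(x, t). J x t * h t) \<in> borel_measurable (I01 \<Otimes>\<^sub>M I01)"
      using J by measurable
  qed
  have Jb: "AE x in I01. cmod (LINT t|I01. J x t * h t) \<le> (LINT t|I01. cmod (h t))"
    by (intro AE_I2 integral_norm_bound_AE) (use hi in \<open>auto simp: J_def indicator_def norm_mult\<close>)
  have JL2: "(\<lambda>x. LINT t|I01. J x t * h t) \<in> L2" by (rule L2_bounded[OF vm Jb])
  then have v: "v \<in> L2" unfolding v_def by (intro L2_add L2_const)
  then show "(\<lambda>x. c + (LINT t|I01. of_real (indicator {t..} x) * h t)) \<in> L2"
    by (simp add: v_def J_def)
  have 1: "is_weak_deriv 1 u v"
    unfolding is_weak_deriv_def
  proof
    fix \<phi> assume \<phi>: "\<phi> \<in> test_functions"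
    note \<phi>' = test_function_props(2)[OF \<phi>]
    have cont: "continuous_on {0..1} (\<lambda>x. complex_of_real (deriv \<phi> x))"
      by (intro continuous_intros test_function_props(3)[OF \<phi>'])
    have cont0: "continuous_on {0..1} (\<lambda>x. complex_of_real (\<phi> x))"
      by (intro continuous_intros test_function_props(3)[OF \<phi>])
    have K': "(LINT x|I01. of_real (max 0 (x - t)) * complex_of_real (deriv \<phi> x)) = - (LINT x|I01. of_real (\<phi> x) * J x t)"
      if t: "0 \<le> t" "t \<le> 1" for t
    proof -
      have "(LINT x|I01. max 0 (x - t) * deriv \<phi> x + indicator {t..} x * \<phi> x) = (1 - t) * \<phi> 1 - (t - t) * \<phi> t"
        by (rule LINT_I01_FTC_upper[OF t, where f = "\<lambda>x. (x - t) * deriv \<phi> x + \<phi> x"])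
           (auto intro!: derivative_eq_intros test_function_props(5)[OF \<phi>] continuous_intros
             test_function_props(3)[OF \<phi>] test_function_props(3)[OF \<phi>'] simp: indicator_def)
      also have "\<dots> = 0" using test_function_props(4)[OF \<phi>, of 1] by auto
      finally have z: "(LINT x|I01. max 0 (x - t) * deriv \<phi> x + indicator {t..} x * \<phi> x) = 0" .
      have i1: "integrable I01 (\<lambda>x. max 0 (x - t) * deriv \<phi> x)"
        by (intro I01_continuous_integrable continuous_intros test_function_props(3)[OF \<phi>'])
      have "integrable I01 (\<lambda>x. \<phi> x)" by (intro I01_continuous_integrable test_function_props(3)[OF \<phi>])
      from this have i2: "integrable I01 (\<lambda>x. indicator {t..} x * \<phi> x)"
      proof (rule Bochner_Integration.integrable_bound)
        have "(indicator {t..} :: real \<Rightarrow> real) \<in> borel_measurable I01"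
          by (intro measurable_restrict_space1 borel_measurable_indicator) simp
        then show "(\<lambda>x. indicator {t..} x * \<phi> x) \<in> borel_measurable I01"
          by (rule borel_measurable_times)
             (intro I01_continuous_measurable test_function_props(3)[OF \<phi>])
      qed (auto simp: indicator_def)
      have "(LINT x|I01. max 0 (x - t) * deriv \<phi> x) = - (LINT x|I01. indicator {t..} x * \<phi> x)"
        using z by (simp add: Bochner_Integration.integral_add[OF i1 i2])
      then have "complex_of_real (LINT x|I01. max 0 (x - t) * deriv \<phi> x) = - complex_of_real (LINT x|I01. \<phi> x * indicator {t..} x)"
        by (simp add: mult.commute)
      then show ?thesis by (simp add: J_def flip: of_real_mult)
    qed
    have Jint: "(LINT x|I01. of_real (\<phi> x) * (LINT t|I01. J x t * h t)) =
                (LINT t|I01. (LINT x|I01. of_real (\<phi> x) * J x t) * h t)"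
      by (rule I01_Fubini[OF I01_continuous_integrable[OF cont0] J _ hi, where B = 1]) (auto simp: J_def indicator_def)
    have "(LINT x|I01. u x * of_real (deriv \<phi> x)) =
      c * (LINT x|I01. of_real x * complex_of_real (deriv \<phi> x)) +
       (LINT t|I01. (LINT x|I01. of_real (max 0 (x - t)) * complex_of_real (deriv \<phi> x)) * h t)"
      unfolding ucongr[OF cont] swap[OF cont] by (simp add: mult.assoc)
    also have "(LINT t|I01. (LINT x|I01. of_real (max 0 (x - t)) * complex_of_real (deriv \<phi> x)) * h t) =
          (LINT t|I01. - ((LINT x|I01. of_real (\<phi> x) * J x t) * h t))"
      by (rule I01_integral_cong) (simp add: K')
    also have "\<dots> = - (LINT x|I01. of_real (\<phi> x) * (LINT t|I01. J x t * h t))" by (simp add: Jint)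
    also have "c * (LINT x|I01. of_real x * complex_of_real (deriv \<phi> x)) + - (LINT x|I01. of_real (\<phi> x) * (LINT t|I01. J x t * h t))
       = - (LINT x|I01. c * of_real (\<phi> x) + (LINT t|I01. J x t * h t) * of_real (\<phi> x))"
      unfolding test_function_affine_moments(2)[OF \<phi>]
      using L2_mult_integrable[OF JL2 test_function_L2[OF \<phi>]] L2_integrable[OF test_function_L2[OF \<phi>]]
      by (simp add: mult.commute)
    finally show "(LINT x|I01. u x * of_real ((deriv ^^ 1) \<phi> x)) = (- 1) ^ 1 * (LINT x|I01. v x * of_real (\<phi> x))"
      by (simp add: v_def distrib_right)
  qed
  then show "is_weak_deriv 1 u (\<lambda>x. c + (LINT t|I01. of_real (indicator {t..} x) * h t))"
    by (simp add: v_def J_def)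
  have "continuous_on {0..1} (\<lambda>x. c * of_real x + volterra h x)"
    by (intro continuous_intros volterra_continuous hi)
  then have "continuous_on {0..1} u" by (rule continuous_on_eq) (use u in simp)
  then show "u \<in> H2"
    using 1 2 v h L2_continuous unfolding H2_def by blast
qed

section \<open>From a weak second derivative back to an explicit formula\<close>

lemma test_function_antiderivative:
  assumes g: "g \<in> test_functions" and int: "(LINT x|I01. g x) = 0"
  shows "\<exists>G\<in>test_functions. deriv G = g"
proof -
  obtain a b where ab: "smooth g" "0 < a" "a \<le> b" "b < 1" "\<And>x. g x \<noteq> 0 \<Longrightarrow> a \<le> x \<and> x \<le> b"
    using test_functionsE[OF g] by blast
  define G where "G x = integral {-1..x} g" for x
  have G0: "G x = 0" if "x < a" for x
  proof -
    have "G x = integral {-1..x} (\<lambda>x. 0)"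
      unfolding G_def by (rule integral_cong) (use ab(5) that in force)
    then show ?thesis by simp
  qed
  have D: "(G has_real_derivative g x) (at x)" for x
  proof (cases "x < a")
    case True
    then have "g x = 0" using ab(5)[of x] by force
    have "((\<lambda>x. 0) has_real_derivative 0) (at x)" by simp
    then have "(G has_real_derivative 0) (at x)"
      by (rule has_field_derivative_transform_within_open[where S = "{..<a}"]) (use True G0 in auto)
    then show ?thesis using \<open>g x = 0\<close> by simp
  next
    case False
    have "(G has_real_derivative g x) (at x within {-1..x + 1})"
      unfolding G_def
      by (rule integral_has_real_derivative) (use test_function_props(3)[OF g] False ab in auto)
    then show ?thesis using False ab(2) by (subst (asm) at_within_Icc_at) auto
  qed
  have Gs: "smooth G" by (rule smooth_antiderivative[OF ab(1) D])
  have "(LINT x|I01. g x) = G 1 - G 0"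
    by (rule LINT_I01_FTC)
       (use D test_function_props(3)[OF g] has_field_derivative_at_within has_real_derivative_iff_has_vector_derivative in \<open>blast+\<close>)
  \<comment> \<open>This is where the vanishing integral enters: G is constant to the right of b,
    and its value at 1 shows that the constant is 0, so the support stays compact in (0, 1).\<close>
  then have G1: "G 1 = 0" using int G0[of 0] ab(2) by simp
  have "\<exists>c. \<forall>x\<in>{b<..}. G x = c"
  proof (rule has_field_derivative_zero_constant)
    fix x assume "x \<in> {b<..}"
    then have "g x = 0" using ab(5)[of x] by force
    then show "(G has_field_derivative 0) (at x within {b<..})"
      using D[of x] has_field_derivative_at_within by metis
  qed auto
  then have Gb: "G x = 0" if "b < x" for x using that G1 ab(4) by force
  have "G \<in> test_functions"
    by (rule test_functionsI[OF Gs ab(2,4)]) (use G0 Gb in force)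
  moreover have "deriv G = g" using D DERIV_imp_deriv by blast
  ultimately show ?thesis by blast
qed

text \<open>The set of interior points where D is nonzero is open and null, hence empty; the
  endpoints follow by continuity.\<close>

lemma I01_AE_zero_continuous:
  fixes D :: "real \<Rightarrow> complex"
  assumes "continuous_on {0..1} D" "AE x in I01. D x = 0" "x \<in> {0..1}"
  shows "D x = 0"
proof -
  let ?S = "{x \<in> {0<..<1}. D x \<noteq> 0}"
  have "continuous_on {0<..<1} D" by (rule continuous_on_subset[OF assms(1)]) auto
  then have op: "open ({0<..<1} \<inter> D -` (- {0}))"
    by (intro continuous_open_preimage) auto
  have eq: "{0<..<1} \<inter> D -` (- {0}) = ?S" by auto
  have "AE x in lebesgue. x \<in> {0<..<1} \<longrightarrow> D x = 0"
    using assms(2) by (subst (asm) AE_restrict_space_iff) auto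
  then have "negligible ?S"
    by (auto simp: negligible_iff_null_sets eventually_ae_filter elim!: null_sets_completion_subset[rotated])
  then have "?S = {}" using op eq open_not_negligible by metis
  then have z: "D y = 0" if "y \<in> {0<..<1}" for y using that by blast
  have cl: "closure {0<..<1::real} = {0..1}" by simp
  show ?thesis
    by (rule continuous_constant_on_closure[of "{0<..<1}" D 0]) (use assms z cl in auto)
qed

text \<open>A du Bois-Reymond argument: \<open>D\<close> annihilates all second derivatives of test functions, and every
  test function becomes such a second derivative after subtracting multiples of \<open>e\<close> and \<open>e'\<close> that
  remove its first two moments.\<close>

lemma annihilates_second_derivs_imp_affine:
  fixes D :: "real \<Rightarrow> complex"
  assumes D: "continuous_on {0..1} D"
    and zero: "\<And>\<phi>. \<phi> \<in> test_functions \<Longrightarrow> (LINT x|I01. D x * of_real (deriv (deriv \<phi>) x)) = 0"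
  shows "\<exists>c0 c1. \<forall>x\<in>{0..1}. D x = c0 + c1 * of_real x"
proof -
  define b where "b = bump (1/4) (3/4) 0"
  have b: "b \<in> test_functions" unfolding b_def by (rule bump_test_function) auto
  define I where "I = (LINT x|I01. b x)"
  have ti: "integrable I01 g" "integrable I01 (\<lambda>x. x * g x)" if "g \<in> test_functions" for g
    by (intro I01_continuous_integrable continuous_intros test_function_props(3)[OF that])+
  have "I \<noteq> 0"
  proof
    assume "I = 0"
    then have "AE x in I01. b x = 0"
      unfolding I_def using integral_nonneg_eq_0_iff_AE[OF ti(1)[OF b]] bump_bounds(1) by (auto simp: b_def)
    then have "AE x in I01. complex_of_real (b x) = 0" by simp
    then have "complex_of_real (b (1/2)) = 0"
      by (rule I01_AE_zero_continuous[rotated]) (auto intro!: continuous_intros test_function_props(3)[OF b])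
    then show False using bump_bounds(3)[of "1/4" "3/4" 0 "1/2"] by (simp add: b_def)
  qed
  define e where "e = (\<lambda>x. 1 / I * b x)"
  have e: "e \<in> test_functions" unfolding e_def by (rule test_function_cmult[OF b])
  have Ie: "(LINT x|I01. e x) = 1" using \<open>I \<noteq> 0\<close> by (simp add: e_def I_def)
  note e' = test_function_props(2)[OF e]
  define \<mu> where "\<mu> = (LINT x|I01. x * e x)"
  have Ie': "(LINT x|I01. deriv e x) = 0" "(LINT x|I01. x * deriv e x) = -1"
  proof -
    have "complex_of_real (LINT x|I01. deriv e x) = of_real 0" "complex_of_real (LINT x|I01. x * deriv e x) = of_real (- 1)"
      using test_function_affine_moments(1,2)[OF e] Ie by (simp_all flip: of_real_mult)
    then show "(LINT x|I01. deriv e x) = 0" "(LINT x|I01. x * deriv e x) = -1"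
      unfolding of_real_eq_iff by auto
  qed
  define d0 d1 where "d0 = (LINT x|I01. D x * of_real (e x))" and "d1 = (LINT x|I01. D x * of_real (deriv e x))"
  \<comment> \<open>Read off from the formula \<open>Dg\<close> below: collecting the moments m0 and
    m1 of g gives m0 (d0 + \<mu> d1) - m1 d1.\<close>
  define c0 c1 where "c0 = d0 + of_real \<mu> * d1" and "c1 = - d1"
  have Di: "integrable I01 (\<lambda>x. D x * of_real (g x))" if "g \<in> test_functions" for g
    by (intro I01_continuous_integrable continuous_intros D test_function_props(3)[OF that])
  have "AE x in I01. D x - (c0 + c1 * of_real x) = 0"
  proof (rule integral_test_functions_eq_0_imp_AE)
    show "integrable I01 (\<lambda>x. D x - (c0 + c1 * of_real x))"
      by (intro I01_continuous_integrable continuous_intros D)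
    fix g assume g: "g \<in> test_functions"
    define m0 m1 where "m0 = (LINT x|I01. g x)" and "m1 = (LINT x|I01. x * g x)"
    \<comment> \<open>The coefficients solve a triangular system: e has moments 1 and \<mu>, its
      derivative has moments 0 and -1.\<close>
    define k where "k = (\<lambda>x. g x + (- m0 * e x + (m1 - \<mu> * m0) * deriv e x))"
    have k: "k \<in> test_functions"
      unfolding k_def by (intro test_function_add test_function_cmult g e e')
    have "(LINT x|I01. k x) = m0 + (- m0 * 1 + (m1 - \<mu> * m0) * 0)"
      unfolding k_def using ti(1)[OF g] ti(1)[OF e] ti(1)[OF e'] by (simp add: Ie Ie' m0_def)
    then have k0: "(LINT x|I01. k x) = 0" by simp
    have "(LINT x|I01. x * k x) = (LINT x|I01. x * g x + (- m0 * (x * e x) + (m1 - \<mu> * m0) * (x * deriv e x)))"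
      by (simp add: k_def algebra_simps)
    also have "\<dots> = m1 + (- m0 * \<mu> + (m1 - \<mu> * m0) * (- 1))"
      using ti(2)[OF g] ti(2)[OF e] ti(2)[OF e'] by (simp add: Ie' m1_def \<mu>_def)
    finally have k1: "(LINT x|I01. x * k x) = 0" by (simp add: algebra_simps)
    obtain G where G: "G \<in> test_functions" "deriv G = k"
      using test_function_antiderivative[OF k k0] by blast
    have "(LINT x|I01. G x) = 0"
      using test_function_affine_moments(2)[OF G(1)] k1 G(2) by (simp flip: of_real_mult)
    then obtain \<phi> where \<phi>: "\<phi> \<in> test_functions" "deriv \<phi> = G"
      using test_function_antiderivative[OF G(1)] by blast
    have "(LINT x|I01. D x * of_real (k x)) = 0" using zero[OF \<phi>(1)] \<phi>(2) G(2) by simp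
    moreover have "(LINT x|I01. D x * of_real (k x)) =
       (LINT x|I01. D x * of_real (g x) + (- of_real m0 * (D x * of_real (e x)) + of_real (m1 - \<mu> * m0) * (D x * of_real (deriv e x))))"
      by (simp add: k_def algebra_simps)
    moreover have "\<dots> = (LINT x|I01. D x * of_real (g x)) + (- of_real m0 * d0 + of_real (m1 - \<mu> * m0) * d1)"
      using Di[OF g] Di[OF e] Di[OF e'] by (simp add: d0_def d1_def)
    ultimately have "(LINT x|I01. D x * of_real (g x)) + (- of_real m0 * d0 + of_real (m1 - \<mu> * m0) * d1) = 0" by argo
    then have Dg: "(LINT x|I01. D x * of_real (g x)) = of_real m0 * d0 - of_real (m1 - \<mu> * m0) * d1" by algebra
    have gi: "integrable I01 (\<lambda>x. complex_of_real (g x))" "integrable I01 (\<lambda>x. complex_of_real x * complex_of_real (g x))"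
      using ti[OF g] by (simp_all flip: of_real_mult)
    have mm: "(LINT x|I01. complex_of_real (g x)) = of_real m0" "(LINT x|I01. complex_of_real x * complex_of_real (g x)) = of_real m1"
      by (simp_all add: m0_def m1_def flip: of_real_mult)
    have "(LINT x|I01. (D x - (c0 + c1 * of_real x)) * of_real (g x)) =
      (LINT x|I01. D x * of_real (g x) - (c0 * of_real (g x) + c1 * (of_real x * of_real (g x))))"
      by (simp add: algebra_simps)
    also have "\<dots> = (LINT x|I01. D x * of_real (g x)) - (c0 * of_real m0 + c1 * of_real m1)"
      using Di[OF g] gi mm by simp
    also have "\<dots> = 0" unfolding Dg by (simp add: c0_def c1_def algebra_simps)
    finally show "(LINT x|I01. (D x - (c0 + c1 * of_real x)) * of_real (g x)) = 0" .
  qed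
  then have "D x - (c0 + c1 * of_real x) = 0" if "x \<in> {0..1}" for x
    by (rule I01_AE_zero_continuous[rotated]) (use that in \<open>auto intro!: continuous_intros D\<close>)
  then show ?thesis by (metis eq_iff_diff_eq_0)
qed

text \<open>Subtracting the twofold integral of the weak second derivative leaves a function whose
  weak second derivative is 0, hence an affine one, and u(0) = 0 removes its constant. This makes
  the test functions \<phi>1 of the variational form explicit.\<close>

lemma H2_diamond_representation:
  assumes "u \<in> H2_diamond"
  shows "weak_deriv 2 u \<in> L2" "\<exists>c. \<forall>x\<in>{0..1}. u x = c * of_real x + volterra (weak_deriv 2 u) x"
proof -
  obtain v where "v \<in> L2" "is_weak_deriv 2 u v" and uc: "continuous_on {0..1} u" and u0: "u 0 = 0"
    using assms unfolding H2_diamond_def H2_def by auto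
  then have h: "weak_deriv 2 u \<in> L2" "is_weak_deriv 2 u (weak_deriv 2 u)"
    using weak_deriv_props by blast+
  show "weak_deriv 2 u \<in> L2" by fact
  let ?V = "volterra (weak_deriv 2 u)"
  have Vc: "continuous_on {0..1} ?V" by (intro volterra_continuous L2_integrable h)
  have V: "is_weak_deriv 2 ?V (weak_deriv 2 u)"
    by (rule volterra_weak_deriv(1)[OF h(1), where c = 0]) simp
  have "\<exists>c0 c1. \<forall>x\<in>{0..1}. u x - ?V x = c0 + c1 * of_real x"
  proof (rule annihilates_second_derivs_imp_affine)
    fix \<phi> assume \<phi>: "\<phi> \<in> test_functions"
    have "continuous_on {0..1} (\<lambda>x. complex_of_real (deriv (deriv \<phi>) x))"
      by (intro continuous_intros test_function_props \<phi>)
    then have "integrable I01 (\<lambda>x. u x * of_real (deriv (deriv \<phi>) x))"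
      "integrable I01 (\<lambda>x. ?V x * of_real (deriv (deriv \<phi>) x))"
      by (intro I01_continuous_integrable continuous_on_mult uc Vc; assumption)+
    moreover have "(LINT x|I01. u x * of_real (deriv (deriv \<phi>) x)) = (LINT x|I01. ?V x * of_real (deriv (deriv \<phi>) x))"
      using h(2) V \<phi> unfolding is_weak_deriv_def by (fastforce simp: numeral_2_eq_2)
    ultimately show "(LINT x|I01. (u x - ?V x) * of_real (deriv (deriv \<phi>) x)) = 0"
      by (simp add: left_diff_distrib)
  qed (intro continuous_intros uc Vc)
  then obtain c0 c1 where c: "\<forall>x\<in>{0..1}. u x - ?V x = c0 + c1 * of_real x" by blast
  from bspec[OF this, of 0] have "c0 = 0" by (simp add: u0 volterra_0)
  with c have "\<forall>x\<in>{0..1}. u x = c1 * of_real x + ?V x" by (metis add_0 diff_add_cancel)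
  then show "\<exists>c. \<forall>x\<in>{0..1}. u x = c * of_real x + ?V x" by blast
qed

section \<open>The linear initial value problem and its Green kernel\<close>

lemma I01_indicator_integrable:
  fixes f :: "real \<Rightarrow> 'b::{banach, second_countable_topology}"
  assumes "integrable I01 f" "A \<in> sets lebesgue"
  shows "integrable I01 (\<lambda>t. indicator A t *\<^sub>R f t)"
proof (rule Bochner_Integration.integrable_bound[OF assms(1)])
  have "(indicator A :: real \<Rightarrow> real) \<in> borel_measurable I01"
    by (intro measurable_restrict_space1 borel_measurable_indicator assms)
  then show "(\<lambda>t. indicator A t *\<^sub>R f t) \<in> borel_measurable I01"
    using assms(1) by (intro borel_measurable_scaleR) auto
qed (auto simp: indicator_def)

text \<open>In the norm weighted by exp(L x) the truncated kernel, bounded by 1, acts with norm at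
  most 1 / L. A large L turns Volterra terms into contractions on the whole interval at
  once.\<close>

lemma exp_kernel_bound:
  fixes L :: real
  assumes "0 < L" "0 \<le> x" "x \<le> 1"
  shows "(LINT t|I01. max 0 (x - t) * exp (L * t)) \<le> exp (L * x) / L"
proof -
  have "(LINT t|I01. max 0 (x - t) * exp (L * t)) \<le> (LINT t|I01. indicator {0..x} t *\<^sub>R exp (L * t))"
  proof (rule integral_mono_AE)
    show "integrable I01 (\<lambda>t. max 0 (x - t) * exp (L * t))"
      by (intro I01_continuous_integrable continuous_intros)
    have "integrable I01 (\<lambda>t. exp (L * t))" by (intro I01_continuous_integrable continuous_intros)
    then show "integrable I01 (\<lambda>t. indicator {0..x} t *\<^sub>R exp (L * t))"
      by (rule I01_indicator_integrable) simp
    show "AE t in I01. max 0 (x - t) * exp (L * t) \<le> indicator {0..x} t *\<^sub>R exp (L * t)"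
      by (rule AE_I01I) (use assms in \<open>auto simp: indicator_def max_def mult_left_le_one_le\<close>)
  qed
  also have "\<dots> = exp (L * x) / L - exp (L * 0) / L"
  proof (rule LINT_I01_FTC_interval)
    fix t
    have "((\<lambda>t. exp (L * t) / L) has_real_derivative exp (L * t)) (at t within {0..x})"
      using assms by (auto intro!: derivative_eq_intros)
    then show "((\<lambda>t. exp (L * t) / L) has_vector_derivative exp (L * t)) (at t within {0..x})"
      by (simp add: has_real_derivative_iff_has_vector_derivative)
  qed (use assms in \<open>auto intro!: continuous_intros\<close>)
  also have "\<dots> \<le> exp (L * x) / L" using assms by simp
  finally show ?thesis .
qed

text \<open>A Gronwall inequality proved by absorption: at the maximum point y of |z(t)| exp(-L t)
  the integral term is at most half of the left-hand side.\<close>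

lemma gronwall_I01:
  fixes z :: "real \<Rightarrow> complex"
  assumes cont: "continuous_on {0..1} z" and "0 \<le> A" "0 \<le> B"
    and le: "\<And>x. x \<in> {0..1} \<Longrightarrow> cmod (z x) \<le> A + B * (LINT t|I01. max 0 (x - t) * cmod (z t))"
    and x: "x \<in> {0..1}"
  shows "cmod (z x) \<le> 2 * A * exp (2 * B + 1)"
proof -
  \<comment> \<open>This gives B / L \<le> 1/2; the added 1 keeps L positive when B = 0.\<close>
  define L where "L = 2 * B + 1"
  have "0 < L" using \<open>0 \<le> B\<close> by (simp add: L_def)
  define \<psi> where "\<psi> t = cmod (z t) * exp (- (L * t))" for t
  have "continuous_on {0..1} \<psi>" unfolding \<psi>_def by (intro continuous_intros cont)
  then obtain y where y: "y \<in> {0..1}" "\<And>t. t \<in> {0..1} \<Longrightarrow> \<psi> t \<le> \<psi> y"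
    using continuous_attains_sup[of "{0..1}" \<psi>] by auto
  have zle: "cmod (z t) \<le> \<psi> y * exp (L * t)" if "t \<in> {0..1}" for t
    using y(2)[OF that] by (simp add: \<psi>_def exp_minus field_simps)
  have nn: "0 \<le> \<psi> y" by (simp add: \<psi>_def)
  have "(LINT t|I01. max 0 (y - t) * cmod (z t)) \<le> (LINT t|I01. \<psi> y * (max 0 (y - t) * exp (L * t)))"
  proof (rule integral_mono_AE)
    show "AE t in I01. max 0 (y - t) * cmod (z t) \<le> \<psi> y * (max 0 (y - t) * exp (L * t))"
    proof (rule AE_I01I)
      fix t :: real assume "0 < t" "t < 1"
      then show "max 0 (y - t) * cmod (z t) \<le> \<psi> y * (max 0 (y - t) * exp (L * t))"
        using mult_left_mono[OF zle[of t], of "max 0 (y - t)"] by (simp add: mult_ac)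
    qed
  qed (intro I01_continuous_integrable continuous_intros cont)+
  also have "\<dots> = \<psi> y * (LINT t|I01. max 0 (y - t) * exp (L * t))" by simp
  also have "\<dots> \<le> \<psi> y * (exp (L * y) / L)"
    by (rule mult_left_mono[OF exp_kernel_bound nn]) (use \<open>0 < L\<close> y in auto)
  finally have "cmod (z y) \<le> A + B * (\<psi> y * (exp (L * y) / L))"
    using le[OF y(1)] mult_left_mono[OF _ \<open>0 \<le> B\<close>] by fastforce
  moreover have "B * (\<psi> y * (exp (L * y) / L)) \<le> \<psi> y * exp (L * y) / 2"
  proof -
    have "B / L \<le> 1 / 2" using \<open>0 < L\<close> by (simp add: L_def field_simps)
    then have "B / L * (\<psi> y * exp (L * y)) \<le> 1 / 2 * (\<psi> y * exp (L * y))"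
      by (rule mult_right_mono) (use nn in simp)
    then show ?thesis by simp
  qed
  moreover have "cmod (z y) = \<psi> y * exp (L * y)" by (simp add: \<psi>_def exp_minus)
  ultimately have "\<psi> y * exp (L * y) \<le> 2 * A" by linarith
  moreover have "1 \<le> exp (L * y)" using \<open>0 < L\<close> y by simp
  then have "\<psi> y * 1 \<le> \<psi> y * exp (L * y)" by (rule mult_left_mono[OF _ nn])
  ultimately have \<psi>A: "\<psi> y \<le> 2 * A" by simp
  have "cmod (z x) \<le> \<psi> y * exp (L * x)" by (rule zle[OF x])
  also have "\<dots> \<le> 2 * A * exp L"
    by (intro mult_mono \<psi>A) (use \<open>0 < L\<close> \<open>0 \<le> A\<close> x in auto)
  finally show ?thesis by (simp add: L_def)
qed

text \<open>For continuous h the iterated integral J equals \<open>volterra h\<close>: integrate by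
  parts on [0, y] with the antiderivative (y - t) I(t) + J(t).\<close>

lemma volterra_derivs:
  assumes h: "continuous_on {0..1} h" and x: "x \<in> {0..1}"
  shows "((\<lambda>x. integral {0..x} h) has_vector_derivative h x) (at x within {0..1})"
    and "(volterra h has_vector_derivative integral {0..x} h) (at x within {0..1})"
proof -
  define I where "I = (\<lambda>x. integral {0..x} h)"
  define J where "J = (\<lambda>x. integral {0..x} I)"
  have I: "(I has_vector_derivative h x) (at x within {0..1})" if "x \<in> {0..1}" for x
    unfolding I_def by (rule integral_has_vector_derivative[OF h that])
  have Ic: "continuous_on {0..1} I"
    using I has_vector_derivative_continuous continuous_on_eq_continuous_within by blast
  have J: "(J has_vector_derivative I x) (at x within {0..1})" if "x \<in> {0..1}" for x
    unfolding J_def by (rule integral_has_vector_derivative[OF Ic that])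
  have "volterra h y = J y" if y: "y \<in> {0..1}" for y
  proof -
    have "volterra h y = (LINT t|I01. indicator {0..y} t *\<^sub>R (of_real (y - t) * h t))"
      unfolding volterra_def
      by (rule I01_integral_cong) (auto simp: indicator_def)
    also have "\<dots> = (of_real (y - y) * I y + J y) - (of_real (y - 0) * I 0 + J 0)"
    proof (rule LINT_I01_FTC_interval)
      fix t assume t: "t \<in> {0..y}"
      have sub: "{0..y} \<subseteq> {0..1}" "t \<in> {0..1}" using t y by auto
      have "((\<lambda>t. complex_of_real (y - t)) has_vector_derivative of_real (-1)) (at t within {0..y})"
        by (rule has_vector_derivative_of_real) (auto intro!: derivative_eq_intros)
      then have "((\<lambda>t. of_real (y - t) * I t + J t) has_vector_derivative
             (of_real (y - t) * h t + of_real (-1) * I t) + I t) (at t within {0..y})"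
        by (intro has_vector_derivative_add has_vector_derivative_mult)
           (use I[OF sub(2)] J[OF sub(2)] sub(1) has_vector_derivative_within_subset in blast)+
      then show "((\<lambda>t. of_real (y - t) * I t + J t) has_vector_derivative of_real (y - t) * h t) (at t within {0..y})"
        by simp
    next
      have "continuous_on {0..y} h" by (rule continuous_on_subset[OF h]) (use y in auto)
      then show "continuous_on {0..y} (\<lambda>t. complex_of_real (y - t) * h t)" by (intro continuous_intros)
    qed (use y in auto)
    finally show ?thesis by (simp add: I_def J_def)
  qed
  then show "(volterra h has_vector_derivative integral {0..x} h) (at x within {0..1})"
    using J[OF x] x unfolding I_def
    by (metis (no_types, lifting) has_vector_derivative_transform)
  show "((\<lambda>x. integral {0..x} h) has_vector_derivative h x) (at x within {0..1})"
    using I[OF x] by (simp add: I_def)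
qed

section \<open>The Cauchy problem: Taylor formulas, existence and stability\<close>

locale potential =
  fixes q :: "real \<Rightarrow> real" and Q :: real
  assumes q_cont: "continuous_on {0..1} q" and Q_nonneg: "0 \<le> Q"
    and q_le: "\<And>x. x \<in> {0..1} \<Longrightarrow> \<bar>q x\<bar> \<le> Q"
begin

lemma qc: "continuous_on {0..1} (\<lambda>x. complex_of_real (q x))"
  by (intro continuous_intros q_cont)

lemma q_mult_integrable:
  fixes h :: "real \<Rightarrow> complex"
  assumes "integrable I01 h" shows "integrable I01 (\<lambda>t. of_real (q t) * h t)"
  by (rule I01_integrable_mult_bounded[OF assms I01_continuous_measurable[OF qc], where B = Q])
     (auto intro!: AE_I01I q_le)

text \<open>Taylor's formula with integral remainder for g'' = -W q g, expanded forward from t and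
  backward from x. Both come from the antiderivative (b s + a) g' - b g of (b s + a) g'', with (b,
  a) equal to (-1, x) and (1, -t).\<close>

lemma taylor_second_order:
  fixes g :: "real \<Rightarrow> complex"
  assumes "0 \<le> t" "t \<le> x" "x \<le> 1"
    and g: "\<And>s. s \<in> {0..1} \<Longrightarrow> (g has_vector_derivative g' s) (at s within {0..1})"
      "\<And>s. s \<in> {0..1} \<Longrightarrow> (g' has_vector_derivative - (W * (of_real (q s) * g s))) (at s within {0..1})"
  shows "g x = g t + of_real (x - t) * g' t - W * (LINT s|I01. indicator {t..x} s *\<^sub>R (of_real (x - s) * (of_real (q s) * g s)))"
    and "g t = g x - of_real (x - t) * g' x - W * (LINT s|I01. indicator {t..x} s *\<^sub>R (of_real (s - t) * (of_real (q s) * g s)))"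
proof -
  define g'' where "g'' s = - (W * (of_real (q s) * g s))" for s
  have sub: "{t..x} \<subseteq> {0..1}" using assms by auto
  have gc: "continuous_on {0..1} g"
    using g(1) has_vector_derivative_continuous continuous_on_eq_continuous_within by blast
  have c: "continuous_on {t..x} (\<lambda>s. of_real (b * s + a) * g'' s)" for a b :: real
    unfolding g''_def by (rule continuous_on_subset[OF _ sub]) (intro continuous_intros qc gc)
  have lin: "((\<lambda>s. complex_of_real (b * s + a)) has_vector_derivative of_real b) (at s within S)" for a b s S
    by (rule has_vector_derivative_of_real) (auto intro!: derivative_eq_intros)
  have d: "((\<lambda>s. of_real (b * s + a) * g' s - of_real b * g s) has_vector_derivative of_real (b * s + a) * g'' s) (at s within {t..x})"
    if "s \<in> {t..x}" for a b s
  proof -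
    have "((\<lambda>s. of_real (b * s + a) * g' s - of_real b * g s) has_vector_derivative
        (of_real (b * s + a) * g'' s + of_real b * g' s) - of_real b * g' s) (at s within {0..1})"
      unfolding g''_def
      by (intro has_vector_derivative_diff has_vector_derivative_mult has_vector_derivative_mult_right g lin)
         (use that sub in auto)
    then show ?thesis using has_vector_derivative_within_subset[OF _ sub] by simp
  qed
  have i: "(LINT s|I01. indicator {t..x} s *\<^sub>R (of_real (b * s + a) * g'' s)) =
      (of_real (b * x + a) * g' x - of_real b * g x) - (of_real (b * t + a) * g' t - of_real b * g t)" for a b
    by (rule LINT_I01_FTC_interval[OF assms(1,2,3) d c])
  have W: "(LINT s|I01. indicator {t..x} s *\<^sub>R (of_real (b * s + a) * g'' s)) =
      - (W * (LINT s|I01. indicator {t..x} s *\<^sub>R (of_real (b * s + a) * (of_real (q s) * g s))))" for a b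
  proof -
    have "(LINT s|I01. indicator {t..x} s *\<^sub>R (of_real (b * s + a) * g'' s)) =
      (LINT s|I01. - W * (indicator {t..x} s *\<^sub>R (of_real (b * s + a) * (of_real (q s) * g s))))"
      by (rule I01_integral_cong) (simp add: g''_def mult_ac)
    also have "\<dots> = - W * (LINT s|I01. indicator {t..x} s *\<^sub>R (of_real (b * s + a) * (of_real (q s) * g s)))"
      by (rule integral_mult_right_zero)
    finally show ?thesis by (simp only: mult_minus_left)
  qed
  show "g x = g t + of_real (x - t) * g' t - W * (LINT s|I01. indicator {t..x} s *\<^sub>R (of_real (x - s) * (of_real (q s) * g s)))"
    using i[of "-1" x] unfolding W by (simp add: algebra_simps)
  show "g t = g x - of_real (x - t) * g' x - W * (LINT s|I01. indicator {t..x} s *\<^sub>R (of_real (s - t) * (of_real (q s) * g s)))"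
    using i[of 1 "- t"] unfolding W by (simp add: algebra_simps)
qed

lemma solves_ivpE:
  assumes "solves_ivp q \<omega> \<alpha> \<beta> z"
  obtains z' where "\<And>x. x \<in> {0..1} \<Longrightarrow> (z has_vector_derivative z' x) (at x within {0..1})"
    "\<And>x. x \<in> {0..1} \<Longrightarrow> (z' has_vector_derivative - (\<omega>\<^sup>2 * (of_real (q x) * z x))) (at x within {0..1})"
    "z 0 = \<alpha>" "z' 0 = \<beta>"
  using assms unfolding solves_ivp_def by (metis add_eq_0_iff2 mult.assoc)

lemma volterra_q_bound:
  assumes "integrable I01 h" "\<And>t. t \<in> {0<..<1} \<Longrightarrow> cmod (h t) \<le> e t" "continuous_on {0..1} e"
  shows "cmod (volterra (\<lambda>t. of_real (q t) * h t) x) \<le> Q * (LINT t|I01. max 0 (x - t) * e t)"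
proof -
  have "cmod (volterra (\<lambda>t. of_real (q t) * h t) x) \<le> (LINT t|I01. Q * (max 0 (x - t) * e t))"
    unfolding volterra_def
  proof (rule integral_norm_bound_AE)
    show "integrable I01 (\<lambda>t. Q * (max 0 (x - t) * e t))"
      by (intro I01_continuous_integrable continuous_intros assms)
    show "AE t in I01. cmod (of_real (max 0 (x - t)) * (of_real (q t) * h t)) \<le> Q * (max 0 (x - t) * e t)"
    proof (rule AE_I01I)
      fix t :: real assume t: "0 < t" "t < 1"
      have "max 0 (x - t) * (\<bar>q t\<bar> * cmod (h t)) \<le> max 0 (x - t) * (Q * e t)"
        by (intro mult_left_mono mult_mono q_le assms(2)) (use t Q_nonneg in auto)
      then show "cmod (of_real (max 0 (x - t)) * (of_real (q t) * h t)) \<le> Q * (max 0 (x - t) * e t)"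
        by (simp add: norm_mult mult_ac)
    qed
  qed
  then show ?thesis by simp
qed

text \<open>Picard iteration in the norm weighted by exp(L x), which contracts by 1/2 whatever
  \<omega> is. Measurability passes to the pointwise limit and boundedness comes from the ball;
  continuity is regained later from the integral equation.\<close>

lemma ivp_integral_equation_solution:
  "\<exists>z. z \<in> borel_measurable I01 \<and> (\<exists>B. \<forall>x\<in>{0..1}. cmod (z x) \<le> B) \<and>
     (\<forall>x\<in>{0..1}. z x = \<alpha> + \<beta> * of_real x - \<omega>\<^sup>2 * volterra (\<lambda>t. of_real (q t) * z t) x)"
proof -
  define W where "W = \<omega>\<^sup>2"
  define L where "L = 2 * (cmod W * Q) + 1"
  have L: "0 < L" using Q_nonneg by (simp add: L_def add_nonneg_pos)
  define f0 where "f0 = (\<lambda>x::real. \<alpha> + \<beta> * of_real x)"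
  define A where "A = cmod \<alpha> + cmod \<beta>"
  \<comment> \<open>Twice the bound |\<omega>^2| Q A on the first displacement F f0 - f0, for which
    \<open>weighted_contraction\<close> allows half the radius.\<close>
  define R where "R = 2 * (cmod W * (Q * A))"
  define w where "w = (\<lambda>x::real. exp (L * x))"
  define F where "F = (\<lambda>f x. if x \<in> {0..1} then f0 x - W * volterra (\<lambda>t. of_real (q t) * f t) x else f0 x)"
  have A: "0 \<le> A" "0 \<le> R" using Q_nonneg by (auto simp: A_def R_def)
  have f0c: "continuous_on {0..1} f0" unfolding f0_def by (intro continuous_intros)
  have f0A: "cmod (f0 x) \<le> A" if "x \<in> {0..1}" for x
  proof -
    have "cmod (f0 x) \<le> cmod \<alpha> + cmod \<beta> * \<bar>x\<bar>"
      unfolding f0_def by (rule order_trans[OF norm_triangle_ineq]) (simp add: norm_mult)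
    moreover have "cmod \<beta> * \<bar>x\<bar> \<le> cmod \<beta>" using that by (simp add: mult_left_le)
    ultimately show ?thesis by (simp add: A_def)
  qed
  have w1: "1 \<le> w x" "w x \<le> exp L" if "x \<in> {0..1}" for x using that L by (auto simp: w_def)
  have bnd: "cmod (f x) \<le> A + R * exp L" if "x \<in> {0..1}" "\<And>i. i \<in> {0..1} \<Longrightarrow> cmod (f i - f0 i) \<le> R * w i" for f x
  proof -
    have "cmod (f x) \<le> cmod (f x - f0 x) + cmod (f0 x)" using norm_triangle_ineq[of "f x - f0 x" "f0 x"] by simp
    also have "\<dots> \<le> R * exp L + A"
      using that(2)[OF that(1)] f0A[OF that(1)] mult_left_mono[OF w1(2)[OF that(1)] A(2)] by linarith
    finally show ?thesis by simp
  qed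
  have fint: "integrable I01 f" if "f \<in> borel_measurable I01" "\<And>i. i \<in> {0..1} \<Longrightarrow> cmod (f i - f0 i) \<le> R * w i" for f
    by (rule I01.integrable_const_bound[where B = "A + R * exp L"]) (use that bnd in \<open>auto intro!: AE_I01I\<close>)
  have "\<exists>f. f \<in> borel_measurable I01 \<and> (\<forall>i\<in>{0..1}. cmod (f i - f0 i) \<le> R * w i) \<and> (\<forall>i\<in>{0..1}. F f i = f i)"
  proof (rule weighted_contraction)
    show "f0 \<in> borel_measurable I01" by (rule I01_continuous_measurable[OF f0c])
    fix f assume f: "f \<in> borel_measurable I01" "\<And>i. i \<in> {0..1} \<Longrightarrow> cmod (f i - f0 i) \<le> R * w i"
    have "continuous_on {0..1} (\<lambda>x. f0 x - W * volterra (\<lambda>t. of_real (q t) * f t) x)"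
      by (intro continuous_intros f0c volterra_continuous q_mult_integrable fint f)
    then have "continuous_on {0..1} (F f)" by (rule continuous_on_eq) (simp add: F_def)
    then show "F f \<in> borel_measurable I01" by (rule I01_continuous_measurable)
  next
    fix X :: "nat \<Rightarrow> real \<Rightarrow> complex" and f assume "\<And>n. X n \<in> borel_measurable I01" "\<And>i. (\<lambda>n. X n i) \<longlonglongrightarrow> f i"
    then show "f \<in> borel_measurable I01" by (metis borel_measurable_LIMSEQ_metric)
  next
    fix i :: real assume i: "i \<in> {0..1}"
    have "cmod (volterra (\<lambda>t. of_real (q t) * f0 t) i) \<le> Q * (LINT t|I01. max 0 (i - t) * A)"
      by (rule volterra_q_bound[OF I01_continuous_integrable[OF f0c]]) (auto intro!: f0A continuous_intros)
    also have "(LINT t|I01. max 0 (i - t) * A) \<le> (LINT t|I01. A)"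
      by (rule integral_mono_AE)
         (use i A in \<open>auto intro!: AE_I01I mult_left_le_one_le I01_continuous_integrable continuous_intros\<close>)
    finally have "cmod (volterra (\<lambda>t. of_real (q t) * f0 t) i) \<le> Q * A"
      using Q_nonneg by (simp add: measure_I01 mult_left_mono)
    then have "cmod (F f0 i - f0 i) \<le> cmod W * (Q * A)"
      using i by (simp add: F_def norm_mult mult_left_mono)
    also have "\<dots> = R / 2 * 1" by (simp add: R_def)
    also have "\<dots> \<le> R / 2 * w i" by (rule mult_left_mono[OF w1(1)[OF i]]) (use A in simp)
    finally show "cmod (F f0 i - f0 i) \<le> R / 2 * w i" .
  next
    fix f g d and x :: real
    assume f: "f \<in> borel_measurable I01" "\<And>i. i \<in> {0..1} \<Longrightarrow> cmod (f i - f0 i) \<le> R * w i"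
      and g: "g \<in> borel_measurable I01" "\<And>i. i \<in> {0..1} \<Longrightarrow> cmod (g i - f0 i) \<le> R * w i"
      and d: "0 \<le> d" "\<And>i. i \<in> {0..1} \<Longrightarrow> cmod (f i - g i) \<le> d * w i" and x: "x \<in> {0..1}"
    have "volterra (\<lambda>t. of_real (q t) * f t) x = volterra (\<lambda>t. of_real (q t) * (f t - g t) + of_real (q t) * g t) x"
      by (simp add: algebra_simps)
    also have "\<dots> = volterra (\<lambda>t. of_real (q t) * (f t - g t)) x + volterra (\<lambda>t. of_real (q t) * g t) x"
      by (intro volterra_add q_mult_integrable Bochner_Integration.integrable_diff fint f g)
    finally have "F f x - F g x = - (W * volterra (\<lambda>t. of_real (q t) * (f t - g t)) x)"
      using x by (simp add: F_def algebra_simps)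
    then have "cmod (F f x - F g x) = cmod W * cmod (volterra (\<lambda>t. of_real (q t) * (f t - g t)) x)"
      by (simp add: norm_mult)
    also have "\<dots> \<le> cmod W * (Q * (LINT t|I01. max 0 (x - t) * (d * w t)))"
      by (intro mult_left_mono volterra_q_bound Bochner_Integration.integrable_diff fint f g)
         (use d in \<open>auto simp: w_def intro!: continuous_intros\<close>)
    also have "(LINT t|I01. max 0 (x - t) * (d * w t)) = d * (LINT t|I01. max 0 (x - t) * exp (L * t))"
      unfolding w_def by (subst integral_mult_right_zero[symmetric]) (simp add: mult_ac)
    also have "cmod W * (Q * (d * (LINT t|I01. max 0 (x - t) * exp (L * t)))) \<le> cmod W * (Q * (d * (exp (L * x) / L)))"
      by (intro mult_left_mono exp_kernel_bound L) (use x d Q_nonneg in auto)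
    also have "\<dots> = (cmod W * Q / L) * (d * w x)" by (simp add: w_def)
    also have "\<dots> \<le> 1 / 2 * (d * w x)"
      by (rule mult_right_mono) (use L d in \<open>auto simp: L_def field_simps w_def\<close>)
    finally show "cmod (F f x - F g x) \<le> d / 2 * w x" by simp
  qed (auto simp: F_def w_def A)
  then obtain z where z: "z \<in> borel_measurable I01" "\<forall>i\<in>{0..1}. cmod (z i - f0 i) \<le> R * w i" "\<forall>i\<in>{0..1}. F z i = z i"
    by blast
  have "z x = \<alpha> + \<beta> * of_real x - \<omega>\<^sup>2 * volterra (\<lambda>t. of_real (q t) * z t) x" if "x \<in> {0..1}" for x
    using z(3) that by (auto simp: F_def f0_def W_def)
  moreover have "\<exists>B. \<forall>x\<in>{0..1}. cmod (z x) \<le> B" using bnd[of _ z] z(2) by blast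
  ultimately show ?thesis using z(1) by blast
qed

text \<open>A bootstrap: the right-hand side of the integral equation is continuous for bounded
  measurable z, so z is continuous, and then twice differentiable.\<close>

lemma solves_ivp_exists: "\<exists>z. solves_ivp q \<omega> \<alpha> \<beta> z"
proof -
  obtain z B where z: "z \<in> borel_measurable I01" "\<forall>x\<in>{0..1}. cmod (z x) \<le> B"
    "\<forall>x\<in>{0..1}. z x = \<alpha> + \<beta> * of_real x - \<omega>\<^sup>2 * volterra (\<lambda>t. of_real (q t) * z t) x"
    using ivp_integral_equation_solution by blast
  have zi: "integrable I01 z"
    by (rule I01.integrable_const_bound[where B = B]) (use z in \<open>auto intro!: AE_I01I\<close>)
  have "continuous_on {0..1} (\<lambda>x. \<alpha> + \<beta> * of_real x - \<omega>\<^sup>2 * volterra (\<lambda>t. of_real (q t) * z t) x)"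
    by (intro continuous_intros volterra_continuous q_mult_integrable zi)
  then have zc: "continuous_on {0..1} z" by (rule continuous_on_eq) (use z(3) in simp)
  define h where "h = (\<lambda>t. of_real (q t) * z t)"
  have h: "continuous_on {0..1} h" unfolding h_def by (intro continuous_intros qc zc)
  have lin: "((\<lambda>x. complex_of_real x) has_vector_derivative of_real 1) (at x within {0..1})" for x
    by (rule has_vector_derivative_of_real) (auto intro!: derivative_eq_intros)
  have "(z has_vector_derivative (0 + \<beta> * of_real 1) - \<omega>\<^sup>2 * integral {0..x} h) (at x within {0..1})" if x: "x \<in> {0..1}" for x
  proof (rule has_vector_derivative_transform[OF x])
    show "((\<lambda>x. (\<alpha> + \<beta> * of_real x) - \<omega>\<^sup>2 * volterra h x) has_vector_derivative
        (0 + \<beta> * of_real 1) - \<omega>\<^sup>2 * integral {0..x} h) (at x within {0..1})"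
      by (intro has_vector_derivative_diff has_vector_derivative_add has_vector_derivative_const
          has_vector_derivative_mult_right lin volterra_derivs(2) h x)
  qed (use z(3) in \<open>simp add: h_def\<close>)
  moreover have "((\<lambda>x. (0 + \<beta> * of_real 1) - \<omega>\<^sup>2 * integral {0..x} h) has_vector_derivative 0 - \<omega>\<^sup>2 * h x) (at x within {0..1})"
    if x: "x \<in> {0..1}" for x
    by (intro has_vector_derivative_diff has_vector_derivative_const
          has_vector_derivative_mult_right volterra_derivs(1) h x)
  moreover have "z 0 = \<alpha>" using bspec[OF z(3), of 0] by (simp add: volterra_0)
  ultimately show ?thesis
    unfolding solves_ivp_def
    by (intro exI[of _ z] exI[of _ "\<lambda>x. (0 + \<beta> * of_real 1) - \<omega>\<^sup>2 * integral {0..x} h"] exI[of _ "\<lambda>x. 0 - \<omega>\<^sup>2 * h x"])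
       (auto simp: h_def)
qed

lemma solves_ivp_continuous:
  assumes "solves_ivp q \<omega> \<alpha> \<beta> z" shows "continuous_on {0..1} z"
  using solves_ivpE[OF assms] has_vector_derivative_continuous continuous_on_eq_continuous_within by metis

lemma solves_ivp_integral_equation:
  assumes "solves_ivp q \<omega> \<alpha> \<beta> z" "x \<in> {0..1}"
  shows "z x = \<alpha> + \<beta> * of_real x - \<omega>\<^sup>2 * volterra (\<lambda>t. of_real (q t) * z t) x"
proof -
  obtain z' where z: "\<And>x. x \<in> {0..1} \<Longrightarrow> (z has_vector_derivative z' x) (at x within {0..1})"
    "\<And>x. x \<in> {0..1} \<Longrightarrow> (z' has_vector_derivative - (\<omega>\<^sup>2 * (of_real (q x) * z x))) (at x within {0..1})"
    "z 0 = \<alpha>" "z' 0 = \<beta>"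
    by (rule solves_ivpE[OF assms(1)]) (rule that)
  have "(LINT s|I01. indicator {0..x} s *\<^sub>R (of_real (x - s) * (of_real (q s) * z s))) = volterra (\<lambda>t. of_real (q t) * z t) x"
    unfolding volterra_def by (rule I01_integral_cong) (auto simp: indicator_def)
  then show ?thesis using taylor_second_order(1)[OF order_refl _ _ z(1,2), of x] assms(2) z(3,4) by (simp add: mult.commute)
qed

text \<open>Gronwall applied to z - y, where y satisfies the integral equation with its own data and
  parameter v. Taking y = 0 gives the a priori bound; taking y as the solution at a limit frequency
  gives continuity in \<omega>. Only y enters M, which keeps M fixed along a sequence of z.\<close>

lemma solves_ivp_diff_bound:
  assumes z: "solves_ivp q \<omega> \<alpha> \<beta> z" and B: "cmod (\<omega>\<^sup>2) * Q \<le> B"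
    and y: "continuous_on {0..1} y" "\<And>x. x \<in> {0..1} \<Longrightarrow> cmod (y x) \<le> M"
    and yeq: "\<And>x. x \<in> {0..1} \<Longrightarrow> y x = \<alpha>' + \<beta>' * of_real x - v * volterra (\<lambda>t. of_real (q t) * y t) x"
    and x: "x \<in> {0..1}"
  shows "cmod (z x - y x) \<le> 2 * (cmod (\<alpha> - \<alpha>') + cmod (\<beta> - \<beta>') + cmod (\<omega>\<^sup>2 - v) * Q * M) * exp (2 * B + 1)"
proof (rule gronwall_I01[where z = "\<lambda>x. z x - y x"])
  note zc = solves_ivp_continuous[OF z]
  note zi = I01_continuous_integrable[OF zc] and yi = I01_continuous_integrable[OF y(1)]
  show "continuous_on {0..1} (\<lambda>x. z x - y x)" by (intro continuous_intros zc y)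
  have M: "0 \<le> M" using order_trans[OF norm_ge_zero y(2)[of 0]] by simp
  show "0 \<le> cmod (\<alpha> - \<alpha>') + cmod (\<beta> - \<beta>') + cmod (\<omega>\<^sup>2 - v) * Q * M" using M Q_nonneg by simp
  show "0 \<le> B" by (rule order_trans[OF _ B]) (simp add: Q_nonneg)
  fix x :: real assume x: "x \<in> {0..1}"
  define a b where "a = volterra (\<lambda>t. of_real (q t) * (z t - y t)) x" and "b = volterra (\<lambda>t. of_real (q t) * y t) x"
  have "volterra (\<lambda>t. of_real (q t) * z t) x = volterra (\<lambda>t. of_real (q t) * (z t - y t) + of_real (q t) * y t) x"
    by (simp add: algebra_simps)
  also have "\<dots> = a + b" unfolding a_def b_def
    by (intro volterra_add q_mult_integrable Bochner_Integration.integrable_diff zi yi)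
  finally have "z x - y x = (\<alpha> - \<alpha>') + (\<beta> - \<beta>') * of_real x - (\<omega>\<^sup>2 - v) * b - \<omega>\<^sup>2 * a"
    using solves_ivp_integral_equation[OF z x] yeq[OF x] by (simp add: b_def algebra_simps)
  then have "cmod (z x - y x) \<le> cmod (\<alpha> - \<alpha>') + cmod (\<beta> - \<beta>') * \<bar>x\<bar> + cmod (\<omega>\<^sup>2 - v) * cmod b + cmod (\<omega>\<^sup>2) * cmod a"
  proof -
    have "cmod (p + r - u - v) \<le> cmod p + cmod r + cmod u + cmod v" for p r u v
      using norm_triangle_ineq[of p r] norm_triangle_ineq4[of "p + r" u] norm_triangle_ineq4[of "p + r - u" v] by linarith
    then show ?thesis using \<open>z x - y x = _\<close> by (metis norm_mult norm_of_real)
  qed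
  also have "cmod (\<beta> - \<beta>') * \<bar>x\<bar> \<le> cmod (\<beta> - \<beta>')" using x by (simp add: mult_left_le)
  also have "cmod b \<le> Q * M"
  proof -
    have "cmod b \<le> Q * (LINT t|I01. max 0 (x - t) * M)"
      unfolding b_def by (rule volterra_q_bound[OF yi]) (auto intro!: y continuous_intros)
    also have "(LINT t|I01. max 0 (x - t) * M) \<le> (LINT t|I01. M)"
      by (rule integral_mono_AE)
         (use x M in \<open>auto intro!: AE_I01I mult_left_le_one_le I01_continuous_integrable continuous_intros\<close>)
    finally show ?thesis using Q_nonneg by (simp add: measure_I01 mult_left_mono)
  qed
  also have "cmod (\<omega>\<^sup>2) * cmod a \<le> B * (LINT t|I01. max 0 (x - t) * cmod (z t - y t))"
  proof -
    have "cmod a \<le> Q * (LINT t|I01. max 0 (x - t) * cmod (z t - y t))"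
      unfolding a_def
      by (intro volterra_q_bound Bochner_Integration.integrable_diff zi yi continuous_intros zc y) auto
    then have "cmod (\<omega>\<^sup>2) * cmod a \<le> (cmod (\<omega>\<^sup>2) * Q) * (LINT t|I01. max 0 (x - t) * cmod (z t - y t))"
      using mult_left_mono norm_ge_zero by (metis mult.assoc)
    also have "\<dots> \<le> B * (LINT t|I01. max 0 (x - t) * cmod (z t - y t))"
      by (rule mult_right_mono[OF B]) (auto intro!: Bochner_Integration.integral_nonneg)
    finally show ?thesis .
  qed
  finally show "cmod (z x - y x) \<le> (cmod (\<alpha> - \<alpha>') + cmod (\<beta> - \<beta>') + cmod (\<omega>\<^sup>2 - v) * Q * M) +
      B * (LINT t|I01. max 0 (x - t) * cmod (z t - y t))"
    by (simp add: mult_left_mono mult.assoc)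
qed fact

lemma solves_ivp_bound:
  assumes "solves_ivp q \<omega> \<alpha> \<beta> z" "cmod (\<omega>\<^sup>2) * Q \<le> B" "x \<in> {0..1}"
  shows "cmod (z x) \<le> 2 * (cmod \<alpha> + cmod \<beta>) * exp (2 * B + 1)"
  using solves_ivp_diff_bound[OF assms(1,2), of "\<lambda>x. 0" 0 0 0 0 x] assms(3) by simp

lemma z_sol: "solves_ivp q \<omega> 0 1 (z_sol q \<omega>)"
  unfolding z_sol_def by (rule someI_ex[OF solves_ivp_exists])

lemma zt_sol: "solves_ivp q \<omega> 1 0 (zt_sol q \<omega>)"
  unfolding zt_sol_def by (rule someI_ex[OF solves_ivp_exists])

text \<open>The kernel of the variation-of-constants formula, extended by zero. It solves a Volterra equation
  in each of its two variables; the one in the first variable serves the initial value problem, the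
  one in the second the problem with Cauchy data at \<open>1\<close>.\<close>

definition green :: "complex \<Rightarrow> real \<Rightarrow> real \<Rightarrow> complex" where
  "green \<omega> x t = (if t \<le> x then z_sol q \<omega> x * zt_sol q \<omega> t - z_sol q \<omega> t * zt_sol q \<omega> x else 0)"

lemma green_measurable: "(\<lambda>(x, t). green \<omega> x t) \<in> borel_measurable (I01 \<Otimes>\<^sub>M I01)"
proof -
  have [measurable]: "z_sol q \<omega> \<in> borel_measurable I01" "zt_sol q \<omega> \<in> borel_measurable I01"
    by (intro I01_continuous_measurable solves_ivp_continuous[OF z_sol] solves_ivp_continuous[OF zt_sol])+
  have "(\<lambda>(x, t). green \<omega> x t) = (\<lambda>p. if snd p \<le> fst p then z_sol q \<omega> (fst p) * zt_sol q \<omega> (snd p)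
      - z_sol q \<omega> (snd p) * zt_sol q \<omega> (fst p) else 0)" by (auto simp: green_def)
  also have "\<dots> \<in> borel_measurable (I01 \<Otimes>\<^sub>M I01)" by measurable
  finally show ?thesis .
qed

text \<open>The Wronskian z' y - z y' is constantly 1. For fixed t, the function y(t) z(s) - z(t)
  y(s) therefore has value 0 and slope 1 at s = t, and the forward Taylor formula applies. For fixed
  x, the function -y(x) z(s) + z(x) y(s) has value 0 and slope -1 at s = x, and the backward formula
  applies.\<close>

lemma green_integral_equations:
  assumes x: "x \<in> {0..1}" and t: "t \<in> {0..1}"
  shows "green \<omega> x t = of_real (max 0 (x - t)) - \<omega>\<^sup>2 * (LINT s|I01. of_real (max 0 (x - s)) * (of_real (q s) * green \<omega> s t))"
    and "green \<omega> x t = of_real (max 0 (x - t)) - \<omega>\<^sup>2 * (LINT s|I01. green \<omega> x s * of_real (q s) * of_real (max 0 (s - t)))"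
proof -
  define z y where "z = z_sol q \<omega>" and "y = zt_sol q \<omega>"
  have zs: "solves_ivp q \<omega> 0 1 z" and ys: "solves_ivp q \<omega> 1 0 y"
    unfolding z_def y_def by (rule z_sol zt_sol)+
  obtain z' where z: "\<And>x. x \<in> {0..1} \<Longrightarrow> (z has_vector_derivative z' x) (at x within {0..1})"
      "\<And>x. x \<in> {0..1} \<Longrightarrow> (z' has_vector_derivative - (\<omega>\<^sup>2 * (of_real (q x) * z x))) (at x within {0..1})"
      "z 0 = 0" "z' 0 = 1"
    by (rule solves_ivpE[OF zs]) (rule that)
  obtain y' where y: "\<And>x. x \<in> {0..1} \<Longrightarrow> (y has_vector_derivative y' x) (at x within {0..1})"
      "\<And>x. x \<in> {0..1} \<Longrightarrow> (y' has_vector_derivative - (\<omega>\<^sup>2 * (of_real (q x) * y x))) (at x within {0..1})"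
      "y 0 = 1" "y' 0 = 0"
    by (rule solves_ivpE[OF ys]) (rule that)
  have const: "((\<lambda>x. z' x * y x - z x * y' x) has_vector_derivative 0) (at s within {0..1})"
    if s: "s \<in> {0..1}" for s
  proof -
    have "((\<lambda>x. z' x * y x - z x * y' x) has_vector_derivative
        (z' s * y' s + - (\<omega>\<^sup>2 * (of_real (q s) * z s)) * y s) - (z s * - (\<omega>\<^sup>2 * (of_real (q s) * y s)) + z' s * y' s)) (at s within {0..1})"
      by (intro has_vector_derivative_diff has_vector_derivative_mult z y s)
    then show ?thesis by simp
  qed
  obtain c where c: "\<And>x. x \<in> {0..1} \<Longrightarrow> z' x * y x - z x * y' x = c"
    by (rule has_vector_derivative_zero_constant[OF _ const]) auto
  from c[of 0] z(3,4) y(3,4) have "c = 1" by simp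
  with c have wronski: "z' s * y s - z s * y' s = 1" if "s \<in> {0..1}" for s using that by blast
  have comb: "((\<lambda>s. \<alpha> * z s - \<beta> * y s) has_vector_derivative \<alpha> * z' s - \<beta> * y' s) (at s within {0..1})"
    "((\<lambda>s. \<alpha> * z' s - \<beta> * y' s) has_vector_derivative - (\<omega>\<^sup>2 * (of_real (q s) * (\<alpha> * z s - \<beta> * y s)))) (at s within {0..1})"
    if s: "s \<in> {0..1}" for \<alpha> \<beta> s
  proof -
    show "((\<lambda>s. \<alpha> * z s - \<beta> * y s) has_vector_derivative \<alpha> * z' s - \<beta> * y' s) (at s within {0..1})"
      by (intro has_vector_derivative_diff has_vector_derivative_mult_right z y s)
    have "((\<lambda>s. \<alpha> * z' s - \<beta> * y' s) has_vector_derivative \<alpha> * - (\<omega>\<^sup>2 * (of_real (q s) * z s)) - \<beta> * - (\<omega>\<^sup>2 * (of_real (q s) * y s))) (at s within {0..1})"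
      by (intro has_vector_derivative_diff has_vector_derivative_mult_right z y s)
    then show "((\<lambda>s. \<alpha> * z' s - \<beta> * y' s) has_vector_derivative - (\<omega>\<^sup>2 * (of_real (q s) * (\<alpha> * z s - \<beta> * y s)))) (at s within {0..1})"
      by (simp add: algebra_simps)
  qed
  show "green \<omega> x t = of_real (max 0 (x - t)) - \<omega>\<^sup>2 * (LINT s|I01. of_real (max 0 (x - s)) * (of_real (q s) * green \<omega> s t))"
  proof (cases "t \<le> x")
    case True
    have "(LINT s|I01. indicator {t..x} s *\<^sub>R (of_real (x - s) * (of_real (q s) * (y t * z s - z t * y s)))) =
       (LINT s|I01. of_real (max 0 (x - s)) * (of_real (q s) * green \<omega> s t))"
      by (rule I01_integral_cong) (auto simp: indicator_def green_def z_def y_def max_def mult.commute)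
    moreover have "y t * z' t - z t * y' t = 1" using wronski[OF t] by (simp add: mult.commute)
    ultimately show ?thesis
      using taylor_second_order(1)[OF _ True _ comb, of "y t" "z t"] True x t
      by (simp add: green_def z_def y_def mult.commute)
  next
    case False
    have "(LINT s|I01. of_real (max 0 (x - s)) * (of_real (q s) * green \<omega> s t)) = (LINT s|I01. 0)"
      by (rule I01_integral_cong) (use False in \<open>auto simp: green_def\<close>)
    then show ?thesis using False by (simp add: green_def)
  qed
  show "green \<omega> x t = of_real (max 0 (x - t)) - \<omega>\<^sup>2 * (LINT s|I01. green \<omega> x s * of_real (q s) * of_real (max 0 (s - t)))"
  proof (cases "t \<le> x")
    case True
    have "(LINT s|I01. indicator {t..x} s *\<^sub>R (of_real (s - t) * (of_real (q s) * (- y x * z s - - z x * y s)))) =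
       (LINT s|I01. green \<omega> x s * of_real (q s) * of_real (max 0 (s - t)))"
      by (rule I01_integral_cong) (auto simp: indicator_def green_def z_def y_def max_def algebra_simps)
    moreover have "- y x * z' x - - z x * y' x = - 1" using wronski[OF x] by algebra
    ultimately show ?thesis
      using taylor_second_order(2)[OF _ True _ comb, of "- y x" "- z x"] True x t
      by (simp add: green_def z_def y_def mult.commute)
  next
    case False
    have "(LINT s|I01. green \<omega> x s * of_real (q s) * of_real (max 0 (s - t))) = (LINT s|I01. 0)"
      by (rule I01_integral_cong) (use False in \<open>auto simp: green_def\<close>)
    then show ?thesis using False by (simp add: green_def)
  qed
qed

end

section \<open>Essential bounds, and solution bounds that vanish linearly at 0\<close>

lemma Linf_AE_bound:
  assumes "chi \<in> Linf"
  shows "chi \<in> borel_measurable I01" "Linf_norm chi < ereal c \<Longrightarrow> AE x in I01. \<bar>chi x\<bar> \<le> c"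
    "\<exists>K>0. AE x in I01. \<bar>chi x\<bar> \<le> K"
proof -
  show m: "chi \<in> borel_measurable I01" using assms by (simp add: Linf_def)
  have ae: "AE x in I01. ereal \<bar>chi x\<bar> \<le> Linf_norm chi"
    unfolding Linf_norm_def by (rule esssup_AE)
  show b: "AE x in I01. \<bar>chi x\<bar> \<le> c" if "Linf_norm chi < ereal c" for c
    using ae by eventually_elim (use that in \<open>meson ereal_less_eq(3) le_less_trans less_imp_le\<close>)
  have "Linf_norm chi < \<infinity>" using assms by (simp add: Linf_def)
  then obtain K where "Linf_norm chi < ereal K" by (metis ereal_dense2)
  then have "AE x in I01. \<bar>chi x\<bar> \<le> K" by (rule b)
  then have "AE x in I01. \<bar>chi x\<bar> \<le> \<bar>K\<bar> + 1" by eventually_elim linarith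
  then show "\<exists>K>0. AE x in I01. \<bar>chi x\<bar> \<le> K" by (intro exI[of _ "\<bar>K\<bar> + 1"]) auto
qed

text \<open>M = 2 exp(2 B + 1) is the Gronwall bound for both basic solutions, and inserting it into
  the integral equation gives |z(x)| \<le> (1 + B M) x. The value 1 + M + B M covers both estimates
  by one number.\<close>

definition sol_bound :: "real \<Rightarrow> real" where
  "sol_bound B = 1 + (1 + B) * (2 * exp (2 * B + 1))"

context potential
begin

text \<open>Gronwall alone yields boundedness; the factor x comes from one further pass through the
  integral equation, whose Volterra term carries a factor x.\<close>

lemma sol_bounds:
  assumes B: "cmod (\<omega>\<^sup>2) * Q \<le> B" and x: "x \<in> {0..1}"
  shows "cmod (z_sol q \<omega> x) \<le> sol_bound B * x" "cmod (z_sol q \<omega> x) \<le> sol_bound B"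
    "cmod (zt_sol q \<omega> x) \<le> sol_bound B" "1 \<le> sol_bound B"
proof -
  define M where "M = 2 * exp (2 * B + 1)"
  have B0: "0 \<le> B" by (rule order_trans[OF _ B]) (simp add: Q_nonneg)
  have M0: "0 \<le> M" by (simp add: M_def)
  have z: "cmod (z_sol q \<omega> t) \<le> M" if "t \<in> {0..1}" for t
    using solves_ivp_bound[OF z_sol B that] by (simp add: M_def)
  have sb: "sol_bound B = 1 + M + B * M" by (simp add: sol_bound_def M_def distrib_right)
  show "cmod (zt_sol q \<omega> x) \<le> sol_bound B"
  proof -
    have "cmod (zt_sol q \<omega> x) \<le> M" using solves_ivp_bound[OF zt_sol B x] by (simp add: M_def)
    then show ?thesis using mult_nonneg_nonneg[OF B0 M0] unfolding sb by linarith
  qed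
  show "1 \<le> sol_bound B" using B0 M0 by (simp add: sb)
  have zi: "integrable I01 (\<lambda>t. of_real (q t) * z_sol q \<omega> t)"
    by (intro q_mult_integrable I01_continuous_integrable solves_ivp_continuous[OF z_sol])
  have "(LINT t|I01. cmod (of_real (q t) * z_sol q \<omega> t)) \<le> Q * M"
  proof -
    have "norm (LINT t|I01. cmod (of_real (q t) * z_sol q \<omega> t)) \<le> Q * M"
      by (rule I01_norm_le_const)
         (auto simp: norm_mult Q_nonneg intro!: AE_I01I mult_mono q_le z)
    then show ?thesis by simp
  qed
  then have "cmod (volterra (\<lambda>t. of_real (q t) * z_sol q \<omega> t) x) \<le> x * (Q * M)"
    using volterra_bound[OF zi, of x] x mult_left_mono[of _ "Q * M" x] by fastforce
  then have "cmod (\<omega>\<^sup>2) * cmod (volterra (\<lambda>t. of_real (q t) * z_sol q \<omega> t) x) \<le> cmod (\<omega>\<^sup>2) * (x * (Q * M))"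
    by (rule mult_left_mono) simp
  also have "\<dots> = (cmod (\<omega>\<^sup>2) * Q) * (x * M)" by simp
  also have "\<dots> \<le> B * (x * M)" by (rule mult_right_mono[OF B]) (use x M0 in simp)
  finally have V: "cmod (\<omega>\<^sup>2 * volterra (\<lambda>t. of_real (q t) * z_sol q \<omega> t) x) \<le> B * (x * M)"
    by (simp add: norm_mult)
  have "z_sol q \<omega> x = of_real x - \<omega>\<^sup>2 * volterra (\<lambda>t. of_real (q t) * z_sol q \<omega> t) x"
    using solves_ivp_integral_equation[OF z_sol x] by simp
  then have "cmod (z_sol q \<omega> x) \<le> x + B * (x * M)"
    using norm_triangle_ineq4[of "of_real x :: complex"] V x by (smt (verit) norm_of_real atLeastAtMost_iff)
  also have "\<dots> \<le> sol_bound B * x" using x M0 by (simp add: sb algebra_simps)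
  finally show 1: "cmod (z_sol q \<omega> x) \<le> sol_bound B * x" .
  have "sol_bound B * x \<le> sol_bound B" using x \<open>1 \<le> sol_bound B\<close> by (simp add: mult_left_le)
  with 1 show "cmod (z_sol q \<omega> x) \<le> sol_bound B" by linarith
qed

lemma green_bound:
  assumes B: "cmod (\<omega>\<^sup>2) * Q \<le> B" and x: "x \<in> {0..1}" and t: "t \<in> {0..1}"
  shows "cmod (green \<omega> x t) \<le> 2 * (sol_bound B)\<^sup>2 * x" "cmod (green \<omega> x t) \<le> 2 * (sol_bound B)\<^sup>2"
proof -
  let ?M = "sol_bound B"
  note bx = sol_bounds[OF B x] and bt = sol_bounds[OF B t]
  show 1: "cmod (green \<omega> x t) \<le> 2 * ?M\<^sup>2 * x"
  proof (cases "t \<le> x")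
    case True
    have "cmod (green \<omega> x t) \<le> cmod (z_sol q \<omega> x * zt_sol q \<omega> t) + cmod (z_sol q \<omega> t * zt_sol q \<omega> x)"
      using True by (simp add: green_def norm_triangle_ineq4)
    also have "\<dots> \<le> (?M * x) * ?M + (?M * t) * ?M"
      unfolding norm_mult by (intro add_mono mult_mono bx bt) (use bx(4) x t in auto)
    \<comment> \<open>The kernel lives on t \<le> x, so the factor t coming from z(t) may be
      replaced by x.\<close>
    also have "(?M * t) * ?M \<le> (?M * x) * ?M" by (intro mult_mono order_refl) (use True bx(4) x t in auto)
    finally show ?thesis by (simp add: power2_eq_square mult_ac)
  qed (use x in \<open>simp add: green_def\<close>)
  have "2 * ?M\<^sup>2 * x \<le> 2 * ?M\<^sup>2" using x by (simp add: mult_left_le)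
  with 1 show "cmod (green \<omega> x t) \<le> 2 * ?M\<^sup>2" by linarith
qed

lemma z_zt_measurable: "z_sol q \<omega> \<in> borel_measurable I01" "zt_sol q \<omega> \<in> borel_measurable I01"
  by (intro I01_continuous_measurable solves_ivp_continuous[OF z_sol] solves_ivp_continuous[OF zt_sol])+

lemma green_section_measurable:
  "(\<lambda>t. green \<omega> x t) \<in> borel_measurable I01" "(\<lambda>x. green \<omega> x t) \<in> borel_measurable I01"
proof -
  note [measurable] = z_zt_measurable
  show "(\<lambda>t. green \<omega> x t) \<in> borel_measurable I01" "(\<lambda>x. green \<omega> x t) \<in> borel_measurable I01"
    unfolding green_def by measurable
qed

lemma green_mult_integrable:
  fixes h :: "real \<Rightarrow> complex"
  assumes h: "integrable I01 h"
  shows "x \<in> {0..1} \<Longrightarrow> integrable I01 (\<lambda>t. green \<omega> x t * h t)"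
    "t \<in> {0..1} \<Longrightarrow> integrable I01 (\<lambda>x. green \<omega> x t * h x)"
  by (rule I01_integrable_mult_bounded[OF h green_section_measurable(1), where B = "2 * (sol_bound (cmod (\<omega>\<^sup>2) * Q))\<^sup>2"]
      I01_integrable_mult_bounded[OF h green_section_measurable(2), where B = "2 * (sol_bound (cmod (\<omega>\<^sup>2) * Q))\<^sup>2"];
      auto intro!: AE_I01I green_bound(2))+

section \<open>Solution operators with Cauchy data at 0 and at 1\<close>

definition green_op :: "complex \<Rightarrow> (real \<Rightarrow> complex) \<Rightarrow> real \<Rightarrow> complex" where
  "green_op \<omega> h x = (LINT t|I01. green \<omega> x t * h t)"

text \<open>The transposed operator: it solves w'' + \<omega>^2 q w = h with w(1) = w'(1) = 0,
  whereas \<open>green_op\<close> has zero Cauchy data at 0.\<close>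

definition green_adj :: "complex \<Rightarrow> (real \<Rightarrow> complex) \<Rightarrow> real \<Rightarrow> complex" where
  "green_adj \<omega> h t = (LINT x|I01. green \<omega> x t * h x)"

lemma green_op_measurable:
  assumes "integrable I01 h"
  shows "green_op \<omega> h \<in> borel_measurable I01" "green_adj \<omega> h \<in> borel_measurable I01"
proof -
  have [measurable]: "h \<in> borel_measurable I01" using assms by auto
  note [measurable] = green_measurable[of \<omega>]
  have sw: "(\<lambda>(t, x). green \<omega> x t) \<in> borel_measurable (I01 \<Otimes>\<^sub>M I01)"
    using measurable_compose[OF measurable_pair_swap' green_measurable[of \<omega>]] by (simp add: case_prod_beta)
  show "green_op \<omega> h \<in> borel_measurable I01"
    unfolding green_op_def[abs_def]
  proof (rule I01.borel_measurable_lebesgue_integral)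
    show "(\<lambda>(x, t). green \<omega> x t * h t) \<in> borel_measurable (I01 \<Otimes>\<^sub>M I01)"
      using green_measurable[of \<omega>] by measurable
  qed
  show "green_adj \<omega> h \<in> borel_measurable I01"
    unfolding green_adj_def[abs_def]
  proof (rule I01.borel_measurable_lebesgue_integral)
    show "(\<lambda>(t, x). green \<omega> x t * h x) \<in> borel_measurable (I01 \<Otimes>\<^sub>M I01)"
      using sw by measurable
  qed
qed

text \<open>The majorant e is kept apart from h so that either |h| or a constant essential bound can
  be inserted.\<close>

lemma green_op_bound:
  assumes h: "integrable I01 h" and B: "cmod (\<omega>\<^sup>2) * Q \<le> B" and x: "x \<in> {0..1}"
    and e: "integrable I01 e" "AE t in I01. cmod (h t) \<le> e t"
  shows "cmod (green_op \<omega> h x) \<le> 2 * (sol_bound B)\<^sup>2 * (LINT t|I01. e t) * x"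
    "cmod (green_adj \<omega> h x) \<le> 2 * (sol_bound B)\<^sup>2 * (LINT t|I01. e t)"
proof -
  have "cmod (green_op \<omega> h x) \<le> (LINT t|I01. 2 * (sol_bound B)\<^sup>2 * x * e t)"
    unfolding green_op_def
  proof (rule integral_norm_bound_AE)
    show "AE t in I01. cmod (green \<omega> x t * h t) \<le> 2 * (sol_bound B)\<^sup>2 * x * e t"
      using e(2) by (rule AE_I01_mp) (use x in \<open>auto simp: norm_mult intro!: mult_mono green_bound(1)[OF B x]\<close>)
  qed (use e in simp)
  then show "cmod (green_op \<omega> h x) \<le> 2 * (sol_bound B)\<^sup>2 * (LINT t|I01. e t) * x" by (simp add: mult_ac)
  have "cmod (green_adj \<omega> h x) \<le> (LINT t|I01. 2 * (sol_bound B)\<^sup>2 * e t)"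
    unfolding green_adj_def
  proof (rule integral_norm_bound_AE)
    show "AE t in I01. cmod (green \<omega> t x * h t) \<le> 2 * (sol_bound B)\<^sup>2 * e t"
      using e(2) by (rule AE_I01_mp) (auto simp: norm_mult intro!: mult_mono green_bound(2)[OF B _ x])
  qed (use e in simp)
  then show "cmod (green_adj \<omega> h x) \<le> 2 * (sol_bound B)\<^sup>2 * (LINT t|I01. e t)" by simp
qed

lemma green_op_L2:
  assumes "integrable I01 h" shows "green_op \<omega> h \<in> L2" "green_adj \<omega> h \<in> L2"
proof -
  let ?B = "2 * (sol_bound (cmod (\<omega>\<^sup>2) * Q))\<^sup>2 * (LINT t|I01. cmod (h t))"
  have "cmod (green_op \<omega> h x) \<le> ?B" if x: "x \<in> {0..1}" for x
  proof -
    have "cmod (green_op \<omega> h x) \<le> ?B * x"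
      by (rule green_op_bound(1)[OF assms order_refl x]) (use assms in auto)
    also have "\<dots> \<le> ?B" by (rule mult_left_le) (use x in \<open>auto intro!: mult_nonneg_nonneg\<close>)
    finally show ?thesis .
  qed
  then show "green_op \<omega> h \<in> L2"
    by (intro L2_bounded[where B = ?B] green_op_measurable assms AE_I01I) auto
  show "green_adj \<omega> h \<in> L2"
    by (intro L2_bounded[where B = ?B] green_op_measurable assms AE_I01I green_op_bound(2) order_refl)
       (use assms in auto)
qed

text \<open>The kernel equation in the first variable, integrated against h; Fubini recombines the
  inner integral into \<open>green_op\<close>.\<close>

lemma green_op_volterra:
  assumes h: "integrable I01 h" and x: "x \<in> {0..1}"
  shows "green_op \<omega> h x = volterra h x - \<omega>\<^sup>2 * volterra (\<lambda>s. of_real (q s) * green_op \<omega> h s) x"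
proof -
  let ?\<phi> = "\<lambda>s. of_real (max 0 (x - s)) * complex_of_real (q s)"
  have "volterra h x - green_op \<omega> h x = (LINT t|I01. (of_real (max 0 (x - t)) - green \<omega> x t) * h t)"
    unfolding volterra_def green_op_def left_diff_distrib
    by (rule Bochner_Integration.integral_diff[symmetric])
       (intro max_kernel_integrable green_mult_integrable h x)+
  also have "\<dots> = (LINT t|I01. \<omega>\<^sup>2 * ((LINT s|I01. ?\<phi> s * green \<omega> s t) * h t))"
  proof (rule I01_integral_cong)
    fix t :: real assume "t \<in> {0<..<1}"
    then have "t \<in> {0..1}" by auto
    from green_integral_equations(1)[OF x this, of \<omega>]
    show "(of_real (max 0 (x - t)) - green \<omega> x t) * h t = \<omega>\<^sup>2 * ((LINT s|I01. ?\<phi> s * green \<omega> s t) * h t)"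
      by (simp add: mult.assoc)
  qed
  also have "\<dots> = \<omega>\<^sup>2 * (LINT t|I01. (LINT s|I01. ?\<phi> s * green \<omega> s t) * h t)" by simp
  also have "(LINT t|I01. (LINT s|I01. ?\<phi> s * green \<omega> s t) * h t) = (LINT s|I01. ?\<phi> s * (LINT t|I01. green \<omega> s t * h t))"
    by (rule I01_Fubini[symmetric, OF _ green_measurable _ h])
       (auto intro!: I01_continuous_integrable continuous_intros qc green_bound(2))
  also have "\<dots> = volterra (\<lambda>s. of_real (q s) * green_op \<omega> h s) x"
    by (simp add: volterra_def green_op_def mult.assoc)
  finally show ?thesis by (simp add: algebra_simps)
qed

text \<open>Here the kernel equation in the second variable is integrated, since t is now the free
  variable.\<close>

lemma green_adj_volterra:
  assumes h: "integrable I01 h" and t: "t \<in> {0..1}"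
  shows "green_adj \<omega> h t = volterra_adj h t - \<omega>\<^sup>2 * volterra_adj (\<lambda>s. of_real (q s) * green_adj \<omega> h s) t"
proof -
  let ?\<phi> = "\<lambda>s. complex_of_real (q s) * of_real (max 0 (s - t))"
  have sw: "(\<lambda>(s, x). green \<omega> x s) \<in> borel_measurable (I01 \<Otimes>\<^sub>M I01)"
    using measurable_compose[OF measurable_pair_swap' green_measurable[of \<omega>]] by (simp add: case_prod_beta)
  have "volterra_adj h t - green_adj \<omega> h t = (LINT x|I01. (of_real (max 0 (x - t)) - green \<omega> x t) * h x)"
    unfolding volterra_adj_def green_adj_def left_diff_distrib
    by (rule Bochner_Integration.integral_diff[symmetric])
       (intro max_kernel_integrable green_mult_integrable h t)+
  also have "\<dots> = (LINT x|I01. \<omega>\<^sup>2 * ((LINT s|I01. ?\<phi> s * green \<omega> x s) * h x))"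
  proof (rule I01_integral_cong)
    fix x :: real assume "x \<in> {0<..<1}"
    then have "x \<in> {0..1}" by auto
    from green_integral_equations(2)[OF this t, of \<omega>]
    show "(of_real (max 0 (x - t)) - green \<omega> x t) * h x = \<omega>\<^sup>2 * ((LINT s|I01. ?\<phi> s * green \<omega> x s) * h x)"
      by (simp add: mult_ac)
  qed
  also have "\<dots> = \<omega>\<^sup>2 * (LINT x|I01. (LINT s|I01. ?\<phi> s * green \<omega> x s) * h x)" by simp
  also have "(LINT x|I01. (LINT s|I01. ?\<phi> s * green \<omega> x s) * h x) = (LINT s|I01. ?\<phi> s * (LINT x|I01. green \<omega> x s * h x))"
    by (rule I01_Fubini[symmetric, OF _ sw _ h])
       (auto intro!: I01_continuous_integrable continuous_intros qc green_bound(2))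
  also have "\<dots> = volterra_adj (\<lambda>s. of_real (q s) * green_adj \<omega> h s) t"
    by (simp add: volterra_adj_def green_adj_def mult_ac)
  finally show ?thesis by (simp add: algebra_simps)
qed

text \<open>At t = 0 the kernel reduces to z(x), because z(0) = 0 and the other basic solution is 1
  there. This converts the boundary condition u2(0) = 0 into a scalar condition on the
  source.\<close>

lemma green_adj_0: "green_adj \<omega> h 0 = (LINT x|I01. z_sol q \<omega> x * h x)"
proof -
  have "z_sol q \<omega> 0 = 0" "zt_sol q \<omega> 0 = 1"
    using z_sol[of \<omega>] zt_sol[of \<omega>] unfolding solves_ivp_def by blast+
  then show ?thesis
    unfolding green_adj_def
    by (intro I01_integral_cong) (simp add: green_def)
qed

lemma a_sol_eq_green_op:
  assumes f: "f \<in> borel_measurable I01" and x: "x \<in> {0..1}"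
  shows "a_sol f q \<omega> x = green_op \<omega> f x"
proof -
  let ?k = "\<lambda>t. z_sol q \<omega> x * zt_sol q \<omega> t - z_sol q \<omega> t * zt_sol q \<omega> x"
  have "a_sol f q \<omega> x = (LINT t|lebesgue. indicator {0<..<x} t *\<^sub>R (?k t * f t))"
    unfolding a_sol_def by (rule integral_restrict_space) simp
  also have "\<dots> = (LINT t|lebesgue. indicator {0<..<1} t *\<^sub>R (indicator {0<..<x} t *\<^sub>R (?k t * f t)))"
    by (rule Bochner_Integration.integral_cong) (use x in \<open>auto simp: indicator_def\<close>)
  also have "\<dots> = (LINT t|I01. indicator {0<..<x} t *\<^sub>R (?k t * f t))"
    by (rule integral_restrict_space[symmetric]) simp
  also have "\<dots> = (LINT t|I01. green \<omega> x t * f t)"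
    by (rule I01_integral_cong) (auto simp: indicator_def green_def)
  finally show ?thesis by (simp add: green_op_def)
qed

lemma a_sol_measurable: "integrable I01 f \<Longrightarrow> a_sol f q \<omega> \<in> borel_measurable I01"
  by (rule measurable_I01_cong[OF green_op_measurable(1)]) (auto simp: a_sol_eq_green_op)

lemma a_sol_bound:
  assumes f: "integrable I01 f" and B: "cmod (\<omega>\<^sup>2) * Q \<le> B" and x: "x \<in> {0<..<1}"
  shows "cmod (a_sol f q \<omega> x) \<le> 2 * (sol_bound B)\<^sup>2 * (LINT t|I01. cmod (f t)) * x"
  using green_op_bound(1)[OF f B, of x "\<lambda>t. cmod (f t)"] x f by (simp add: a_sol_eq_green_op)

text \<open>The linear vanishing of z at 0 cancels the singular factor 1/x.\<close>

lemma z_sol_chi_bound: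
  assumes B: "cmod (\<omega>\<^sup>2) * Q \<le> B" and x: "x \<in> {0<..<1}" and K: "\<bar>chi x\<bar> \<le> K"
  shows "cmod (z_sol q \<omega> x * of_real (chi x / x)) \<le> sol_bound B * K"
proof -
  have x': "x \<in> {0..1}" using x by auto
  have "cmod (z_sol q \<omega> x * of_real (chi x / x)) \<le> (sol_bound B * x) * (K / x)"
    unfolding norm_mult
    by (intro mult_mono sol_bounds(1)[OF B x'])
       (use x K sol_bounds(4)[OF B x'] in \<open>auto simp: norm_divide divide_right_mono\<close>)
  then show ?thesis using x by simp
qed

section \<open>Continuous dependence on the frequency\<close>

lemma tendsto_imp_uniform_bound:
  assumes "\<Omega> \<longlonglongrightarrow> \<omega>"
  obtains B where "\<And>n. cmod ((\<Omega> n)\<^sup>2) * Q \<le> B" "\<And>n. cmod ((2 * \<Omega> n)\<^sup>2) * Q \<le> B"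
proof -
  have "Bseq \<Omega>" using assms convergent_imp_Bseq convergentI by blast
  then obtain r where r: "\<And>n. cmod (\<Omega> n) \<le> r" by (auto simp: Bseq_def)
  have "cmod ((2 * \<Omega> n)\<^sup>2) * Q \<le> (2 * r)\<^sup>2 * Q" for n
    unfolding norm_power by (intro mult_right_mono power_mono Q_nonneg) (simp_all add: norm_mult r)
  moreover have "cmod ((\<Omega> n)\<^sup>2) * Q \<le> cmod ((2 * \<Omega> n)\<^sup>2) * Q" for n
    by (rule mult_right_mono[OF _ Q_nonneg]) (simp add: norm_power norm_mult power_mult_distrib)
  ultimately show thesis using that order_trans by blast
qed

text \<open>The difference bound, with the limit solution in the role of y, is a multiple of the
  distance of the squared frequencies with a factor independent of n.\<close>

lemma solves_ivp_tendsto: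
  assumes \<omega>: "\<Omega> \<longlonglongrightarrow> \<omega>" and x: "x \<in> {0..1}"
    and Z: "\<And>n. solves_ivp q (\<Omega> n) \<alpha> \<beta> (Z n)" and z: "solves_ivp q \<omega> \<alpha> \<beta> z"
  shows "(\<lambda>n. Z n x) \<longlonglongrightarrow> z x"
proof -
  obtain B where B: "\<And>n. cmod ((\<Omega> n)\<^sup>2) * Q \<le> B" by (rule tendsto_imp_uniform_bound[OF \<omega>]) (rule that)
  define M where "M = 2 * (cmod \<alpha> + cmod \<beta>) * exp (2 * (cmod (\<omega>\<^sup>2) * Q) + 1)"
  have "(\<lambda>n. 2 * (cmod ((\<Omega> n)\<^sup>2 - \<omega>\<^sup>2) * Q * M) * exp (2 * B + 1)) \<longlonglongrightarrow> 2 * (cmod (\<omega>\<^sup>2 - \<omega>\<^sup>2) * Q * M) * exp (2 * B + 1)"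
    by (intro tendsto_intros \<omega>)
  then have lim: "(\<lambda>n. 2 * (cmod ((\<Omega> n)\<^sup>2 - \<omega>\<^sup>2) * Q * M) * exp (2 * B + 1)) \<longlonglongrightarrow> 0" by simp
  have "cmod (Z n x - z x) \<le> 2 * (cmod ((\<Omega> n)\<^sup>2 - \<omega>\<^sup>2) * Q * M) * exp (2 * B + 1)" for n
    using solves_ivp_diff_bound[OF Z B solves_ivp_continuous[OF z] solves_ivp_bound[OF z order_refl] solves_ivp_integral_equation[OF z] x]
    by (simp add: M_def)
  then have "(\<lambda>n. Z n x - z x) \<longlonglongrightarrow> 0"
    by (intro Lim_null_comparison[OF _ lim] always_eventually allI)
  then show ?thesis by (simp add: LIM_zero_iff)
qed

lemmas z_sol_tendsto = solves_ivp_tendsto[OF _ _ z_sol z_sol]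
lemmas zt_sol_tendsto = solves_ivp_tendsto[OF _ _ zt_sol zt_sol]

lemma green_op_tendsto:
  assumes \<omega>: "\<Omega> \<longlonglongrightarrow> \<omega>" and x: "x \<in> {0..1}" and h: "integrable I01 h"
  shows "(\<lambda>n. green_op (\<Omega> n) h x) \<longlonglongrightarrow> green_op \<omega> h x"
proof -
  obtain B where B: "\<And>n. cmod ((\<Omega> n)\<^sup>2) * Q \<le> B" by (rule tendsto_imp_uniform_bound[OF \<omega>]) (rule that)
  show ?thesis
    unfolding green_op_def
  proof (rule integral_dominated_convergence[where w = "\<lambda>t. 2 * (sol_bound B)\<^sup>2 * cmod (h t)"])
    show "AE t in I01. (\<lambda>n. green (\<Omega> n) x t * h t) \<longlonglongrightarrow> green \<omega> x t * h t"
    proof (rule AE_I01I)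
      fix t :: real assume "0 < t" "t < 1"
      then have t: "t \<in> {0..1}" by simp
      show "(\<lambda>n. green (\<Omega> n) x t * h t) \<longlonglongrightarrow> green \<omega> x t * h t"
        unfolding green_def by (cases "t \<le> x") (auto intro!: tendsto_intros z_sol_tendsto zt_sol_tendsto \<omega> x t)
    qed
    show "AE t in I01. norm (green (\<Omega> n) x t * h t) \<le> 2 * (sol_bound B)\<^sup>2 * cmod (h t)" for n
      unfolding norm_mult by (auto intro!: AE_I01I mult_right_mono green_bound(2)[OF B x])
  qed (use h green_section_measurable in auto)
qed

text \<open>Sequential continuity by dominated convergence. A convergent sequence of frequencies is
  bounded, so one B serves all its members and their doubles and provides constant
  majorants.\<close>

lemma zeta_det_continuous:
  assumes f: "integrable I01 f" and chi: "chi \<in> borel_measurable I01" "AE x in I01. \<bar>chi x\<bar> \<le> K"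
  shows "continuous_on UNIV (zeta_det f q chi)"
proof -
  have "(zeta_det f q chi \<circ> \<Omega>) \<longlonglongrightarrow> zeta_det f q chi \<omega>" if \<omega>: "\<Omega> \<longlonglongrightarrow> \<omega>" for \<Omega> \<omega>
  proof -
    obtain B where B: "\<And>n. cmod ((\<Omega> n)\<^sup>2) * Q \<le> B" "\<And>n. cmod ((2 * \<Omega> n)\<^sup>2) * Q \<le> B"
      by (rule tendsto_imp_uniform_bound[OF \<omega>]) (rule that)
    define M where "M = sol_bound B"
    define A where "A = 2 * M\<^sup>2 * (LINT t|I01. cmod (f t))"
    have M: "1 \<le> M" unfolding M_def using sol_bounds(4)[OF B(1)[of 0], of 0] by simp
    have fm: "f \<in> borel_measurable I01" using f by auto
    note am = a_sol_measurable[OF f]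
    have ab: "cmod (a_sol f q (\<Omega> n) x) \<le> A" if x: "x \<in> {0<..<1}" for n x
    proof -
      have "cmod (a_sol f q (\<Omega> n) x) \<le> A * x" unfolding A_def M_def by (rule a_sol_bound[OF f B(1) x])
      also have "\<dots> \<le> A" by (rule mult_left_le) (use x in \<open>auto simp: A_def intro!: mult_nonneg_nonneg\<close>)
      finally show ?thesis .
    qed
    have A: "0 \<le> A" by (auto simp: A_def intro!: mult_nonneg_nonneg)
    have at: "(\<lambda>n. a_sol f q (\<Omega> n) x) \<longlonglongrightarrow> a_sol f q \<omega> x" if x: "x \<in> {0..1}" for x
      unfolding a_sol_eq_green_op[OF fm x] by (rule green_op_tendsto[OF \<omega> x f])
    \<comment> \<open>The three integrals in the determinant share this form, with G equal to z a,
      z^2 or a^2. The remaining factor is bounded, so a uniform bound on G suffices.\<close>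
    have conv: "(\<lambda>n. LINT x|I01. G (\<Omega> n) x * z_sol q (2 * \<Omega> n) x * of_real (chi x / x)) \<longlonglongrightarrow>
          (LINT x|I01. G \<omega> x * z_sol q (2 * \<omega>) x * of_real (chi x / x))"
      if G: "\<And>\<omega>. G \<omega> \<in> borel_measurable I01" "\<And>n x. x \<in> {0<..<1} \<Longrightarrow> cmod (G (\<Omega> n) x) \<le> C"
        "\<And>x. x \<in> {0<..<1} \<Longrightarrow> (\<lambda>n. G (\<Omega> n) x) \<longlonglongrightarrow> G \<omega> x" for G :: "complex \<Rightarrow> real \<Rightarrow> complex" and C
    proof (rule integral_dominated_convergence[where w = "\<lambda>x. C * (M * K)"])
      have \<omega>2: "(\<lambda>n. 2 * \<Omega> n) \<longlonglongrightarrow> 2 * \<omega>" by (intro tendsto_intros \<omega>)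
      show "AE x in I01. (\<lambda>n. G (\<Omega> n) x * z_sol q (2 * \<Omega> n) x * of_real (chi x / x)) \<longlonglongrightarrow>
              G \<omega> x * z_sol q (2 * \<omega>) x * of_real (chi x / x)"
        by (rule AE_I01I) (intro tendsto_mult G z_sol_tendsto[OF \<omega>2] tendsto_const, auto)
      show "AE x in I01. norm (G (\<Omega> n) x * z_sol q (2 * \<Omega> n) x * of_real (chi x / x)) \<le> C * (M * K)" for n
        using chi(2)
      proof (rule AE_I01_mp)
        fix x assume x: "x \<in> {0<..<1}" and K: "\<bar>chi x\<bar> \<le> K"
        show "norm (G (\<Omega> n) x * z_sol q (2 * \<Omega> n) x * of_real (chi x / x)) \<le> C * (M * K)"
          unfolding mult.assoc norm_mult[of "G (\<Omega> n) x"] M_def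
          by (intro mult_mono G x z_sol_chi_bound[where chi = chi, OF B(2) x K]) (auto intro: order_trans[OF norm_ge_zero G(2)[OF x]])
      qed
    qed (use G(1) z_zt_measurable chi in auto)
    have zb: "cmod (z_sol q (\<Omega> n) x) \<le> M" if "x \<in> {0<..<1}" for n x
      unfolding M_def by (rule sol_bounds(2)[OF B(1)]) (use that in auto)
    have zt: "(\<lambda>n. z_sol q (\<Omega> n) x) \<longlonglongrightarrow> z_sol q \<omega> x" if "x \<in> {0<..<1}" for x
      by (rule z_sol_tendsto[OF \<omega>]) (use that in auto)
    have at': "(\<lambda>n. a_sol f q (\<Omega> n) x) \<longlonglongrightarrow> a_sol f q \<omega> x" if "x \<in> {0<..<1}" for x
      by (rule at) (use that in auto)
    show ?thesis
      unfolding zeta_det_def comp_def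
    proof (intro tendsto_diff tendsto_mult tendsto_power)
      show "(\<lambda>n. LINT x|I01. z_sol q (\<Omega> n) x * a_sol f q (\<Omega> n) x * z_sol q (2 * \<Omega> n) x * of_real (chi x / x)) \<longlonglongrightarrow>
          (LINT x|I01. z_sol q \<omega> x * a_sol f q \<omega> x * z_sol q (2 * \<omega>) x * of_real (chi x / x))"
      proof (rule conv)
        show "(\<lambda>x. z_sol q \<omega> x * a_sol f q \<omega> x) \<in> borel_measurable I01" for \<omega>
          using z_zt_measurable am by simp
        show "cmod (z_sol q (\<Omega> n) x * a_sol f q (\<Omega> n) x) \<le> M * A" if "x \<in> {0<..<1}" for n x
          unfolding norm_mult by (intro mult_mono zb ab that) (use M in auto)
      qed (intro tendsto_mult zt at')
      show "(\<lambda>n. LINT x|I01. (z_sol q (\<Omega> n) x)\<^sup>2 * z_sol q (2 * \<Omega> n) x * of_real (chi x / x)) \<longlonglongrightarrow>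
          (LINT x|I01. (z_sol q \<omega> x)\<^sup>2 * z_sol q (2 * \<omega>) x * of_real (chi x / x))"
      proof (rule conv)
        show "(\<lambda>x. (z_sol q \<omega> x)\<^sup>2) \<in> borel_measurable I01" for \<omega>
          using z_zt_measurable by simp
        show "cmod ((z_sol q (\<Omega> n) x)\<^sup>2) \<le> M\<^sup>2" if "x \<in> {0<..<1}" for n x
          unfolding norm_power by (intro power_mono zb that) auto
      qed (intro tendsto_power zt)
      show "(\<lambda>n. LINT x|I01. (a_sol f q (\<Omega> n) x)\<^sup>2 * z_sol q (2 * \<Omega> n) x * of_real (chi x / x)) \<longlonglongrightarrow>
          (LINT x|I01. (a_sol f q \<omega> x)\<^sup>2 * z_sol q (2 * \<omega>) x * of_real (chi x / x))"
      proof (rule conv)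
        show "(\<lambda>x. (a_sol f q \<omega> x)\<^sup>2) \<in> borel_measurable I01" for \<omega>
          using am by simp
        show "cmod ((a_sol f q (\<Omega> n) x)\<^sup>2) \<le> A\<^sup>2" if "x \<in> {0<..<1}" for n x
          unfolding norm_power by (intro power_mono ab that) auto
      qed (intro tendsto_power at')
    qed
  qed
  then show ?thesis by (simp add: continuous_on_sequentially)
qed

end

section \<open>A perturbed quadratic equation\<close>

text \<open>The ball of functions vanishing linearly at 0, on which division by x is harmless. The
  bound holds everywhere on (0, 1), matching the pointwise form of
  \<open>weighted_contraction\<close>.\<close>

definition lin_bounded :: "real \<Rightarrow> (real \<Rightarrow> complex) \<Rightarrow> bool" where
  "lin_bounded R u \<longleftrightarrow> u \<in> borel_measurable I01 \<and> (\<forall>x\<in>{0<..<1}. cmod (u x) \<le> R * x)"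

lemma lin_boundedD:
  assumes "lin_bounded R u"
  shows "u \<in> borel_measurable I01" "x \<in> {0<..<1} \<Longrightarrow> cmod (u x) \<le> R * x"
    "0 \<le> R \<Longrightarrow> x \<in> {0<..<1} \<Longrightarrow> cmod (u x) \<le> R" "0 \<le> R \<Longrightarrow> u \<in> L2"
proof -
  show "u \<in> borel_measurable I01" using assms by (simp add: lin_bounded_def)
  show b: "cmod (u x) \<le> R * x" if "x \<in> {0<..<1}" for x
    using assms that by (auto simp: lin_bounded_def)
  show c: "cmod (u x) \<le> R" if "0 \<le> R" "x \<in> {0<..<1}" for x
    using b[OF that(2)] mult_left_le[of x R] that by auto
  show "u \<in> L2" if "0 \<le> R"
    using assms c[OF that] by (intro L2_bounded[of u R] AE_I01I) (auto simp: lin_bounded_def)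
qed

text \<open>Here M bounds |z|/x, |a|/x and |m|, and r0^2 bounds the discriminant from below. The
  root satisfies |s0| \<le> M^3 / r0 and s stays within distance 1 of it, so s z, a and p account
  for the three summands, as multiples of x.\<close>

definition quad_R :: "real \<Rightarrow> real \<Rightarrow> real" where
  "quad_R M r0 = (M ^ 3 / r0 + 1) * M + M + 1"

text \<open>Radius of the weighted ball. The part of the Newton remainder due to leaving the base
  point u0 is then at most r0 / 2 per unit distance.\<close>

definition quad_eps :: "real \<Rightarrow> real \<Rightarrow> real" where
  "quad_eps M r0 = min 1 (r0 / (4 * M\<^sup>2 * (M + 1)))"

text \<open>Weight of p relative to s. A small weight keeps the part of the Newton remainder due to
  p within the other half, r0 / 2.\<close>

definition quad_kappa :: "real \<Rightarrow> real \<Rightarrow> real" where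
  "quad_kappa M r0 = min 1 (r0 / (4 * M * quad_R M r0))"

text \<open>The Lipschitz constant allowed for N. The first bound makes the p-component contract by
  1/2, the second keeps its first displacement within half the radius.\<close>

definition quad_eta :: "real \<Rightarrow> real \<Rightarrow> real" where
  "quad_eta M r0 = min (quad_kappa M r0 / (2 * (M + 1))) (quad_eps M r0 * quad_kappa M r0 / (2 * quad_R M r0))"

lemma quad_constants:
  assumes "1 \<le> M" "0 < r0"
  shows "1 \<le> quad_R M r0" "0 < quad_eps M r0" "quad_eps M r0 \<le> 1" "0 < quad_kappa M r0" "quad_kappa M r0 \<le> 1"
    "0 < quad_eta M r0" "quad_eta M r0 * (M + 1) \<le> quad_kappa M r0 / 2"
    "quad_eta M r0 * quad_R M r0 \<le> quad_eps M r0 * quad_kappa M r0 / 2"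
    "2 * M\<^sup>2 * (M + 1) * quad_eps M r0 \<le> r0 / 2" "2 * M * quad_R M r0 * quad_kappa M r0 \<le> r0 / 2"
proof -
  show R: "1 \<le> quad_R M r0" using assms by (simp add: quad_R_def)
  show e: "0 < quad_eps M r0" "quad_eps M r0 \<le> 1" and k: "0 < quad_kappa M r0" "quad_kappa M r0 \<le> 1"
    using assms R by (auto simp: quad_eps_def quad_kappa_def)
  then show "0 < quad_eta M r0" using assms R by (auto simp: quad_eta_def)
  have "quad_eta M r0 \<le> quad_kappa M r0 / (2 * (M + 1))" by (simp add: quad_eta_def)
  then show "quad_eta M r0 * (M + 1) \<le> quad_kappa M r0 / 2" using assms by (simp add: field_simps)
  have "quad_eta M r0 \<le> quad_eps M r0 * quad_kappa M r0 / (2 * quad_R M r0)" by (simp add: quad_eta_def)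
  then show "quad_eta M r0 * quad_R M r0 \<le> quad_eps M r0 * quad_kappa M r0 / 2" using R by (simp add: field_simps)
  have "quad_eps M r0 \<le> r0 / (4 * M\<^sup>2 * (M + 1))" by (simp add: quad_eps_def)
  moreover have "0 < 4 * M\<^sup>2 * (M + 1)" using assms by simp
  ultimately have "quad_eps M r0 * (4 * M\<^sup>2 * (M + 1)) \<le> r0" by (simp add: pos_le_divide_eq)
  then show "2 * M\<^sup>2 * (M + 1) * quad_eps M r0 \<le> r0 / 2" by (simp add: mult_ac)
  have "quad_kappa M r0 \<le> r0 / (4 * M * quad_R M r0)" by (simp add: quad_kappa_def)
  moreover have "0 < 4 * M * quad_R M r0" using assms R by simp
  ultimately have "quad_kappa M r0 * (4 * M * quad_R M r0) \<le> r0" by (simp add: pos_le_divide_eq)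
  then show "2 * M * quad_R M r0 * quad_kappa M r0 \<le> r0 / 2" by (simp add: mult_ac)
qed

text \<open>The root is written as -C / (B + r), which stays meaningful for A = 0, with the sign of
  the square root r chosen so that the denominator is at least |r|. The bound on s is thus
  insensitive to small A.\<close>

lemma complex_quadratic_root:
  fixes A B C :: complex
  assumes "B\<^sup>2 - A * C \<noteq> 0"
  obtains s r where "r\<^sup>2 = B\<^sup>2 - A * C" "A * s + B = r" "A * s\<^sup>2 + 2 * B * s + C = 0" "cmod s \<le> cmod C / cmod r"
proof -
  define r1 where "r1 = csqrt (B\<^sup>2 - A * C)"
  define r where "r = (if cmod (B + r1) \<ge> cmod r1 then r1 else - r1)"
  have r2: "r\<^sup>2 = B\<^sup>2 - A * C" by (simp add: r_def r1_def)
  then have r0: "r \<noteq> 0" using assms by auto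
  \<comment> \<open>B + r1 and B - r1 differ by 2 r1, so one of them has modulus at least
    |r1|.\<close>
  have "2 * cmod r1 \<le> cmod (B + r1) + cmod (B - r1)"
    using norm_triangle_ineq4[of "B + r1" "B - r1"] by (simp add: norm_mult flip: mult_2)
  then have ge: "cmod r \<le> cmod (B + r)" by (auto simp: r_def)
  then have nz: "B + r \<noteq> 0" using r0 by auto
  define s where "s = - C / (B + r)"
  have sB: "s * (B + r) = - C" using nz by (simp add: s_def)
  have "(A * s + B - r) * (B + r) = A * (s * (B + r)) + (B\<^sup>2 - r\<^sup>2)" by (simp add: algebra_simps power2_eq_square)
  also have "\<dots> = 0" unfolding sB r2 by simp
  finally have 1: "A * s + B = r" using nz by simp
  have "A * s\<^sup>2 + 2 * B * s + C = s * (A * s + B) + B * s + C" by (simp add: algebra_simps power2_eq_square)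
  also have "\<dots> = s * (B + r) + C" unfolding 1 by (simp add: algebra_simps)
  finally have 2: "A * s\<^sup>2 + 2 * B * s + C = 0" by (simp add: sB)
  have "cmod s = cmod C / cmod (B + r)" by (simp add: s_def norm_divide)
  also have "\<dots> \<le> cmod C / cmod r" using ge r0 nz by (intro divide_left_mono) auto
  finally show thesis using that[OF r2 1 2] by blast
qed

text \<open>The unknown is the pair of a scalar \<open>s\<close>, stored at \<open>None\<close>, and a function \<open>p\<close>. The scalar is
  updated by a Newton step for the quadratic equation at its simple root \<open>s0\<close> for \<open>p = 0\<close>, where the
  derivative is \<open>2 r\<close>; the nonvanishing discriminant makes the combined map a contraction.\<close>

lemma quadratic_fixed_point:
  fixes z a m :: "real \<Rightarrow> complex" and N :: "(real \<Rightarrow> complex) \<Rightarrow> real \<Rightarrow> complex"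
  assumes M: "1 \<le> M" and r0: "0 < r0"
    and meas: "z \<in> borel_measurable I01" "a \<in> borel_measurable I01" "m \<in> borel_measurable I01"
    and z: "\<And>x. x \<in> {0<..<1} \<Longrightarrow> cmod (z x) \<le> M * x"
    and a: "\<And>x. x \<in> {0<..<1} \<Longrightarrow> cmod (a x) \<le> M * x"
    and m: "AE x in I01. cmod (m x) \<le> M"
    and discr: "r0\<^sup>2 \<le> cmod ((LINT x|I01. m x * (z x * a x))\<^sup>2 - (LINT x|I01. m x * (z x)\<^sup>2) * (LINT x|I01. m x * (a x)\<^sup>2))"
    and Nm: "\<And>u. lin_bounded (quad_R M r0) u \<Longrightarrow> N u \<in> borel_measurable I01"
    and Nb: "\<And>u x. lin_bounded (quad_R M r0) u \<Longrightarrow> x \<in> {0<..<1} \<Longrightarrow>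
       cmod (N u x) \<le> quad_eta M r0 * quad_R M r0 * x"
    and Nl: "\<And>u v d x. lin_bounded (quad_R M r0) u \<Longrightarrow> lin_bounded (quad_R M r0) v \<Longrightarrow> 0 \<le> d \<Longrightarrow>
       (\<And>x. x \<in> {0<..<1} \<Longrightarrow> cmod (u x - v x) \<le> d * x) \<Longrightarrow>
       x \<in> {0<..<1} \<Longrightarrow> cmod (N u x - N v x) \<le> quad_eta M r0 * d * x"
  shows "\<exists>s u. lin_bounded (quad_R M r0) u \<and> (\<forall>x\<in>{0<..<1}. u x = s * z x + a x - N u x) \<and>
    (LINT x|I01. m x * (u x)\<^sup>2) = 0"
proof -
  define R \<epsilon> \<kappa> \<eta> where "R = quad_R M r0" and "\<epsilon> = quad_eps M r0" and "\<kappa> = quad_kappa M r0" and "\<eta> = quad_eta M r0"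
  note c = quad_constants[OF M r0, folded R_def \<epsilon>_def \<kappa>_def \<eta>_def]
  note Nm = Nm[folded R_def] and Nb = Nb[folded R_def \<eta>_def] and Nl = Nl[folded R_def \<eta>_def]
  define A B C where "A = (LINT x|I01. m x * (z x)\<^sup>2)" and "B = (LINT x|I01. m x * (z x * a x))"
    and "C = (LINT x|I01. m x * (a x)\<^sup>2)"
  have intg: "integrable I01 (\<lambda>x. m x * g x)"
    and intb: "cmod (LINT x|I01. m x * g x) \<le> M * K"
    if "g \<in> borel_measurable I01" "\<And>x. x \<in> {0<..<1} \<Longrightarrow> cmod (g x) \<le> K" for g K
  proof -
    have b: "AE x in I01. cmod (m x * g x) \<le> M * K"
      using m by (rule AE_I01_mp) (use that(2) M in \<open>auto simp: norm_mult intro!: mult_mono\<close>)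
    show "cmod (LINT x|I01. m x * g x) \<le> M * K" by (rule I01_norm_le_const[OF b])
    show "integrable I01 (\<lambda>x. m x * g x)"
      by (rule I01.integrable_const_bound[OF b]) (use that meas in simp)
  qed
  have le1: "L * x \<le> L" if "0 \<le> L" "x \<in> {0<..<1}" for L x :: real
    using that by (simp add: mult_left_le)
  have z1: "cmod (z x) \<le> M" and a1: "cmod (a x) \<le> M" if "x \<in> {0<..<1}" for x
    using z[OF that] a[OF that] le1[of M x] M that by linarith+
  have ii: "integrable I01 (\<lambda>x. m x * (z x)\<^sup>2)" "integrable I01 (\<lambda>x. m x * (z x * a x))" "integrable I01 (\<lambda>x. m x * (a x)\<^sup>2)"
  proof -
    show "integrable I01 (\<lambda>x. m x * (z x)\<^sup>2)"
      by (rule intg[where K = "M\<^sup>2"]) (use meas z1 in \<open>auto simp: norm_power intro!: power_mono\<close>)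
    show "integrable I01 (\<lambda>x. m x * (z x * a x))"
      by (rule intg[where K = "M * M"]) (use meas z1 a1 M in \<open>auto simp: norm_mult intro!: mult_mono\<close>)
    show "integrable I01 (\<lambda>x. m x * (a x)\<^sup>2)"
      by (rule intg[where K = "M\<^sup>2"]) (use meas a1 in \<open>auto simp: norm_power intro!: power_mono\<close>)
  qed
  have disc: "r0\<^sup>2 \<le> cmod (B\<^sup>2 - A * C)" using discr by (simp add: A_def B_def C_def)
  moreover have "0 < r0\<^sup>2" using r0 by simp
  ultimately have "0 < cmod (B\<^sup>2 - A * C)" by linarith
  then have "B\<^sup>2 - A * C \<noteq> 0" by simp
  then obtain s0 r where r: "r\<^sup>2 = B\<^sup>2 - A * C" "A * s0 + B = r" "A * s0\<^sup>2 + 2 * B * s0 + C = 0"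
    and s0: "cmod s0 \<le> cmod C / cmod r" by (rule complex_quadratic_root)
  have "r0\<^sup>2 \<le> (cmod r)\<^sup>2" using disc by (simp flip: r(1) add: norm_power)
  then have rr: "r0 \<le> cmod r" by (rule power2_le_imp_le) simp
  then have rnz: "r \<noteq> 0" using r0 by auto
  have "cmod C \<le> M * M\<^sup>2" unfolding C_def
    by (rule intb) (use meas a1 in \<open>auto simp: norm_power intro!: power_mono\<close>)
  then have "cmod C / cmod r \<le> M ^ 3 / r0"
    using rr r0 M by (intro frac_le) (auto simp: power3_eq_cube power2_eq_square)
  with s0 have s0b: "cmod s0 \<le> M ^ 3 / r0" by linarith
  define D where "D = insert None (Some ` {0<..<1::real})"
  \<comment> \<open>The factor x in the second weight keeps p among the functions vanishing linearly
    at 0.\<close>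
  define w where "w = (\<lambda>i. case i of None \<Rightarrow> 1 | Some x \<Rightarrow> \<kappa> * (x::real))"
  define f0 where "f0 = (\<lambda>i::real option. case i of None \<Rightarrow> s0 | Some x \<Rightarrow> 0)"
  define U where "U f x = f None * z x + a x - f (Some x)" for f :: "real option \<Rightarrow> complex" and x
  \<comment> \<open>The Newton step uses the derivative frozen at s0, so a single lower bound on |r|
    serves every iterate.\<close>
  define F where "F = (\<lambda>f i. case i of None \<Rightarrow> f None - (LINT x|I01. m x * (U f x)\<^sup>2) / (2 * r)
      | Some x \<Rightarrow> if x \<in> {0<..<1} then N (U f) x else 0)"
  define P where "P f \<longleftrightarrow> (\<lambda>x. f (Some x)) \<in> borel_measurable I01" for f :: "real option \<Rightarrow> complex"
  define u0 where "u0 x = s0 * z x + a x" for x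
  have Um: "U f \<in> borel_measurable I01" if "P f" for f
    using that meas unfolding P_def U_def by simp
  have near: "cmod (U f x - u0 x) \<le> \<epsilon> * (M + 1)" "cmod (U f x) \<le> R * x" "cmod (U f x) \<le> R"
    if "\<And>i. i \<in> D \<Longrightarrow> cmod (f i - f0 i) \<le> \<epsilon> * w i" and x: "x \<in> {0<..<1}" for f x
  proof -
    have s: "cmod (f None - s0) \<le> \<epsilon>" using that(1)[of None] by (simp add: D_def f0_def w_def)
    have p: "cmod (f (Some x)) \<le> \<epsilon> * (\<kappa> * x)" using that(1)[of "Some x"] x by (simp add: D_def f0_def w_def)
    have "\<kappa> * x \<le> x" using c(5) x by simp
    then have "\<epsilon> * (\<kappa> * x) \<le> \<epsilon> * x" using c(2) by (intro mult_left_mono) auto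
    with p have p: "cmod (f (Some x)) \<le> \<epsilon> * x" by linarith
    have "cmod (U f x - u0 x) = cmod ((f None - s0) * z x - f (Some x))" by (simp add: U_def u0_def algebra_simps)
    also have "\<dots> \<le> cmod (f None - s0) * cmod (z x) + cmod (f (Some x))" by (metis norm_mult norm_triangle_ineq4)
    also have "\<dots> \<le> \<epsilon> * (M * x) + \<epsilon> * x" by (intro add_mono mult_mono s z x p) (use c in auto)
    also have "\<dots> = \<epsilon> * (M + 1) * x" by (simp add: algebra_simps)
    finally have 1: "cmod (U f x - u0 x) \<le> \<epsilon> * (M + 1) * x" .
    also have "\<dots> \<le> \<epsilon> * (M + 1)" by (rule le1) (use c M x in auto)
    finally show "cmod (U f x - u0 x) \<le> \<epsilon> * (M + 1)" .
    have "cmod (u0 x) \<le> cmod s0 * cmod (z x) + cmod (a x)" unfolding u0_def by (metis norm_mult norm_triangle_ineq)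
    also have "\<dots> \<le> M ^ 3 / r0 * (M * x) + M * x" by (intro add_mono mult_mono s0b z a x) (use M r0 in auto)
    finally have "cmod (u0 x) \<le> M ^ 3 / r0 * (M * x) + M * x" .
    moreover have "\<epsilon> * (M + 1) * x \<le> 1 * (M + 1) * x" by (intro mult_right_mono c) (use M x in auto)
    ultimately have "cmod (U f x) \<le> (M ^ 3 / r0 * (M * x) + M * x) + (M + 1) * x"
      using 1 norm_triangle_ineq[of "u0 x" "U f x - u0 x"] by simp
    also have "\<dots> = R * x" by (simp add: R_def quad_R_def algebra_simps)
    finally show "cmod (U f x) \<le> R * x" .
    also have "\<dots> \<le> R" by (rule le1) (use c(1) x in auto)
    finally show "cmod (U f x) \<le> R" .
  qed
  have Ulb: "lin_bounded R (U f)" if "P f" "\<And>i. i \<in> D \<Longrightarrow> cmod (f i - f0 i) \<le> \<epsilon> * w i" for f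
    using Um[OF that(1)] near(2)[OF that(2)] by (simp add: lin_bounded_def)
  have f0near: "cmod (f0 i - f0 i) \<le> \<epsilon> * w i" if "i \<in> D" for i
    using that c by (auto simp: D_def w_def)
  have Uf0: "U f0 = u0" by (auto simp: U_def u0_def f0_def)
  have f0v: "f0 None = s0" "f0 (Some x) = 0" for x by (simp_all add: f0_def)
  have Pf0: "P f0" by (simp add: P_def f0_def)
  have u0m: "u0 \<in> borel_measurable I01" using Um[OF Pf0] by (simp add: Uf0)
  have u0b: "cmod (u0 x) \<le> R" if "x \<in> {0<..<1}" for x using near(3)[OF f0near that] by (simp add: Uf0)
  have Q0: "(LINT x|I01. m x * (u0 x)\<^sup>2) = 0"
  proof -
    have "(LINT x|I01. m x * (u0 x)\<^sup>2) = (LINT x|I01. s0\<^sup>2 * (m x * (z x)\<^sup>2) + 2 * s0 * (m x * (z x * a x)) + m x * (a x)\<^sup>2)"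
      by (simp add: u0_def algebra_simps power2_eq_square)
    also have "\<dots> = s0\<^sup>2 * A + 2 * s0 * B + C" using ii by (simp add: A_def B_def C_def)
    finally show ?thesis using r(3) by (simp add: mult_ac)
  qed
  \<comment> \<open>Half the derivative of the quadratic at its root, namely A s0 + B.\<close>
  have zu0: "(LINT x|I01. m x * (z x * u0 x)) = r"
  proof -
    have "(LINT x|I01. m x * (z x * u0 x)) = (LINT x|I01. s0 * (m x * (z x)\<^sup>2) + m x * (z x * a x))"
      by (simp add: u0_def algebra_simps power2_eq_square)
    also have "\<dots> = s0 * A + B" using ii by (simp add: A_def B_def)
    finally show ?thesis using r(2) by (simp add: mult_ac)
  qed
  have zu0i: "integrable I01 (\<lambda>x. m x * (z x * u0 x))"
    by (rule intg[where K = "M * R"]) (use meas u0m z1 u0b M in \<open>auto simp: norm_mult intro!: mult_mono\<close>)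
  have "\<exists>f. P f \<and> (\<forall>i\<in>D. cmod (f i - f0 i) \<le> \<epsilon> * w i) \<and> (\<forall>i\<in>D. F f i = f i)"
  proof (rule weighted_contraction)
    show "P (F f)" if f: "P f" "\<And>i. i \<in> D \<Longrightarrow> cmod (f i - f0 i) \<le> \<epsilon> * w i" for f
    proof -
      show ?thesis unfolding P_def
        by (rule measurable_I01_cong[OF Nm[OF Ulb[OF f]]]) (auto simp: F_def)
    qed
    show "P f" if "\<And>n. P (X n)" "\<And>i. (\<lambda>n. X n i) \<longlonglongrightarrow> f i" for X :: "nat \<Rightarrow> real option \<Rightarrow> complex" and f
      unfolding P_def by (rule borel_measurable_LIMSEQ_metric[where f = "\<lambda>n x. X n (Some x)"]) (use that in \<open>auto simp: P_def\<close>)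
    show "F f i = f0 i" if "i \<notin> D" for f i
      using that by (cases i) (auto simp: D_def F_def f0_def)
    show "cmod (F f0 i - f0 i) \<le> \<epsilon> / 2 * w i" if i: "i \<in> D" for i
    proof (cases i)
      case None
      then show ?thesis using c by (simp add: F_def Uf0 Q0 f0v w_def)
    next
      case (Some x)
      then have x: "x \<in> {0<..<1}" using i by (auto simp: D_def)
      have "cmod (N u0 x) \<le> \<eta> * R * x"
        unfolding Uf0[symmetric] by (intro Nb Ulb Pf0 f0near x)
      also have "\<dots> \<le> \<epsilon> * \<kappa> / 2 * x" by (rule mult_right_mono[OF c(8)]) (use x in simp)
      finally show ?thesis using Some x by (simp add: F_def Uf0 f0v w_def)
    qed
  next
    fix f g d i
    assume f: "P f" "\<And>i. i \<in> D \<Longrightarrow> cmod (f i - f0 i) \<le> \<epsilon> * w i"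
      and g: "P g" "\<And>i. i \<in> D \<Longrightarrow> cmod (g i - f0 i) \<le> \<epsilon> * w i"
      and d: "0 \<le> d" "\<And>i. i \<in> D \<Longrightarrow> cmod (f i - g i) \<le> d * w i" and i: "i \<in> D"
    have ds: "cmod (f None - g None) \<le> d" using d(2)[of None] by (simp add: D_def w_def)
    have dp: "cmod (f (Some x) - g (Some x)) \<le> d * \<kappa> * x" if "x \<in> {0<..<1}" for x
      using d(2)[of "Some x"] that by (simp add: D_def w_def)
    show "cmod (F f i - F g i) \<le> d / 2 * w i"
    proof (cases i)
      case None
      \<comment> \<open>The difference of the squares of \<open>U f\<close> and \<open>U g\<close>
        is 2 (f None - g None) z u0, whose integral against m is cancelled exactly by the Newton
        step, plus this remainder. Its first term is small because both functions are near u0, its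
        second because p carries the weight \<kappa>.\<close>
      define T where "T x = (f None - g None) * (z x * ((U f x - u0 x) + (U g x - u0 x))) - (f (Some x) - g (Some x)) * (U f x + U g x)" for x
      have Tm: "T \<in> borel_measurable I01" unfolding T_def[abs_def] using f(1) g(1) Um[OF f(1)] Um[OF g(1)] u0m meas
        by (simp add: P_def)
      have Tb: "cmod (T x) \<le> d * (M * (\<epsilon> * (M + 1) + \<epsilon> * (M + 1))) + (d * \<kappa>) * (R + R)" if x: "x \<in> {0<..<1}" for x
      proof -
        have "d * \<kappa> * x \<le> d * \<kappa>" by (rule le1) (use d c x in auto)
        then have dp': "cmod (f (Some x) - g (Some x)) \<le> d * \<kappa>" using dp[OF x] by linarith
        have 1: "cmod ((U f x - u0 x) + (U g x - u0 x)) \<le> \<epsilon> * (M + 1) + \<epsilon> * (M + 1)"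
          by (rule order_trans[OF norm_triangle_ineq add_mono[OF near(1)[OF f(2) x] near(1)[OF g(2) x]]])
        have 2: "cmod (U f x + U g x) \<le> R + R"
          by (rule order_trans[OF norm_triangle_ineq add_mono[OF near(3)[OF f(2) x] near(3)[OF g(2) x]]])
        have "cmod (T x) \<le> cmod (f None - g None) * (cmod (z x) * cmod ((U f x - u0 x) + (U g x - u0 x)))
            + cmod (f (Some x) - g (Some x)) * cmod (U f x + U g x)"
          unfolding T_def by (metis norm_mult norm_triangle_ineq4)
        also have "\<dots> \<le> d * (M * (\<epsilon> * (M + 1) + \<epsilon> * (M + 1))) + (d * \<kappa>) * (R + R)"
          by (intro add_mono mult_mono ds dp' 1 2 z1 x) (use d c M in auto)
        finally show ?thesis .
      qed
      have qi: "integrable I01 (\<lambda>x. m x * (U f x)\<^sup>2)" "integrable I01 (\<lambda>x. m x * (U g x)\<^sup>2)"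
        by (rule intg[where K = "R\<^sup>2"]; use Um[OF f(1)] Um[OF g(1)] near(3)[OF f(2)] near(3)[OF g(2)] in \<open>auto simp: norm_power intro!: power_mono\<close>)+
      have "(LINT x|I01. m x * (U f x)\<^sup>2) - (LINT x|I01. m x * (U g x)\<^sup>2) = (LINT x|I01. m x * (U f x)\<^sup>2 - m x * (U g x)\<^sup>2)"
        using qi by simp
      also have "\<dots> = (LINT x|I01. m x * T x + 2 * (f None - g None) * (m x * (z x * u0 x)))"
        by (rule Bochner_Integration.integral_cong[OF refl]) (simp add: T_def U_def power2_eq_square algebra_simps)
      also have "\<dots> = (LINT x|I01. m x * T x) + 2 * (f None - g None) * r"
        using intg[OF Tm Tb] zu0i by (simp add: zu0)
      finally have eq: "(LINT x|I01. m x * (U f x)\<^sup>2) - (LINT x|I01. m x * (U g x)\<^sup>2) = (LINT x|I01. m x * T x) + 2 * (f None - g None) * r" .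
      have "F f i - F g i = (f None - g None) - ((LINT x|I01. m x * (U f x)\<^sup>2) - (LINT x|I01. m x * (U g x)\<^sup>2)) / (2 * r)"
        using None by (simp add: F_def diff_divide_distrib)
      also have "\<dots> = - (LINT x|I01. m x * T x) / (2 * r)"
        unfolding eq using rnz by (simp add: field_simps)
      finally have "cmod (F f i - F g i) = cmod (LINT x|I01. m x * T x) / (2 * cmod r)"
        by (simp add: norm_divide norm_mult)
      also have "\<dots> \<le> (d * r0) / (2 * r0)"
      proof (rule frac_le)
        have "cmod (LINT x|I01. m x * T x) \<le> M * (d * (M * (\<epsilon> * (M + 1) + \<epsilon> * (M + 1))) + (d * \<kappa>) * (R + R))"
          by (rule intb[OF Tm Tb])
        also have "\<dots> = d * (2 * M\<^sup>2 * (M + 1) * \<epsilon> + 2 * M * R * \<kappa>)" by (simp add: algebra_simps power2_eq_square)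
        also have "\<dots> \<le> d * r0" by (rule mult_left_mono[OF _ d(1)]) (use c(9,10) in linarith)
        finally show "cmod (LINT x|I01. m x * T x) \<le> d * r0" .
      qed (use rr r0 d in auto)
      also have "\<dots> = d / 2 * w i" using r0 None by (simp add: w_def)
      finally show ?thesis .
    next
      case (Some x)
      then have x: "x \<in> {0<..<1}" using i by (auto simp: D_def)
      have du: "cmod (U f y - U g y) \<le> d * (M + 1) * y" if y: "y \<in> {0<..<1}" for y
      proof -
        have "cmod (U f y - U g y) = cmod ((f None - g None) * z y - (f (Some y) - g (Some y)))"
          by (simp add: U_def algebra_simps)
        also have "\<dots> \<le> cmod (f None - g None) * cmod (z y) + cmod (f (Some y) - g (Some y))"
          by (metis norm_mult norm_triangle_ineq4)
        also have "\<dots> \<le> d * (M * y) + d * \<kappa> * y" by (intro add_mono mult_mono ds z dp y) (use d in auto)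
        also have "d * \<kappa> * y \<le> d * 1 * y" by (intro mult_right_mono mult_left_mono c) (use d y in auto)
        finally show ?thesis by (simp add: algebra_simps)
      qed
      have "cmod (N (U f) x - N (U g) x) \<le> \<eta> * (d * (M + 1)) * x"
        by (rule Nl[OF Ulb[OF f] Ulb[OF g] _ du x]) (use d M in auto)
      also have "\<dots> = (\<eta> * (M + 1)) * (d * x)" by simp
      also have "\<dots> \<le> \<kappa> / 2 * (d * x)" by (rule mult_right_mono[OF c(7)]) (use d x in auto)
      finally show ?thesis using Some x by (simp add: F_def w_def mult_ac)
    qed
  qed (use c Pf0 in \<open>auto simp: D_def w_def\<close>)
  then obtain f where f: "P f" "\<And>i. i \<in> D \<Longrightarrow> cmod (f i - f0 i) \<le> \<epsilon> * w i" "\<And>i. i \<in> D \<Longrightarrow> F f i = f i" by blast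
  have "F f None = f None" by (rule f(3)) (simp add: D_def)
  then have Q: "(LINT x|I01. m x * (U f x)\<^sup>2) = 0" using rnz by (simp add: F_def)
  have "f (Some x) = N (U f) x" if "x \<in> {0<..<1}" for x
    using f(3)[of "Some x"] that by (auto simp: D_def F_def)
  then have "U f x = f None * z x + a x - N (U f) x" if "x \<in> {0<..<1}" for x
    using that by (simp add: U_def)
  with Q show ?thesis using Ulb[OF f(1,2)] unfolding R_def by blast
qed

section \<open>Solving the nonlinear system\<close>

lemma H2_diamond_zero: "(\<lambda>x. 0) \<in> H2_diamond" "AE x in I01. weak_deriv 2 (\<lambda>x. 0) x = 0"
proof -
  have z: "(\<lambda>x. 0) x = 0 * of_real x + volterra (\<lambda>x. 0) x" for x by (simp add: volterra_def)
  note v = volterra_weak_deriv[OF L2_const[of 0] z]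
  show "(\<lambda>x. 0) \<in> H2_diamond" using v(4) by (simp add: H2_diamond_def)
  show "AE x in I01. weak_deriv 2 (\<lambda>x. 0) x = 0" by (rule weak_deriv_props(3)[OF L2_const v(1)])
qed

lemma H2_diamond_L2: "u \<in> H2_diamond \<Longrightarrow> u \<in> L2"
  by (simp add: H2_diamond_def H2_def)

text \<open>Even for the zero function \<open>weak_deriv 2\<close> is a choice, known to vanish only
  almost everywhere, which suffices under the integral.\<close>

lemma inner_H2_zero:
  assumes "u \<in> H2_diamond" shows "inner_H2 (\<lambda>x. 0) u = 0"
proof -
  have "inner_L2 (weak_deriv 2 (\<lambda>x. 0)) (weak_deriv 2 u) = (LINT x|I01. 0)"
    unfolding inner_L2_def
  proof (rule integral_cong_AE)
    show "(\<lambda>x. weak_deriv 2 (\<lambda>x. 0) x * cnj (weak_deriv 2 u x)) \<in> borel_measurable I01"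
      by (intro borel_measurable_times L2_measurable L2_cnj H2_diamond_representation(1) H2_diamond_zero assms)
    show "AE x in I01. weak_deriv 2 (\<lambda>x. 0) x * cnj (weak_deriv 2 u x) = 0"
      using H2_diamond_zero(2) by eventually_elim simp
  qed simp
  then show ?thesis by (simp add: inner_H2_def inner_L2_def)
qed

lemma integral_cmod_square:
  assumes "u \<in> L2"
  shows "(LINT x|I01. u x * cnj (u x)) = of_real (LINT x|I01. (cmod (u x))\<^sup>2)"
    and "0 \<le> (LINT x|I01. (cmod (u x))\<^sup>2)"
    and "(LINT x|I01. (cmod (u x))\<^sup>2) = 0 \<Longrightarrow> AE x in I01. u x = 0"
proof -
  show "(LINT x|I01. u x * cnj (u x)) = of_real (LINT x|I01. (cmod (u x))\<^sup>2)"
    unfolding complex_norm_square[symmetric] by (simp flip: of_real_power)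
  show "0 \<le> (LINT x|I01. (cmod (u x))\<^sup>2)" by simp
  show "AE x in I01. u x = 0" if "(LINT x|I01. (cmod (u x))\<^sup>2) = 0"
    using that integral_nonneg_eq_0_iff_AE[OF L2_square_integrable[OF assms]] by simp
qed

text \<open>\<open>T_diamond\<close> picks an unspecified representative (g1, g2). Testing with its
  difference (g1, g2 - f) from the target makes a sum of three squared L^2 norms vanish, those of
  g1, its second derivative and g2 - f. Weak derivatives of differences do not arise, because the
  first component of the target is 0.\<close>

lemma T_diamond_eqI:
  assumes f: "f \<in> L2"
    and eq: "\<And>\<phi>. \<phi> \<in> X_diamond \<Longrightarrow> T_form chi1 chi2 q \<omega> u \<phi> = inner_X (\<lambda>x. 0, f) \<phi>"
  shows "eq_X (T_diamond chi1 chi2 q \<omega> u) (\<lambda>x. 0, f)"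
proof -
  let ?P = "\<lambda>g. g \<in> X_diamond \<and> (\<forall>\<phi>\<in>X_diamond. inner_X g \<phi> = T_form chi1 chi2 q \<omega> u \<phi>)"
  have "?P (\<lambda>x. 0, f)" using H2_diamond_zero(1) f eq by (simp add: X_diamond_def)
  then have "?P (T_diamond chi1 chi2 q \<omega> u)" unfolding T_diamond_def by (rule someI)
  then obtain g1 g2 where g: "T_diamond chi1 chi2 q \<omega> u = (g1, g2)" "g1 \<in> H2_diamond" "g2 \<in> L2"
    "\<And>\<phi>. \<phi> \<in> X_diamond \<Longrightarrow> inner_X (g1, g2) \<phi> = inner_X (\<lambda>x. 0, f) \<phi>"
    using eq unfolding X_diamond_def by (metis (no_types, lifting) SigmaE)
  note w = H2_diamond_representation(1)[OF g(2)]
  have d: "(\<lambda>x. g2 x - f x) \<in> L2" by (rule L2_diff[OF g(3) f])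
  have "inner_H2 (\<lambda>x. 0) g1 = 0" by (rule inner_H2_zero[OF g(2)])
  moreover have "inner_X (g1, g2) (g1, \<lambda>x. g2 x - f x) = inner_X (\<lambda>x. 0, f) (g1, \<lambda>x. g2 x - f x)"
    by (rule g(4)) (use g d in \<open>simp add: X_diamond_def\<close>)
  ultimately have "inner_H2 g1 g1 + (inner_L2 g2 (\<lambda>x. g2 x - f x) - inner_L2 f (\<lambda>x. g2 x - f x)) = 0"
    by (simp add: inner_X_def add_diff_eq)
  moreover have "inner_L2 g2 (\<lambda>x. g2 x - f x) - inner_L2 f (\<lambda>x. g2 x - f x) =
      (LINT x|I01. (g2 x - f x) * cnj (g2 x - f x))"
    unfolding inner_L2_def left_diff_distrib
    by (rule Bochner_Integration.integral_diff[symmetric]) (intro L2_mult_integrable L2_cnj d f g)+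
  moreover have "inner_H2 g1 g1 = of_real (LINT x|I01. (cmod (g1 x))\<^sup>2) + of_real (LINT x|I01. (cmod (weak_deriv 2 g1 x))\<^sup>2)"
    unfolding inner_H2_def inner_L2_def
    by (simp add: integral_cmod_square(1)[OF w] integral_cmod_square(1)[OF H2_diamond_L2[OF g(2)]])
  ultimately have "complex_of_real ((LINT x|I01. (cmod (g1 x))\<^sup>2) + (LINT x|I01. (cmod (weak_deriv 2 g1 x))\<^sup>2) +
      (LINT x|I01. (cmod (g2 x - f x))\<^sup>2)) = 0"
    using integral_cmod_square(1)[OF d] by simp
  then have "(LINT x|I01. (cmod (g1 x))\<^sup>2) + (LINT x|I01. (cmod (weak_deriv 2 g1 x))\<^sup>2) +
      (LINT x|I01. (cmod (g2 x - f x))\<^sup>2) = 0"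
    by (simp only: of_real_eq_0_iff)
  with integral_cmod_square(2)[OF w] integral_cmod_square(2)[OF d] integral_cmod_square(2)[OF H2_diamond_L2[OF g(2)]]
  have "(LINT x|I01. (cmod (g1 x))\<^sup>2) = 0" "(LINT x|I01. (cmod (g2 x - f x))\<^sup>2) = 0" by linarith+
  then have "AE x in I01. g1 x = 0" "AE x in I01. g2 x - f x = 0"
    using integral_cmod_square(3)[OF d] integral_cmod_square(3)[OF H2_diamond_L2[OF g(2)]] by auto
  then show ?thesis by (simp add: eq_X_def g(1))
qed

text \<open>One factor g vanishing linearly at 0 cancels 1/x; for the remaining factor b boundedness
  is enough.\<close>

lemma singular_term_bound:
  fixes b g :: "real \<Rightarrow> complex"
  assumes chi: "chi \<in> borel_measurable I01" "AE x in I01. \<bar>chi x\<bar> \<le> K"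
    and b: "b \<in> borel_measurable I01" "\<And>x. x \<in> {0<..<1} \<Longrightarrow> cmod (b x) \<le> B"
    and g: "g \<in> borel_measurable I01" "\<And>x. x \<in> {0<..<1} \<Longrightarrow> cmod (g x) \<le> G * x"
    and w: "cmod w \<le> W"
  shows "(\<lambda>x. w / of_real x * of_real (chi x) * b x * g x) \<in> borel_measurable I01"
    "AE x in I01. cmod (w / of_real x * of_real (chi x) * b x * g x) \<le> W * K * B * G"
proof -
  show "(\<lambda>x. w / of_real x * of_real (chi x) * b x * g x) \<in> borel_measurable I01"
    using chi(1) b(1) g(1) by measurable
  show "AE x in I01. cmod (w / of_real x * of_real (chi x) * b x * g x) \<le> W * K * B * G"
    using chi(2)
  proof (rule AE_I01_mp)
    fix x :: real assume x: "x \<in> {0<..<1}" and K: "\<bar>chi x\<bar> \<le> K"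
    have nn: "0 \<le> B" "0 \<le> W" "0 \<le> K" using order_trans[OF norm_ge_zero b(2)[OF x]] order_trans[OF norm_ge_zero w] K by auto
    have "cmod (w / of_real x * of_real (chi x) * b x * g x) = (cmod w * \<bar>chi x\<bar> * cmod (b x)) * (cmod (g x) / x)"
      using x by (simp add: norm_mult norm_divide)
    also have "\<dots> \<le> (W * K * B) * G"
      by (intro mult_mono w K b x) (use nn x g(2)[OF x] in \<open>auto simp: pos_divide_le_eq\<close>)
    finally show "cmod (w / of_real x * of_real (chi x) * b x * g x) \<le> W * K * B * G" .
  qed
qed

lemma volterra_cong: "(\<And>t. t \<in> {0<..<1} \<Longrightarrow> g t = h t) \<Longrightarrow> volterra g x = volterra h x"
  unfolding volterra_def by (rule I01_integral_cong) simp

lemma cnj_volterra: "cnj (volterra h x) = volterra (\<lambda>t. cnj (h t)) x"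
  using Bochner_Integration.integral_cnj[of I01 "\<lambda>t. of_real (max 0 (x - t)) * h t"] by (simp add: volterra_def)

lemma volterra_lincomb:
  assumes "integrable I01 a" "integrable I01 b" "integrable I01 d"
  shows "volterra (\<lambda>t. \<alpha> * a t + \<beta> * b t + \<gamma> * d t) x = \<alpha> * volterra a x + \<beta> * volterra b x + \<gamma> * volterra d x"
  using assms by (simp add: volterra_add volterra_cmult)

lemma I01_const: "(LINT t|I01. c) = (c :: real)"
  by (simp add: measure_I01)

text \<open>Testing with \<open>\<phi>\<^sub>2\<close> gives the first equation pointwise. Testing with \<open>\<phi>\<^sub>1\<close> gives the adjoint problem
  \<open>u\<^sub>2'' + (2 \<omega>)\<^sup>2 q u\<^sub>2 = - \<omega>\<^sup>2 \<chi>\<^sub>2 u\<^sub>1\<^sup>2 / x\<close> with \<open>u\<^sub>2(1) = u\<^sub>2'(1) = 0\<close>, together with the extra condition \<open>u\<^sub>2(0) = 0\<close>,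
  which is the scalar quadratic equation for the coefficient of \<open>z\<^sub>\<omega>\<close> in \<open>u\<^sub>1\<close>.\<close>

definition quadratic_source :: "complex \<Rightarrow> (real \<Rightarrow> real) \<Rightarrow> (real \<Rightarrow> complex) \<Rightarrow> real \<Rightarrow> complex" where
  "quadratic_source \<omega> chi2 u x = \<omega>\<^sup>2 / of_real x * of_real (chi2 x) * (u x)\<^sup>2"

section \<open>Estimates of the nonlinear terms and recovery of the solution\<close>

context potential
begin

definition second_component :: "complex \<Rightarrow> (real \<Rightarrow> real) \<Rightarrow> (real \<Rightarrow> complex) \<Rightarrow> real \<Rightarrow> complex" where
  "second_component \<omega> chi2 u t = - green_adj (2 * \<omega>) (quadratic_source \<omega> chi2 u) t"

text \<open>The nonlinear term of the first equation after elimination of u2. Its image under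
  \<open>green_op\<close> is the correction p, and being linear in chi1 it is small.\<close>

definition cubic_source ::
  "complex \<Rightarrow> (real \<Rightarrow> real) \<Rightarrow> (real \<Rightarrow> real) \<Rightarrow> (real \<Rightarrow> complex) \<Rightarrow> real \<Rightarrow> complex" where
  "cubic_source \<omega> chi1 chi2 u x = \<omega>\<^sup>2 / of_real x * of_real (chi1 x) * second_component \<omega> chi2 u x * cnj (u x)"

context
  fixes \<omega> :: complex and W B K1 K2 R :: real and chi1 chi2 :: "real \<Rightarrow> real"
  assumes \<omega>: "cmod (\<omega>\<^sup>2) \<le> W" "cmod ((2 * \<omega>)\<^sup>2) * Q \<le> B"
    and chi1: "chi1 \<in> borel_measurable I01" "AE x in I01. \<bar>chi1 x\<bar> \<le> K1"
    and chi2: "chi2 \<in> borel_measurable I01" "AE x in I01. \<bar>chi2 x\<bar> \<le> K2"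
    and R: "0 \<le> R" and K: "0 \<le> K1" "0 \<le> K2"
begin

lemma \<omega>1: "cmod (\<omega>\<^sup>2) * Q \<le> B"
proof -
  have "cmod (\<omega>\<^sup>2) * Q \<le> cmod ((2 * \<omega>)\<^sup>2) * Q"
    by (rule mult_right_mono[OF _ Q_nonneg]) (simp add: norm_power norm_mult power_mult_distrib)
  with \<omega>(2) show ?thesis by linarith
qed

lemma W_nonneg: "0 \<le> W" by (rule order_trans[OF norm_ge_zero \<omega>(1)])

lemma quadratic_source_bounds:
  assumes u: "lin_bounded R u"
  shows "quadratic_source \<omega> chi2 u \<in> borel_measurable I01"
    "AE x in I01. cmod (quadratic_source \<omega> chi2 u x) \<le> W * K2 * R * R"
    "integrable I01 (quadratic_source \<omega> chi2 u)"
proof -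
  have eq: "quadratic_source \<omega> chi2 u = (\<lambda>x. \<omega>\<^sup>2 / of_real x * of_real (chi2 x) * u x * u x)"
    by (simp add: quadratic_source_def fun_eq_iff power2_eq_square)
  note b = singular_term_bound[OF chi2 lin_boundedD(1)[OF u] lin_boundedD(3)[OF u R] lin_boundedD(1)[OF u] lin_boundedD(2)[OF u] \<omega>(1)]
  show 1: "quadratic_source \<omega> chi2 u \<in> borel_measurable I01" unfolding eq by (rule b)
  show 2: "AE x in I01. cmod (quadratic_source \<omega> chi2 u x) \<le> W * K2 * R * R" unfolding eq by (rule b)
  show "integrable I01 (quadratic_source \<omega> chi2 u)"
    by (rule L2_integrable[OF L2_bounded[OF 1 2]])
qed

lemma second_component_bounds:
  assumes u: "lin_bounded R u"
  shows "second_component \<omega> chi2 u \<in> borel_measurable I01"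
    "x \<in> {0..1} \<Longrightarrow> cmod (second_component \<omega> chi2 u x) \<le> 2 * (sol_bound B)\<^sup>2 * (W * K2 * R * R)"
proof -
  note k = quadratic_source_bounds[OF u]
  show "second_component \<omega> chi2 u \<in> borel_measurable I01"
    unfolding second_component_def[abs_def] using green_op_measurable(2)[OF k(3)] by simp
  assume x: "x \<in> {0..1}"
  have "cmod (green_adj (2 * \<omega>) (quadratic_source \<omega> chi2 u) x) \<le> 2 * (sol_bound B)\<^sup>2 * (LINT t|I01. W * K2 * R * R)"
    by (rule green_op_bound(2)[OF k(3) \<omega>(2) x _ k(2)]) simp
  then show "cmod (second_component \<omega> chi2 u x) \<le> 2 * (sol_bound B)\<^sup>2 * (W * K2 * R * R)"
    by (simp add: second_component_def measure_I01)
qed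

lemma cubic_source_bounds:
  assumes u: "lin_bounded R u"
  shows "cubic_source \<omega> chi1 chi2 u \<in> borel_measurable I01"
    "AE x in I01. cmod (cubic_source \<omega> chi1 chi2 u x) \<le> W * K1 * (2 * (sol_bound B)\<^sup>2 * (W * K2 * R * R)) * R"
    "cubic_source \<omega> chi1 chi2 u \<in> L2"
proof -
  have cu: "(\<lambda>x. cnj (u x)) \<in> borel_measurable I01" by (intro L2_measurable L2_cnj lin_boundedD(4)[OF u R])
  note v = second_component_bounds[OF u]
  show 1: "cubic_source \<omega> chi1 chi2 u \<in> borel_measurable I01"
    and 2: "AE x in I01. cmod (cubic_source \<omega> chi1 chi2 u x) \<le> W * K1 * (2 * (sol_bound B)\<^sup>2 * (W * K2 * R * R)) * R"
    unfolding cubic_source_def[abs_def]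
    by (rule singular_term_bound[OF chi1 v(1) v(2) cu _ \<omega>(1)]; use lin_boundedD(2)[OF u] in auto)+
  show "cubic_source \<omega> chi1 chi2 u \<in> L2" by (rule L2_bounded[OF 1 2])
qed

text \<open>A product rule for the cubic term: varying \<open>second_component\<close>, which is
  quadratic in u, contributes two units and varying the conjugate factor one, hence the 3. The Green
  kernel enters twice, once for the second component and once for \<open>green_op\<close>, hence the
  square. K1 enters linearly, which is the source of smallness.\<close>

lemma perturbation_bounds:
  assumes u: "lin_bounded R u" and v: "lin_bounded R v" and d: "0 \<le> d" "\<And>x. x \<in> {0<..<1} \<Longrightarrow> cmod (u x - v x) \<le> d * x"
    and x: "x \<in> {0<..<1}"
  defines "\<eta> \<equiv> 3 * (2 * (sol_bound B)\<^sup>2)\<^sup>2 * W\<^sup>2 * K2 * R\<^sup>2 * K1"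
  shows "cmod (green_op \<omega> (cubic_source \<omega> chi1 chi2 u) x) \<le> \<eta> * R * x"
    and "cmod (green_op \<omega> (cubic_source \<omega> chi1 chi2 u) x - green_op \<omega> (cubic_source \<omega> chi1 chi2 v) x) \<le> \<eta> * d * x"
proof -
  define G where "G = 2 * (sol_bound B)\<^sup>2"
  have G: "0 \<le> G" by (simp add: G_def)
  have x': "x \<in> {0..1}" using x by auto
  let ?h = "cubic_source \<omega> chi1 chi2" and ?k = "quadratic_source \<omega> chi2" and ?v = "second_component \<omega> chi2"
  note hu = cubic_source_bounds[OF u, folded G_def] and hv = cubic_source_bounds[OF v, folded G_def]
  note hui = L2_integrable[OF hu(3)] and hvi = L2_integrable[OF hv(3)]
  have \<eta>: "\<eta> = G * (3 * W\<^sup>2 * G * K2 * R\<^sup>2 * K1)" by (simp add: \<eta>_def G_def power2_eq_square)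
  have "cmod (green_op \<omega> (?h u) x) \<le> G * (LINT t|I01. W * K1 * (G * (W * K2 * R * R)) * R) * x"
    unfolding G_def by (rule green_op_bound(1)[OF hui \<omega>1 x' _ hu(2)[unfolded G_def]]) simp
  \<comment> \<open>The size of one term needs only a third of \<eta>; the same constant serves both
    conclusions.\<close>
  also have "\<dots> = 1 / 3 * (\<eta> * R * x)" by (simp add: \<eta> measure_I01 power2_eq_square)
  also have "\<dots> \<le> \<eta> * R * x"
    using W_nonneg R K G x by (auto simp: \<eta> intro!: mult_left_le_one_le mult_nonneg_nonneg)
  finally show "cmod (green_op \<omega> (?h u) x) \<le> \<eta> * R * x" .
  note ku = quadratic_source_bounds[OF u] and kv = quadratic_source_bounds[OF v]
  have kd: "AE y in I01. cmod (?k u y - ?k v y) \<le> W * K2 * (R + R) * d"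
  proof -
    have "AE y in I01. cmod (\<omega>\<^sup>2 / of_real y * of_real (chi2 y) * (u y + v y) * (u y - v y)) \<le> W * K2 * (R + R) * d"
    proof (rule singular_term_bound(2)[OF chi2 _ _ _ d(2) \<omega>(1)])
      show "cmod (u y + v y) \<le> R + R" if "y \<in> {0<..<1}" for y
        by (rule order_trans[OF norm_triangle_ineq add_mono[OF lin_boundedD(3)[OF u R that] lin_boundedD(3)[OF v R that]]])
    qed (use lin_boundedD(1)[OF u] lin_boundedD(1)[OF v] in auto)
    moreover have "?k u y - ?k v y = \<omega>\<^sup>2 / of_real y * of_real (chi2 y) * (u y + v y) * (u y - v y)" for y
      by (simp add: quadratic_source_def algebra_simps power2_eq_square diff_divide_distrib)
    ultimately show ?thesis by simp
  qed
  have vd: "cmod (?v u y - ?v v y) \<le> G * (W * K2 * (R + R) * d)" if y: "y \<in> {0..1}" for y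
  proof -
    have "?v u y - ?v v y = - green_adj (2 * \<omega>) (\<lambda>x. ?k u x - ?k v x) y"
      unfolding second_component_def green_adj_def right_diff_distrib
      using green_mult_integrable(2)[OF ku(3) y] green_mult_integrable(2)[OF kv(3) y] by simp
    moreover have "cmod (green_adj (2 * \<omega>) (\<lambda>x. ?k u x - ?k v x) y) \<le> 2 * (sol_bound B)\<^sup>2 * (LINT t|I01. W * K2 * (R + R) * d)"
      by (rule green_op_bound(2)[OF _ \<omega>(2) y _ kd]) (use ku kv in auto)
    ultimately show ?thesis by (simp add: G_def measure_I01)
  qed
  have cm: "(\<lambda>x. cnj (u x)) \<in> borel_measurable I01" "(\<lambda>x. cnj (u x - v x)) \<in> borel_measurable I01"
    by (intro L2_measurable L2_cnj L2_diff lin_boundedD(4)[OF u R] lin_boundedD(4)[OF v R])+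
  note vu = second_component_bounds[OF u] and vv = second_component_bounds[OF v]
  have t1: "AE y in I01. cmod (\<omega>\<^sup>2 / of_real y * of_real (chi1 y) * (?v u y - ?v v y) * cnj (u y)) \<le> W * K1 * (G * (W * K2 * (R + R) * d)) * R"
    by (rule singular_term_bound(2)[OF chi1 _ _ cm(1) _ \<omega>(1)]) (use vu vv vd lin_boundedD(2)[OF u] in auto)
  have t2: "AE y in I01. cmod (\<omega>\<^sup>2 / of_real y * of_real (chi1 y) * ?v v y * cnj (u y - v y)) \<le> W * K1 * (G * (W * K2 * R * R)) * d"
    by (rule singular_term_bound(2)[OF chi1 vv(1) _ cm(2) _ \<omega>(1)]) (use vv(2) d(2) in \<open>auto simp: G_def simp del: complex_cnj_diff\<close>)
  have hd: "AE y in I01. cmod (?h u y - ?h v y) \<le> W * K1 * (G * (W * K2 * (R + R) * d)) * R + W * K1 * (G * (W * K2 * R * R)) * d"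
    using t1 t2
  proof eventually_elim
    case (elim y)
    have "?h u y - ?h v y = \<omega>\<^sup>2 / of_real y * of_real (chi1 y) * (?v u y - ?v v y) * cnj (u y) +
       \<omega>\<^sup>2 / of_real y * of_real (chi1 y) * ?v v y * cnj (u y - v y)"
      by (simp add: cubic_source_def algebra_simps diff_divide_distrib)
    then show ?case using order_trans[OF norm_triangle_ineq add_mono[OF elim]] by simp
  qed
  have diff: "green_op \<omega> (?h u) x - green_op \<omega> (?h v) x = green_op \<omega> (\<lambda>y. ?h u y - ?h v y) x"
    unfolding green_op_def right_diff_distrib
    using green_mult_integrable(1)[OF hui x'] green_mult_integrable(1)[OF hvi x'] by simp
  have "cmod (green_op \<omega> (\<lambda>y. ?h u y - ?h v y) x) \<le> G * (LINT t|I01. W * K1 * (G * (W * K2 * (R + R) * d)) * R + W * K1 * (G * (W * K2 * R * R)) * d) * x"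
    unfolding G_def by (rule green_op_bound(1)[OF _ \<omega>1 x' _ hd[unfolded G_def]]) (use hui hvi in auto)
  also have "\<dots> = \<eta> * d * x"
  proof -
    define T where "T = W\<^sup>2 * G * K2 * R\<^sup>2 * K1 * d"
    have "W * K1 * (G * (W * K2 * (R + R) * d)) * R = 2 * T" "W * K1 * (G * (W * K2 * R * R)) * d = T"
      unfolding T_def power2_eq_square mult_2[symmetric, of R] by (simp_all only: mult_ac)
    moreover have "\<eta> * d = G * (3 * T)" unfolding \<eta> T_def by (simp only: mult_ac)
    ultimately show ?thesis unfolding I01_const by simp
  qed
  finally show "cmod (green_op \<omega> (?h u) x - green_op \<omega> (?h v) x) \<le> \<eta> * d * x" by (simp only: diff)
qed

text \<open>The fixed point u is controlled only on the open interval and through integrals, so its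
  representative U in \<open>H2_diamond\<close> is rebuilt from the second derivative. The
  \<phi>2-part of the form is then an identity almost everywhere; in the \<phi>1-part everything is
  moved onto the second derivative of \<phi>1.\<close>

lemma fixed_point_solves_form:
  assumes f: "f \<in> L2" and u: "lin_bounded R u"
    and fixpt: "\<And>x. x \<in> {0<..<1} \<Longrightarrow> u x = s * z_sol q \<omega> x + a_sol f q \<omega> x - green_op \<omega> (cubic_source \<omega> chi1 chi2 u) x"
    and orth: "(LINT x|I01. z_sol q (2 * \<omega>) x * quadratic_source \<omega> chi2 u x) = 0"
  shows "\<exists>U\<in>X_diamond. \<forall>\<phi>\<in>X_diamond. T_form chi1 chi2 q \<omega> U \<phi> = inner_X (\<lambda>x. 0, f) \<phi>"
proof -
  define k h v where "k = quadratic_source \<omega> chi2 u" and "h = cubic_source \<omega> chi1 chi2 u"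
    and "v = second_component \<omega> chi2 u"
  note kb = quadratic_source_bounds[OF u, folded k_def] and hb = cubic_source_bounds[OF u, folded h_def]
  note fi = L2_integrable[OF f] and hi = L2_integrable[OF hb(3)] and ki = kb(3)
  note u2 = lin_boundedD(4)[OF u R]
  note ui = L2_integrable[OF u2]
  have zi: "integrable I01 (z_sol q \<omega>)" by (rule I01_continuous_integrable[OF solves_ivp_continuous[OF z_sol]])
  note goL2 = green_op_L2(1)[OF fi, of \<omega>] green_op_L2(1)[OF hi, of \<omega>]
  have v2: "v \<in> L2" using L2_cmult[OF green_op_L2(2)[OF ki, of "2 * \<omega>"], of "- 1"]
    by (simp add: v_def second_component_def[abs_def] k_def)
  have qu2: "(\<lambda>x. of_real (q x) * u x) \<in> L2"
    by (rule L2_mult_bounded[OF u2 I01_continuous_measurable[OF qc], where B = Q]) (auto intro!: AE_I01I q_le)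
  \<comment> \<open>The second derivative of u that the first equation dictates.\<close>
  define H where "H = (\<lambda>x. (f x - h x) - \<omega>\<^sup>2 * (of_real (q x) * u x))"
  have H2: "H \<in> L2" unfolding H_def by (intro L2_diff L2_cmult f hb(3) qu2)
  define U where "U = (\<lambda>x. s * of_real x + volterra H x)"
  have Uu: "U x = u x" if x: "x \<in> {0<..<1}" for x
  proof -
    have x': "x \<in> {0..1}" using x by auto
    \<comment> \<open>Each of the three parts of u satisfies its own Volterra equation; by linearity
      they combine to one for u, whose right-hand side is s x plus the twofold integral of
      H.\<close>
    have "volterra (\<lambda>t. of_real (q t) * u t) x =
      volterra (\<lambda>t. s * (of_real (q t) * z_sol q \<omega> t) + 1 * (of_real (q t) * green_op \<omega> f t) + (- 1) * (of_real (q t) * green_op \<omega> h t)) x"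
    proof (rule volterra_cong)
      fix t :: real assume t: "t \<in> {0<..<1}"
      then have "a_sol f q \<omega> t = green_op \<omega> f t" by (intro a_sol_eq_green_op L2_measurable f) auto
      then show "of_real (q t) * u t = s * (of_real (q t) * z_sol q \<omega> t) + 1 * (of_real (q t) * green_op \<omega> f t) + (- 1) * (of_real (q t) * green_op \<omega> h t)"
        unfolding fixpt[OF t] h_def by (simp add: algebra_simps)
    qed
    also have "\<dots> = s * volterra (\<lambda>t. of_real (q t) * z_sol q \<omega> t) x + 1 * volterra (\<lambda>t. of_real (q t) * green_op \<omega> f t) x
        + (- 1) * volterra (\<lambda>t. of_real (q t) * green_op \<omega> h t) x"
      by (intro volterra_lincomb q_mult_integrable zi L2_integrable goL2)
    finally have V: "volterra (\<lambda>t. of_real (q t) * u t) x = s * volterra (\<lambda>t. of_real (q t) * z_sol q \<omega> t) x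
      + 1 * volterra (\<lambda>t. of_real (q t) * green_op \<omega> f t) x + (- 1) * volterra (\<lambda>t. of_real (q t) * green_op \<omega> h t) x" .
    have qu: "\<omega>\<^sup>2 * volterra (\<lambda>t. of_real (q t) * u t) x = s * (\<omega>\<^sup>2 * volterra (\<lambda>t. of_real (q t) * z_sol q \<omega> t) x)
      + \<omega>\<^sup>2 * volterra (\<lambda>t. of_real (q t) * green_op \<omega> f t) x - \<omega>\<^sup>2 * volterra (\<lambda>t. of_real (q t) * green_op \<omega> h t) x"
      unfolding V by (simp add: algebra_simps)
    have Heq: "H = (\<lambda>x. 1 * f x + (- 1) * h x + (- \<omega>\<^sup>2) * (of_real (q x) * u x))" by (simp add: H_def fun_eq_iff)
    have "volterra H x = 1 * volterra f x + (- 1) * volterra h x + (- \<omega>\<^sup>2) * volterra (\<lambda>t. of_real (q t) * u t) x"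
      unfolding Heq by (intro volterra_lincomb q_mult_integrable fi hi ui)
    moreover have "z_sol q \<omega> x = of_real x - \<omega>\<^sup>2 * volterra (\<lambda>t. of_real (q t) * z_sol q \<omega> t) x"
      using solves_ivp_integral_equation[OF z_sol x'] by simp
    moreover have "u x = s * z_sol q \<omega> x + green_op \<omega> f x - green_op \<omega> h x"
      using fixpt[OF x] a_sol_eq_green_op[OF L2_measurable[OF f] x'] by (simp add: h_def)
    ultimately show ?thesis
      using green_op_volterra[OF fi x', of \<omega>] green_op_volterra[OF hi x', of \<omega>] qu
      unfolding U_def by algebra
  qed
  note Uw = volterra_weak_deriv[OF H2, of U s]
  have UH: "is_weak_deriv 2 U H" "U \<in> H2" using Uw(1,4) by (auto simp: U_def)
  have UX: "U \<in> H2_diamond" using UH(2) by (simp add: H2_diamond_def U_def volterra_0)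
  note wU = weak_deriv_props[OF H2 UH(1)]
  \<comment> \<open>The second equation reads v'' = -P. With zero Cauchy data at 1 it becomes
    \<open>vP\<close> below, which is free of derivatives of v.\<close>
  define P where "P = (\<lambda>x. k x + 4 * \<omega>\<^sup>2 * (of_real (q x) * v x))"
  have P2: "P \<in> L2" unfolding P_def
    by (intro L2_add L2_cmult L2_bounded[OF kb(1,2)] L2_mult_bounded[OF v2 I01_continuous_measurable[OF qc], where B = Q])
       (auto intro!: AE_I01I q_le)
  note Pi = L2_integrable[OF P2]
  have vP: "v t = - volterra_adj P t" if t: "t \<in> {0..1}" for t
  proof -
    have qg: "integrable I01 (\<lambda>s. of_real (q s) * green_adj (2 * \<omega>) k s)"
      by (intro q_mult_integrable L2_integrable green_op_L2(2) ki)
    have "volterra_adj P t = (LINT x|I01. of_real (max 0 (x - t)) * k x + (- (2 * \<omega>)\<^sup>2) * (of_real (max 0 (x - t)) * (of_real (q x) * green_adj (2 * \<omega>) k x)))"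
      unfolding volterra_adj_def P_def v_def second_component_def k_def[symmetric] by (simp add: algebra_simps)
    also have "\<dots> = volterra_adj k t - (2 * \<omega>)\<^sup>2 * volterra_adj (\<lambda>s. of_real (q s) * green_adj (2 * \<omega>) k s) t"
      unfolding volterra_adj_def using max_kernel_integrable(2)[OF ki, of t] max_kernel_integrable(2)[OF qg, of t] by simp
    also have "\<dots> = - v t"
      using green_adj_volterra[OF ki t, of "2 * \<omega>"] by (simp add: v_def second_component_def k_def)
    finally show ?thesis by simp
  qed
  have "v 0 = 0" using orth by (simp add: v_def second_component_def green_adj_0)
  \<comment> \<open>The representation of v at 0 is minus the first moment of P, so v(0) = 0 says
    that the free slope c of \<phi>1 contributes nothing.\<close>
  then have P0: "(LINT x|I01. of_real x * P x) = 0"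
  proof -
    assume "v 0 = 0"
    have "(LINT x|I01. of_real x * P x) = volterra_adj P 0"
      unfolding volterra_adj_def by (rule I01_integral_cong) simp
    with \<open>v 0 = 0\<close> vP[of 0] show ?thesis by simp
  qed
  have "T_form chi1 chi2 q \<omega> (U, v) (\<phi>1, \<phi>2) = inner_X (\<lambda>x. 0, f) (\<phi>1, \<phi>2)"
    if \<phi>: "\<phi>1 \<in> H2_diamond" "\<phi>2 \<in> L2" for \<phi>1 \<phi>2
  proof -
    have hv: "h x = \<omega>\<^sup>2 / of_real x * of_real (chi1 x) * v x * cnj (u x)" for x
      by (simp add: h_def cubic_source_def v_def)
    have "(LINT x|I01. (weak_deriv 2 U x + \<omega>\<^sup>2 * of_real (q x) * U x) * cnj (\<phi>2 x)
        + \<omega>\<^sup>2 / of_real x * of_real (chi1 x) * v x * cnj (U x) * cnj (\<phi>2 x)) = (LINT x|I01. f x * cnj (\<phi>2 x))"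
    proof (rule integral_cong_AE)
      have [measurable]: "weak_deriv 2 U \<in> borel_measurable I01" "U \<in> borel_measurable I01"
        "(\<lambda>x. cnj (U x)) \<in> borel_measurable I01" "v \<in> borel_measurable I01" "f \<in> borel_measurable I01"
        "(\<lambda>x. cnj (\<phi>2 x)) \<in> borel_measurable I01" "chi1 \<in> borel_measurable I01" "q \<in> borel_measurable I01"
        by (intro L2_measurable L2_cnj wU H2_diamond_L2[OF UX] v2 f \<phi> chi1 I01_continuous_measurable q_cont)+
      show "(\<lambda>x. (weak_deriv 2 U x + \<omega>\<^sup>2 * of_real (q x) * U x) * cnj (\<phi>2 x)
        + \<omega>\<^sup>2 / of_real x * of_real (chi1 x) * v x * cnj (U x) * cnj (\<phi>2 x)) \<in> borel_measurable I01"
        "(\<lambda>x. f x * cnj (\<phi>2 x)) \<in> borel_measurable I01" by measurable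
      show "AE x in I01. (weak_deriv 2 U x + \<omega>\<^sup>2 * of_real (q x) * U x) * cnj (\<phi>2 x)
        + \<omega>\<^sup>2 / of_real x * of_real (chi1 x) * v x * cnj (U x) * cnj (\<phi>2 x) = f x * cnj (\<phi>2 x)"
        using wU(3)
      proof (rule AE_I01_mp)
        fix x :: real assume x: "x \<in> {0<..<1}" and H: "weak_deriv 2 U x = H x"
        show "(weak_deriv 2 U x + \<omega>\<^sup>2 * of_real (q x) * U x) * cnj (\<phi>2 x)
          + \<omega>\<^sup>2 / of_real x * of_real (chi1 x) * v x * cnj (U x) * cnj (\<phi>2 x)
          = f x * cnj (\<phi>2 x)"
          unfolding H Uu[OF x] by (simp add: H_def hv algebra_simps)
      qed
    qed
    moreover
    define S where "S = (\<lambda>t. cnj (weak_deriv 2 \<phi>1 t))"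
    have S2: "S \<in> L2" unfolding S_def by (intro L2_cnj H2_diamond_representation \<phi>)
    note Si = L2_integrable[OF S2]
    obtain c where c: "\<And>x. x \<in> {0..1} \<Longrightarrow> \<phi>1 x = c * of_real x + volterra (weak_deriv 2 \<phi>1) x"
      using H2_diamond_representation(2)[OF \<phi>(1)] by blast
    have c\<phi>1: "cnj (\<phi>1 x) = cnj c * of_real x + volterra S x" if "x \<in> {0..1}" for x
      using c[OF that] by (simp add: S_def cnj_volterra)
    have "(LINT x|I01. v x * (cnj (weak_deriv 2 \<phi>1 x) + 4 * \<omega>\<^sup>2 * of_real (q x) * cnj (\<phi>1 x))
        + \<omega>\<^sup>2 / of_real x * of_real (chi2 x) * (U x)\<^sup>2 * cnj (\<phi>1 x)) = 0"
    proof -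
      have iv: "integrable I01 (\<lambda>x. v x * S x)" by (rule L2_mult_integrable[OF v2 S2])
      have ix: "integrable I01 (\<lambda>x. of_real x * P x)"
        using L2_mult_integrable[OF L2_continuous[of "\<lambda>x. complex_of_real x"] P2] by (simp add: continuous_intros)
      have iV: "integrable I01 (\<lambda>x. P x * volterra S x)"
        by (rule L2_mult_integrable[OF P2 L2_continuous[OF volterra_continuous[OF Si]]])
      have "(LINT x|I01. v x * (cnj (weak_deriv 2 \<phi>1 x) + 4 * \<omega>\<^sup>2 * of_real (q x) * cnj (\<phi>1 x))
        + \<omega>\<^sup>2 / of_real x * of_real (chi2 x) * (U x)\<^sup>2 * cnj (\<phi>1 x)) =
        (LINT x|I01. v x * S x + (cnj c * (of_real x * P x) + P x * volterra S x))"
      proof (rule I01_integral_cong)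
        fix x :: real assume x: "x \<in> {0<..<1}"
        then have x': "x \<in> {0..1}" by auto
        have kx: "\<omega>\<^sup>2 / of_real x * of_real (chi2 x) * (u x)\<^sup>2 = k x" by (simp add: k_def quadratic_source_def)
        show "v x * (cnj (weak_deriv 2 \<phi>1 x) + 4 * \<omega>\<^sup>2 * of_real (q x) * cnj (\<phi>1 x))
          + \<omega>\<^sup>2 / of_real x * of_real (chi2 x) * (U x)\<^sup>2 * cnj (\<phi>1 x) =
          v x * S x + (cnj c * (of_real x * P x) + P x * volterra S x)"
          unfolding Uu[OF x] kx c\<phi>1[OF x'] by (simp add: P_def S_def algebra_simps)
      qed
      also have "\<dots> = (LINT x|I01. v x * S x) + (LINT x|I01. P x * volterra S x)"
        using iv ix iV by (simp add: P0)
      \<comment> \<open>Fubini transposes \<open>volterra\<close> into \<open>volterra_adj\<close>;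
        by \<open>vP\<close> this term is minus the integral of v S and cancels the other
        one.\<close>
      also have "(LINT x|I01. P x * volterra S x) = (LINT t|I01. (LINT x|I01. P x * of_real (max 0 (x - t))) * S t)"
        unfolding volterra_def
      proof (rule I01_Fubini[OF Pi _ _ Si])
        show "(\<lambda>(x, t). complex_of_real (max 0 (x - t))) \<in> borel_measurable (I01 \<Otimes>\<^sub>M I01)"
          unfolding case_prod_beta by (intro I01_pair_measurable_continuous continuous_intros)
        show "cmod (complex_of_real (max 0 (x - t))) \<le> 1" if "0 < x" "x < 1" "0 < t" "t < 1" for x t
          using that by simp
      qed
      also have "\<dots> = (LINT t|I01. - (v t * S t))"
        by (rule I01_integral_cong) (simp add: vP volterra_adj_def mult.commute)
      finally show ?thesis by simp
    qed
    ultimately show ?thesis using inner_H2_zero[OF \<phi>(1)] by (simp add: T_form_def inner_X_def inner_L2_def)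
  qed
  then show ?thesis using UX v2 by (intro bexI[of _ "(U, v)"]) (auto simp: X_diamond_def)
qed

end

end

text \<open>The set is compact and positive distance from the zeros keeps the continuous function
  \<open>zeta_det\<close> away from 0 there. The bound is written as a square because r0 is to bound
  the square root of the discriminant.\<close>

lemma G_set_zeta_bound:
  assumes cont: "continuous_on UNIV (zeta_det f q chi)" and "0 < \<delta>"
  shows "\<exists>r0>0. \<forall>\<omega>\<in>G_set f q chi \<rho> \<delta>. r0\<^sup>2 \<le> cmod (zeta_det f q chi \<omega>)"
proof (cases "G_set f q chi \<rho> \<delta> = {}")
  case False
  let ?G = "G_set f q chi \<rho> \<delta>"
  have eq: "?G = cball 0 \<rho> \<inter> {\<omega>. \<delta> \<le> infdist \<omega> (Lambda_set f q chi)}"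
    by (auto simp: G_set_def)
  have "compact ?G" unfolding eq
    by (intro compact_Int_closed compact_cball closed_Collect_le continuous_intros)
  moreover have "continuous_on ?G (\<lambda>\<omega>. cmod (zeta_det f q chi \<omega>))"
    by (intro continuous_intros continuous_on_subset[OF cont]) auto
  ultimately obtain \<omega>0 where \<omega>0: "\<omega>0 \<in> ?G" "\<And>\<omega>. \<omega> \<in> ?G \<Longrightarrow> cmod (zeta_det f q chi \<omega>0) \<le> cmod (zeta_det f q chi \<omega>)"
    using continuous_attains_inf[OF _ False] by blast
  have "zeta_det f q chi \<omega>0 \<noteq> 0"
  proof
    assume "zeta_det f q chi \<omega>0 = 0"
    then have "\<omega>0 \<in> Lambda_set f q chi" by (simp add: Lambda_set_def)
    then have "infdist \<omega>0 (Lambda_set f q chi) = 0" by simp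
    with \<omega>0(1) \<open>0 < \<delta>\<close> show False by (simp add: G_set_def)
  qed
  then show ?thesis
    by (intro exI[of _ "sqrt (cmod (zeta_det f q chi \<omega>0))"]) (simp add: \<omega>0(2))
qed (auto intro: exI[of _ 1])

theorem theorem2p10:
  fixes chi\<^sub>2 q :: "real \<Rightarrow> real" and f :: "real \<Rightarrow> complex" and \<rho> \<delta> :: real
  assumes "chi\<^sub>2 \<in> Linf"
    and "continuous_on {0..1} q"
    and "f \<in> L2" and "\<not> (AE x in I01. f x = 0)"
    and "\<rho> > 0" and "\<delta> > 0"
  shows "\<exists>c>0. \<forall>chi\<^sub>1. chi\<^sub>1 \<in> Linf \<and> Linf_norm chi\<^sub>1 < ereal c \<longrightarrow>
           (\<forall>\<omega> \<in> G_set f q chi\<^sub>2 \<rho> \<delta>.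
              \<exists>u \<in> X_diamond. eq_X (T_diamond chi\<^sub>1 chi\<^sub>2 q \<omega> u) (\<lambda>x. 0, f))"
proof -
  have "bounded (q ` {0..1})"
    using assms(2) compact_continuous_image compact_imp_bounded by blast
  then obtain Q where "\<forall>y\<in>q ` {0..1}. norm y \<le> Q" unfolding bounded_iff by blast
  then have Q: "\<And>x. x \<in> {0..1} \<Longrightarrow> \<bar>q x\<bar> \<le> Q" by simp
  interpret potential q Q
    by unfold_locales (use assms(2) Q order_trans[OF abs_ge_zero Q[of 0]] in auto)
  note f = \<open>f \<in> L2\<close>
  note fi = L2_integrable[OF f]
  note chi2m = Linf_AE_bound(1)[OF assms(1)]
  obtain K where K: "0 < K" "AE x in I01. \<bar>chi\<^sub>2 x\<bar> \<le> K" using Linf_AE_bound(3)[OF assms(1)] by blast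
  obtain r0 where r0: "0 < r0" "\<And>\<omega>. \<omega> \<in> G_set f q chi\<^sub>2 \<rho> \<delta> \<Longrightarrow> r0\<^sup>2 \<le> cmod (zeta_det f q chi\<^sub>2 \<omega>)"
    using G_set_zeta_bound[OF zeta_det_continuous[OF fi chi2m K(2)] \<open>\<delta> > 0\<close>] by blast
  \<comment> \<open>Bounds |(2 \<omega>)^2| Q on the disc of radius \<rho>, so it serves the
    frequencies \<omega> and 2 \<omega> alike.\<close>
  define B where "B = 4 * \<rho>\<^sup>2 * Q"
  define sb where "sb = sol_bound B"
  define F where "F = (LINT t|I01. cmod (f t))"
  \<comment> \<open>The summands bound |z| / x, |a| / x and the coefficient m in turn; the sum
    stands in for a maximum.\<close>
  define M where "M = sb + 2 * sb\<^sup>2 * F + sb * K"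
  define R where "R = quad_R M r0"
  \<comment> \<open>The constant of \<open>perturbation_bounds\<close> without its factor K1, which
    will be c.\<close>
  define L where "L = 3 * (2 * sb\<^sup>2)\<^sup>2 * (\<rho>\<^sup>2)\<^sup>2 * K * R\<^sup>2"
  \<comment> \<open>The added 1 avoids a division by zero and still gives L c \<le>
    \<open>quad_eta M r0\<close>.\<close>
  define c where "c = quad_eta M r0 / (L + 1)"
  have sb1: "1 \<le> sb" unfolding sb_def B_def using Q_nonneg by (simp add: sol_bound_def)
  have F0: "0 \<le> F" by (simp add: F_def)
  have M: "1 \<le> M" "sb \<le> M" "2 * sb\<^sup>2 * F \<le> M" "sb * K \<le> M"
  proof -
    have "0 \<le> 2 * sb\<^sup>2 * F" "0 \<le> sb * K" using sb1 F0 K(1) by simp_all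
    then show "1 \<le> M" "sb \<le> M" "2 * sb\<^sup>2 * F \<le> M" "sb * K \<le> M" unfolding M_def using sb1 by linarith+
  qed
  note qc' = quad_constants[OF M(1) r0(1)]
  have R0: "0 \<le> R" using qc'(1) by (simp add: R_def)
  have L0: "0 \<le> L" using K(1) by (simp add: L_def)
  have c0: "0 < c" using qc'(6) L0 by (simp add: c_def)
  have Lc: "L * c \<le> quad_eta M r0"
    using L0 qc'(6) by (simp add: c_def field_simps)
  show ?thesis
  proof (intro exI[of _ c] conjI allI impI ballI c0)
    fix chi1 \<omega> assume chi: "chi1 \<in> Linf \<and> Linf_norm chi1 < ereal c" and \<omega>G: "\<omega> \<in> G_set f q chi\<^sub>2 \<rho> \<delta>"
    then have chi1: "chi1 \<in> borel_measurable I01" "AE x in I01. \<bar>chi1 x\<bar> \<le> c"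
      using Linf_AE_bound by blast+
    have "(cmod \<omega>)\<^sup>2 \<le> \<rho>\<^sup>2" using \<omega>G by (intro power_mono) (auto simp: G_set_def)
    then have W: "cmod (\<omega>\<^sup>2) \<le> \<rho>\<^sup>2" and W2: "cmod ((2 * \<omega>)\<^sup>2) * Q \<le> B"
      unfolding B_def by (auto simp: norm_power norm_mult power_mult_distrib intro!: mult_right_mono Q_nonneg)
    note pars = W W2 chi1 chi2m K(2) R0 less_imp_le[OF c0] less_imp_le[OF K(1)]
    note W1 = \<omega>1[OF pars]
    let ?N = "\<lambda>u. green_op \<omega> (cubic_source \<omega> chi1 chi\<^sub>2 u)"
    \<comment> \<open>With this coefficient the discriminant in \<open>quadratic_fixed_point\<close>
      is exactly \<open>zeta_det\<close>, so the lower bound r0^2 applies.\<close>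
    let ?m = "\<lambda>x. z_sol q (2 * \<omega>) x * of_real (chi\<^sub>2 x / x)"
    have \<eta>: "3 * (2 * (sol_bound B)\<^sup>2)\<^sup>2 * (\<rho>\<^sup>2)\<^sup>2 * K * R\<^sup>2 * c \<le> quad_eta M r0"
      using Lc by (simp add: L_def sb_def)
    have "\<exists>s u. lin_bounded (quad_R M r0) u \<and> (\<forall>x\<in>{0<..<1}. u x = s * z_sol q \<omega> x + a_sol f q \<omega> x - ?N u x) \<and> (LINT x|I01. ?m x * (u x)\<^sup>2) = 0"
    proof (rule quadratic_fixed_point[OF M(1) r0(1) z_zt_measurable(1) a_sol_measurable[OF fi]])
      show "?m \<in> borel_measurable I01" using z_zt_measurable chi2m by simp
      show "cmod (z_sol q \<omega> x) \<le> M * x" if "x \<in> {0<..<1}" for x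
      proof (rule order_trans)
        show "cmod (z_sol q \<omega> x) \<le> sb * x"
          unfolding sb_def by (rule sol_bounds(1)[OF W1]) (use that in auto)
        show "sb * x \<le> M * x" by (rule mult_right_mono[OF M(2)]) (use that in simp)
      qed
      show "cmod (a_sol f q \<omega> x) \<le> M * x" if x: "x \<in> {0<..<1}" for x
        by (rule order_trans[OF a_sol_bound[OF fi W1 x] mult_right_mono[OF M(3)[unfolded sb_def F_def]]]) (use x in simp)
      show "AE x in I01. cmod (?m x) \<le> M"
        using K(2) by (rule AE_I01_mp) (use z_sol_chi_bound[OF W2] M(4) in \<open>fastforce simp: sb_def intro: order_trans\<close>)
      show "r0\<^sup>2 \<le> cmod ((LINT x|I01. ?m x * (z_sol q \<omega> x * a_sol f q \<omega> x))\<^sup>2 -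
          (LINT x|I01. ?m x * (z_sol q \<omega> x)\<^sup>2) * (LINT x|I01. ?m x * (a_sol f q \<omega> x)\<^sup>2))"
        using r0(2)[OF \<omega>G] by (simp add: zeta_det_def mult_ac)
    next
      fix u assume "lin_bounded (quad_R M r0) u"
      then have u: "lin_bounded R u" by (simp add: R_def)
      show "?N u \<in> borel_measurable I01"
        by (rule green_op_measurable(1)[OF L2_integrable[OF cubic_source_bounds(3)[OF pars u]]])
      fix x :: real assume x: "x \<in> {0<..<1}"
      have "cmod (?N u x) \<le> 3 * (2 * (sol_bound B)\<^sup>2)\<^sup>2 * (\<rho>\<^sup>2)\<^sup>2 * K * R\<^sup>2 * c * R * x"
        by (rule perturbation_bounds(1)[OF pars u u, of 0]) (use x in auto)
      also have "\<dots> \<le> quad_eta M r0 * R * x" by (intro mult_right_mono \<eta> R0) (use x in auto)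
      finally show "cmod (?N u x) \<le> quad_eta M r0 * quad_R M r0 * x" by (simp add: R_def)
    next
      fix u v d and x :: real
      assume "lin_bounded (quad_R M r0) u" "lin_bounded (quad_R M r0) v"
        and d: "0 \<le> d" "\<And>x. x \<in> {0<..<1} \<Longrightarrow> cmod (u x - v x) \<le> d * x" and x: "x \<in> {0<..<1}"
      then have u: "lin_bounded R u" and v: "lin_bounded R v" by (simp_all add: R_def)
      have "cmod (?N u x - ?N v x) \<le> 3 * (2 * (sol_bound B)\<^sup>2)\<^sup>2 * (\<rho>\<^sup>2)\<^sup>2 * K * R\<^sup>2 * c * d * x"
        by (rule perturbation_bounds(2)[OF pars u v d x])
      also have "\<dots> \<le> quad_eta M r0 * d * x" by (intro mult_right_mono \<eta> d) (use x in auto)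
      finally show "cmod (?N u x - ?N v x) \<le> quad_eta M r0 * d * x" .
    qed
    then obtain s u where u: "lin_bounded R u"
      and eq: "\<And>x. x \<in> {0<..<1} \<Longrightarrow> u x = s * z_sol q \<omega> x + a_sol f q \<omega> x - ?N u x"
      and Q0: "(LINT x|I01. ?m x * (u x)\<^sup>2) = 0"
      unfolding R_def by blast
    \<comment> \<open>The factor \<omega>^2 of the source leaves the integral, so the root condition
      for m u^2 is the required orthogonality.\<close>
    have "(LINT x|I01. z_sol q (2 * \<omega>) x * quadratic_source \<omega> chi\<^sub>2 u x) = (LINT x|I01. \<omega>\<^sup>2 * (?m x * (u x)\<^sup>2))"
      by (rule Bochner_Integration.integral_cong) (simp_all add: quadratic_source_def)
    also have "\<dots> = \<omega>\<^sup>2 * (LINT x|I01. ?m x * (u x)\<^sup>2)" by (rule integral_mult_right_zero)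
    also have "\<dots> = 0" unfolding Q0 by simp
    finally have orth: "(LINT x|I01. z_sol q (2 * \<omega>) x * quadratic_source \<omega> chi\<^sub>2 u x) = 0" .
    show "\<exists>u\<in>X_diamond. eq_X (T_diamond chi1 chi\<^sub>2 q \<omega> u) (\<lambda>x. 0, f)"
      using fixed_point_solves_form[OF pars f u eq orth] T_diamond_eqI[OF f] by blast
  qed
qed

end
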